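(* Let $n\ge2$ and let $M\subset\mathbb R^n$ be an origin-symmetric star-shaped body such that $\|x\|_M^{-1}$ is a positive definite distribution on $\mathbb R^n$. Let $K,L\subset\mathbb R^n$ be origin-symmetric star-shaped bodies and let $1\le k<n$ be an integer such that for every $H\in G(n,n-k)$ $$\int_{K\cap H}\|x\|_M^k\,dx\le\int_{L\cap H}\|x\|_M^k\,dx.$$ Then $$\mathrm{Vol}_n(K)\le\mathrm{Vol}_n(L).$$
   Context: $G(n,m)$ is the Grassmannian of $m$-dimensional linear subspaces of $\mathbb R^n$; integrals over $K\cap H$ are with respect to Lebesgue measure on $H$. A star-shaped body is a compact set $K\subset\mathbb R^n$, star-shaped with respect to the origin and containing the origin in its interior, whose Minkowski functional $\|x\|_K=\min\{a>0: x\in aK\}$ (for $x\neq 0$, with $\|0\|_K=0$) is continuous and positive on $\mathbb R^n\setminus\{0\}$. The Fourier transform of a tempered distribution $f$ is defined by $\langle\hat f,\phi\rangle=\langle f,\hat\phi\rangle$ for Schwartz functions $\phi$, with $\hat\phi(\xi)=\int\phi(x)e^{-i(x,\xi)}dx$. A distribution $f$ is positive definite iff $\langle\hat f,\phi\rangle\ge0$ for every nonnegative Schwartz function $\phi$. *)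

theory Defs
  imports "HOL-Analysis.Analysis"
begin

definition minkowski_functional :: "'a::euclidean_space set \<Rightarrow> 'a \<Rightarrow> real" where
  "minkowski_functional K x =
     (if x = 0 then 0 else (LEAST a. a > 0 \<and> x \<in> (\<lambda>y. a *\<^sub>R y) ` K))"

definition star_body :: "'a::euclidean_space set \<Rightarrow> bool" where
  "star_body K \<longleftrightarrow>
     compact K \<and> (\<forall>x\<in>K. closed_segment 0 x \<subseteq> K) \<and> 0 \<in> interior K \<and>
     continuous_on (UNIV - {0}) (minkowski_functional K) \<and>
     (\<forall>x. x \<noteq> 0 \<longrightarrow> minkowski_functional K x > 0)"

definition origin_symmetric :: "'a::real_vector set \<Rightarrow> bool" where
  "origin_symmetric K \<longleftrightarrow> uminus ` K = K"

definition grassmannian :: "nat \<Rightarrow> 'a::euclidean_space set set" where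
  "grassmannian m = {H. subspace H \<and> dim H = m}"

definition orthonormal_basis_of :: "'a::euclidean_space set \<Rightarrow> 'a set \<Rightarrow> bool" where
  "orthonormal_basis_of H B \<longleftrightarrow>
     pairwise orthogonal B \<and> (\<forall>b\<in>B. norm b = 1) \<and> span B = H"

lemma ex_orthonormal_basis_of:
  assumes "subspace H"
  shows "\<exists>B. orthonormal_basis_of H B"
  using orthonormal_basis_subspace[OF assms] unfolding orthonormal_basis_of_def by metis

text \<open>
  Lebesgue measure on a linear subspace \<open>H\<close>, as a Borel measure on the ambient space that is
  concentrated on \<open>H\<close>. It is built from an orthonormal basis of \<open>H\<close> in the same way as the
  library builds \<^const>\<open>lborel\<close> from \<^const>\<open>Basis\<close>; by the orthogonal invariance of Lebesgue
  measure the result does not depend on the basis chosen.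
\<close>
definition subspace_lborel :: "'a::euclidean_space set \<Rightarrow> 'a measure" where
  "subspace_lborel H =
     (let B = (SOME B. orthonormal_basis_of H B)
      in distr (\<Pi>\<^sub>M b\<in>B. lborel) borel (\<lambda>c. \<Sum>b\<in>B. c b *\<^sub>R b))"

primrec iterated_partial ::
  "'a::euclidean_space list \<Rightarrow> ('a \<Rightarrow> complex) \<Rightarrow> 'a \<Rightarrow> complex" where
  "iterated_partial [] f = f"
| "iterated_partial (v # vs) f =
     (\<lambda>x. frechet_derivative (iterated_partial vs f) (at x) v)"

definition schwartz :: "('a::euclidean_space \<Rightarrow> complex) \<Rightarrow> bool" where
  "schwartz f \<longleftrightarrow>
     (\<forall>vs. set vs \<subseteq> Basis \<longrightarrow>
        (\<forall>x. iterated_partial vs f differentiable at x) \<and>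
        (\<forall>N::nat. \<exists>C. \<forall>x. (1 + norm x) ^ N * norm (iterated_partial vs f x) \<le> C))"

definition fourier_transform ::
  "('a::euclidean_space \<Rightarrow> complex) \<Rightarrow> 'a \<Rightarrow> complex" where
  "fourier_transform \<phi> \<xi> = (LINT x|lborel. \<phi> x * exp (- \<i> * complex_of_real (x \<bullet> \<xi>)))"

text \<open>
  Distributions are represented by their action on test functions; only the values on Schwartz
  functions matter. The functional below is the tempered distribution given by a locally integrable
  function of at most polynomial growth at infinity. For a star body \<open>M\<close> in dimension at least 2,
  \<open>\<lambda>x. 1 / minkowski_functional M x\<close> is such a function, being bounded by a multiple of
  \<open>1 / norm x\<close>; its value at the origin is irrelevant.
\<close>
definition distribution_of ::
  "('a::euclidean_space \<Rightarrow> real) \<Rightarrow> ('a \<Rightarrow> complex) \<Rightarrow> complex" where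
  "distribution_of f \<phi> = (LINT x|lborel. complex_of_real (f x) * \<phi> x)"

definition fourier_distribution ::
  "(('a::euclidean_space \<Rightarrow> complex) \<Rightarrow> complex) \<Rightarrow> ('a \<Rightarrow> complex) \<Rightarrow> complex" where
  "fourier_distribution T \<phi> = T (fourier_transform \<phi>)"

definition positive_definite_distribution ::
  "(('a::euclidean_space \<Rightarrow> complex) \<Rightarrow> complex) \<Rightarrow> bool" where
  "positive_definite_distribution T \<longleftrightarrow>
     (\<forall>\<phi>. schwartz \<phi> \<and> (\<forall>x. \<phi> x \<in> \<real>\<^sub>\<ge>\<^sub>0) \<longrightarrow> fourier_distribution T \<phi> \<in> \<real>\<^sub>\<ge>\<^sub>0)"

end

theory Submission
  imports Defs "HOL-Probability.Probability" "HOL-Real_Asymp.Real_Asymp"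
begin

text \<open>
  Write \<open>f\<close> for the function sending \<open>x\<close> to \<open>1 / minkowski_functional M x\<close>. Multiplying the
  weight by \<open>f\<close> lowers its exponent by one, so it suffices to pass from all subspaces of
  dimension \<open>m\<close> to all subspaces \<open>H\<close> of dimension \<open>m + 1 \<ge> 2\<close>: if \<open>G\<close> has nonpositive
  integral over every hyperplane of \<open>H\<close>, then \<open>G * f\<close> has nonpositive integral over \<open>H\<close>.

  For a positive definite function \<open>p\<close>, that is, the Fourier transform of a nonnegative \<open>\<Phi>\<close>, the
  slice theorem writes the integral over \<open>H\<close> of \<open>G y * \<integral> p (s y) ds\<close> as an average, weighted
  by \<open>\<Phi>\<close>, of hyperplane integrals of \<open>G\<close>; hence it is nonpositive. This is applied to
  \<open>p = (f * \<gamma>) exp (- \<epsilon>\<^sup>2 |x|\<^sup>2 / 2)\<close> with a Gaussian \<open>\<gamma>\<close>, and only Gaussian test functions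
  are needed to see that it is positive definite. Since \<open>f\<close> is homogeneous of degree \<open>-1\<close>, the
  integral of \<open>p (s y)\<close> over \<open>s\<close> diverges logarithmically as \<open>\<epsilon> \<rightarrow> 0\<close>, with leading
  coefficient proportional to \<open>f y\<close>; dividing by the divergent factor gives the claim in the limit.
\<close>

section \<open>Gaussian integrals\<close>

text \<open>Along a line through the origin, the integral of a function of degree -1 diverges at
  both ends. Smoothing by \<open>\<gamma>\<close> removes the divergence at zero and the Gaussian
  factor the one at infinity. Only the second is relaxed, and the far range that then dominates does
  not feel the smoothing; so the width of \<open>\<gamma>\<close> can stay fixed.

  The distribution is never restricted to a subspace: a frequency acts on \<open>H\<close> only
  through its projection to \<open>H\<close>, so one nonnegative \<open>\<Phi>\<close> on the whole
  space serves every \<open>H\<close>. The condition \<open>m + 1 \<ge> 2\<close> makes the inverse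
  norm locally integrable, both on \<open>H\<close> and after projecting frequencies to
  \<open>H\<close>; these inverse norms dominate all limits below.

  The obstacle is that \<open>G\<close> jumps across the boundaries of the two bodies, while
  hyperplane integrals arise as limits of integrals over thin Gaussian slabs. The limit needs
  \<open>G\<close> continuous almost everywhere on each hyperplane, which holds because the level
  set 1 of a positively homogeneous function is null in every subspace.\<close>

lemma integrable_exp_neg_square:
  fixes a :: real
  assumes "a > 0"
  shows "integrable lborel (\<lambda>x::real. exp (- a * x\<^sup>2 / 2))"
    and "(LINT x|lborel. exp (- a * x\<^sup>2 / 2)) = sqrt (2 * pi / a)"
proof -
  have "exp (- a * x\<^sup>2 / 2) = sqrt (2 * pi / a) * normal_density 0 (1 / sqrt a) x" for x
    using assms by (simp add: normal_density_def power_divide field_simps real_sqrt_mult real_sqrt_divide)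
  then show "integrable lborel (\<lambda>x::real. exp (- a * x\<^sup>2 / 2))"
    and "(LINT x|lborel. exp (- a * x\<^sup>2 / 2)) = sqrt (2 * pi / a)"
    using assms by (simp_all)
qed

lemma nn_integral_exp_neg_square:
  fixes a :: real
  assumes "a > 0"
  shows "(\<integral>\<^sup>+x. ennreal (exp (- a * x\<^sup>2 / 2)) \<partial>lborel) = ennreal (sqrt (2 * pi / a))"
  using integrable_exp_neg_square[OF assms] by (subst nn_integral_eq_integral) auto

lemma fourier_exp_neg_square:
  fixes a t :: real
  assumes "a > 0"
  shows "(LINT x|lborel. complex_of_real (exp (- a * x\<^sup>2 / 2)) * exp (\<i> * complex_of_real (t * x)))
         = complex_of_real (sqrt (2 * pi / a) * exp (- t\<^sup>2 / (2 * a)))"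
proof -
  let ?s = "t / sqrt a"
  have "(LINT x|lborel. complex_of_real (std_normal_density x) * exp (\<i> * complex_of_real (?s * x)))
        = complex_of_real (exp (- ?s\<^sup>2 / 2))"
    using fun_cong[OF char_std_normal_distribution, of ?s]
    by (simp add: char_def integral_density scaleR_conv_of_real mult_ac)
  then have "(LINT x|lborel. complex_of_real (exp (- x\<^sup>2 / 2)) * exp (\<i> * complex_of_real (?s * x)))
        = complex_of_real (sqrt (2 * pi) * exp (- ?s\<^sup>2 / 2))"
    by (simp add: std_normal_density_def field_simps)
  moreover have "(LINT x|lborel. complex_of_real (exp (- x\<^sup>2 / 2)) * exp (\<i> * complex_of_real (?s * x)))
    = sqrt a *\<^sub>R (LINT x|lborel. complex_of_real (exp (- a * x\<^sup>2 / 2)) * exp (\<i> * complex_of_real (t * x)))"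
    using assms by (subst lborel_integral_real_affine[where c="sqrt a" and t=0]) (auto simp: power_mult_distrib)
  moreover have "- ?s\<^sup>2 / 2 = - t\<^sup>2 / (2 * a)"
    using assms by (simp add: power_divide)
  ultimately have "sqrt a *\<^sub>R (LINT x|lborel. complex_of_real (exp (- a * x\<^sup>2 / 2)) * exp (\<i> * complex_of_real (t * x)))
     = complex_of_real (sqrt (2 * pi) * exp (- t\<^sup>2 / (2 * a)))" by metis
  then show ?thesis using assms 
    by (simp add: scaleR_conv_of_real real_sqrt_divide field_simps)
qed

lemma fourier_gaussian:
  fixes v :: "'a::euclidean_space" and a :: real
  assumes "a > 0"
  shows "integrable lborel (\<lambda>x::'a. exp (- a * (norm x)\<^sup>2 / 2))"
    and "(LINT x|lborel. complex_of_real (exp (- a * (norm x)\<^sup>2 / 2)) * exp (\<i> * complex_of_real (v \<bullet> x)))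
         = complex_of_real (sqrt (2 * pi / a) ^ DIM('a) * exp (- (norm v)\<^sup>2 / (2 * a)))"
proof -
  interpret product_sigma_finite "\<lambda>b::'a. lborel :: real measure" ..
  have n: "(norm (\<Sum>b\<in>Basis. c b *\<^sub>R b))\<^sup>2 = (\<Sum>b\<in>Basis. (c b)\<^sup>2)" for c :: "'a \<Rightarrow> real"
    by (subst power2_norm_eq_inner) (simp add: inner_sum_left inner_sum_right inner_Basis if_distrib sum.delta power2_eq_square cong: if_cong)
  have e: "exp (- a * (norm (\<Sum>b\<in>Basis. c b *\<^sub>R b))\<^sup>2 / 2) = (\<Prod>b\<in>Basis. exp (- a * (c b)\<^sup>2 / 2))" for c :: "'a \<Rightarrow> real"
    unfolding n by (simp add: exp_sum[symmetric] sum_distrib_left sum_divide_distrib sum_negf)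
  show int: "integrable lborel (\<lambda>x::'a. exp (- a * (norm x)\<^sup>2 / 2))"
    apply (subst lborel_eq, subst integrable_distr_eq)
      apply (simp_all add: e del: exp_sum)
    apply (subst e[simplified])
    apply (rule product_integrable_prod)
    using integrable_exp_neg_square[OF assms] by auto
  have v: "v \<bullet> (\<Sum>b\<in>Basis. c b *\<^sub>R b) = (\<Sum>b\<in>Basis. (v \<bullet> b) * c b)" for c :: "'a \<Rightarrow> real"
    by (simp add: inner_sum_right mult.commute)
  have "(LINT x|lborel. complex_of_real (exp (- a * (norm x)\<^sup>2 / 2)) * exp (\<i> * complex_of_real (v \<bullet> x)))
    = (LINT c|(\<Pi>\<^sub>M b\<in>Basis. lborel). (\<Prod>b\<in>Basis. complex_of_real (exp (- a * (c b)\<^sup>2 / 2)) * exp (\<i> * complex_of_real ((v \<bullet> b) * c b))))"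
    apply (subst lborel_eq, subst integral_distr)
      apply (measurable)
    unfolding e v by (simp add: prod.distrib sum_distrib_left exp_sum)
  also have "\<dots> = (\<Prod>b\<in>Basis. complex_of_real (sqrt (2 * pi / a) * exp (- (v \<bullet> b)\<^sup>2 / (2 * a))))"
    apply (subst product_integral_prod)
      apply simp
    subgoal for b
      apply (rule Bochner_Integration.integrable_bound[OF integrable_exp_neg_square(1)[OF assms]])
      by (auto simp: norm_mult)
    by (intro prod.cong refl fourier_exp_neg_square assms)
  also have "\<dots> = complex_of_real (sqrt (2 * pi / a) ^ DIM('a) * exp (- (\<Sum>b\<in>Basis. (v \<bullet> b)\<^sup>2) / (2 * a)))"
    by (simp add: prod.distrib exp_sum[symmetric] sum_divide_distrib sum_negf of_real_prod[symmetric] del: of_real_prod)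
  also have "(\<Sum>b\<in>Basis. (v \<bullet> b)\<^sup>2) = (norm v)\<^sup>2"
    using n[of "\<lambda>b. v \<bullet> b"] by (simp add: euclidean_representation)
  finally show "(LINT x|lborel. complex_of_real (exp (- a * (norm x)\<^sup>2 / 2)) * exp (\<i> * complex_of_real (v \<bullet> x)))
         = complex_of_real (sqrt (2 * pi / a) ^ DIM('a) * exp (- (norm v)\<^sup>2 / (2 * a)))" .
qed

text \<open>The real form suffices for the sequel: the kernel is even, so all transforms can be
  written with cosines.\<close>

lemma cos_gaussian:
  fixes v :: "'a::euclidean_space" and a :: real
  assumes "a > 0"
  shows "(LINT x|lborel. exp (- a * (norm x)\<^sup>2 / 2) * cos (v \<bullet> x))
         = sqrt (2 * pi / a) ^ DIM('a) * exp (- (norm v)\<^sup>2 / (2 * a))"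
proof -
  have "integrable lborel (\<lambda>x. complex_of_real (exp (- a * (norm x)\<^sup>2 / 2)) * exp (\<i> * complex_of_real (v \<bullet> x)))"
    by (rule Bochner_Integration.integrable_bound[OF fourier_gaussian(1)[OF assms, where 'a='a]]) (auto simp: norm_mult)
  from integral_Re[OF this] show ?thesis
    unfolding fourier_gaussian(2)[OF assms] by (simp add: Re_exp)
qed

section \<open>Lebesgue measure on subspaces\<close>

definition orthonormal :: "'a::euclidean_space set \<Rightarrow> bool" where
  "orthonormal B \<longleftrightarrow> pairwise orthogonal B \<and> (\<forall>b\<in>B. norm b = 1)"

lemma orthonormal_finite: "orthonormal B \<Longrightarrow> finite B"
  by (simp add: orthonormal_def pairwise_orthogonal_imp_finite)

lemma orthonormal_subset: "orthonormal B \<Longrightarrow> A \<subseteq> B \<Longrightarrow> orthonormal A"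
  by (auto simp: orthonormal_def intro: pairwise_subset)

lemma orthonormal_independent: "orthonormal B \<Longrightarrow> independent B"
  unfolding orthonormal_def by (metis norm_zero pairwise_orthogonal_independent zero_neq_one)

lemma orthonormal_card: "orthonormal B \<Longrightarrow> card B = dim (span B)"
  by (simp add: dim_eq_card_independent orthonormal_independent)

lemma orthonormal_insert_inner_span:
  assumes "orthonormal (insert u B)" "u \<notin> B" "x \<in> span B"
  shows "u \<bullet> x = 0"
  using orthogonal_to_span[OF assms(3), of u] assms(1,2)
  by (auto simp: orthonormal_def pairwise_insert orthogonal_def)

lemma orthonormal_extend:
  assumes "orthonormal A" "subspace H" "A \<subseteq> H"
  obtains E where "A \<subseteq> E" "orthonormal E" "span E = H"
proof -
  obtain U where U: "pairwise orthogonal (A \<union> U)" "span (A \<union> U) = span (A \<union> H)"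
    using orthogonal_extension assms(1) unfolding orthonormal_def by metis
  let ?n = "\<lambda>x::'a. x /\<^sub>R norm x"
  \<comment> \<open>Nothing prevents the orthogonal extension from containing 0, which cannot be
    normalised and is dropped. Vectors of \<open>A\<close> are unchanged by the
    normalisation.\<close>
  define E where "E = ?n ` (A \<union> U - {0})"
  have sp: "span (A \<union> U) = H"
    using U(2) assms(2,3) by (metis span_eq_iff sup.absorb2)
  have "A \<subseteq> E"
  proof
    fix a assume "a \<in> A"
    then have "norm a = 1" using assms(1) by (auto simp: orthonormal_def)
    with \<open>a \<in> A\<close> show "a \<in> E" unfolding E_def by (intro image_eqI[of _ _ a]) auto
  qed
  moreover have "orthonormal E"
    unfolding orthonormal_def
  proof
    show "pairwise orthogonal E"
    proof (rule pairwiseI)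
      fix x y assume "x \<in> E" "y \<in> E" "x \<noteq> y"
      then obtain x' y' where "x' \<in> A \<union> U" "y' \<in> A \<union> U" "x = ?n x'" "y = ?n y'" "x' \<noteq> y'"
        unfolding E_def by blast
      with U(1) have "orthogonal x' y'" by (auto simp: pairwise_def)
      then show "orthogonal x y" using \<open>x = ?n x'\<close> \<open>y = ?n y'\<close> by (simp add: orthogonal_def)
    qed
    show "\<forall>b\<in>E. norm b = 1" unfolding E_def by auto
  qed
  moreover have "span E = H"
  proof
    show "span E \<subseteq> H"
      unfolding sp[symmetric] E_def by (rule span_minimal) (auto intro: span_mul[OF span_base])
    have "A \<union> U \<subseteq> span E"
    proof
      fix x assume x: "x \<in> A \<union> U"
      show "x \<in> span E"
      proof (cases "x = 0")
        case False
        then have "x = norm x *\<^sub>R ?n x" by simp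
        moreover have "?n x \<in> span E" using False x unfolding E_def by (intro span_base) auto
        ultimately show ?thesis using span_mul by metis
      qed (simp add: span_zero)
    qed
    then show "H \<subseteq> span E" unfolding sp[symmetric] by (rule span_minimal) auto
  qed
  ultimately show thesis using that by blast
qed

text \<open>The measure of \<open>subspace_lborel\<close> with the basis as an argument instead of a
  choice, so that it can be studied by inserting one basis vector at a time.\<close>

definition frame_lborel :: "'a::euclidean_space set \<Rightarrow> 'a measure" where
  "frame_lborel B = distr (\<Pi>\<^sub>M b\<in>B. lborel) borel (\<lambda>c. \<Sum>b\<in>B. c b *\<^sub>R b)"

lemma sets_frame_lborel [simp, measurable_cong]: "sets (frame_lborel B) = sets borel"
  by (simp add: frame_lborel_def)

lemma space_frame_lborel [simp]: "space (frame_lborel B) = UNIV"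
  by (simp add: frame_lborel_def)

lemma measurable_frame_sum [measurable]:
  fixes B :: "'a::euclidean_space set"
  shows "(\<lambda>c. \<Sum>b\<in>B. c b *\<^sub>R b) \<in> borel_measurable (\<Pi>\<^sub>M b\<in>B. lborel)"
  by (intro borel_measurable_sum borel_measurable_scaleR) auto

text \<open>The measure lives on the whole ambient space. Identities that hold only on the span can
  be used under the integral because of this.\<close>

lemma AE_frame_lborel_span: "AE x in frame_lborel B. x \<in> span B"
proof -
  have "{x \<in> space borel. x \<in> span B} \<in> sets borel"
    by (simp add: closed_subspace)
  then show ?thesis
    unfolding frame_lborel_def
    by (subst AE_distr_iff) (auto intro!: AE_I2 span_sum span_mul[OF span_base])
qed

lemma nn_integral_frame_lborel_empty:
  assumes [measurable]: "g \<in> borel_measurable borel"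
  shows "(\<integral>\<^sup>+x. g x \<partial>frame_lborel {}) = g 0"
  unfolding frame_lborel_def
  by (subst nn_integral_distr) (auto simp: PiM_empty nn_integral_count_space_finite)

lemma nn_integral_frame_lborel_insert:
  fixes g :: "'a::euclidean_space \<Rightarrow> ennreal"
  assumes [measurable]: "g \<in> borel_measurable borel" and "finite B" "u \<notin> B"
  shows "(\<integral>\<^sup>+x. g x \<partial>frame_lborel (insert u B))
         = (\<integral>\<^sup>+x. \<integral>\<^sup>+t. g (x + t *\<^sub>R u) \<partial>lborel \<partial>frame_lborel B)"
proof -
  interpret product_sigma_finite "\<lambda>b::'a. lborel :: real measure" ..
  have *: "(\<Sum>b\<in>insert u B. (c(u := t)) b *\<^sub>R b) = (\<Sum>b\<in>B. c b *\<^sub>R b) + t *\<^sub>R u" for c t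
    using assms by (auto intro!: sum.cong simp: add.commute)
  have "(\<integral>\<^sup>+x. g x \<partial>frame_lborel (insert u B))
      = (\<integral>\<^sup>+c. g (\<Sum>b\<in>insert u B. c b *\<^sub>R b) \<partial>(\<Pi>\<^sub>M b\<in>insert u B. lborel))"
    unfolding frame_lborel_def by (subst nn_integral_distr) auto
  also have "\<dots> = (\<integral>\<^sup>+c. \<integral>\<^sup>+t. g (\<Sum>b\<in>insert u B. (c(u := t)) b *\<^sub>R b) \<partial>lborel \<partial>(\<Pi>\<^sub>M b\<in>B. lborel))"
    using assms by (subst product_nn_integral_insert) auto
  also have "\<dots> = (\<integral>\<^sup>+x. \<integral>\<^sup>+t. g (x + t *\<^sub>R u) \<partial>lborel \<partial>frame_lborel B)"
    unfolding * frame_lborel_def by (subst nn_integral_distr) auto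
  finally show ?thesis .
qed

lemma orthonormal_insert_norm:
  assumes "orthonormal (insert u B)" "u \<notin> B" "x \<in> span B"
  shows "(norm (x + t *\<^sub>R u))\<^sup>2 = (norm x)\<^sup>2 + t\<^sup>2"
proof -
  have "u \<bullet> u = 1" using assms(1) by (simp add: orthonormal_def norm_eq_1)
  then show ?thesis
    using orthonormal_insert_inner_span[OF assms]
    unfolding power2_norm_eq_inner
    by (simp add: inner_add_left inner_add_right inner_commute power2_eq_square)
qed

lemma nn_integral_frame_lborel_gaussian:
  fixes a :: real
  assumes "orthonormal B" "a > 0"
  shows "(\<integral>\<^sup>+x. ennreal (exp (- a * (norm x)\<^sup>2 / 2)) \<partial>frame_lborel B) = ennreal (sqrt (2 * pi / a) ^ card B)"
  using orthonormal_finite[OF assms(1)] assms(1)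
proof (induction B rule: finite_induct)
  case empty
  then show ?case by (subst nn_integral_frame_lborel_empty) auto
next
  case (insert u B)
  have "(\<integral>\<^sup>+x. ennreal (exp (- a * (norm x)\<^sup>2 / 2)) \<partial>frame_lborel (insert u B))
     = (\<integral>\<^sup>+x. \<integral>\<^sup>+t. ennreal (exp (- a * (norm (x + t *\<^sub>R u))\<^sup>2 / 2)) \<partial>lborel \<partial>frame_lborel B)"
    using insert by (subst nn_integral_frame_lborel_insert) auto
  also have "\<dots> = (\<integral>\<^sup>+x. ennreal (exp (- a * (norm x)\<^sup>2 / 2)) * ennreal (sqrt (2 * pi / a)) \<partial>frame_lborel B)"
  proof (rule nn_integral_cong_AE, use AE_frame_lborel_span in eventually_elim)
    fix x assume x: "x \<in> span B"
    have "exp (- a * (norm (x + t *\<^sub>R u))\<^sup>2 / 2) = exp (- a * (norm x)\<^sup>2 / 2) * exp (- a * t\<^sup>2 / 2)" for t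
      unfolding orthonormal_insert_norm[OF insert.prems insert.hyps(2) x]
      by (simp add: exp_add[symmetric] field_simps)
    then show "(\<integral>\<^sup>+t. ennreal (exp (- a * (norm (x + t *\<^sub>R u))\<^sup>2 / 2)) \<partial>lborel) =
       ennreal (exp (- a * (norm x)\<^sup>2 / 2)) * ennreal (sqrt (2 * pi / a))"
      using nn_integral_exp_neg_square[OF assms(2)]
      by (simp add: ennreal_mult nn_integral_cmult)
  qed
  also have "\<dots> = ennreal (sqrt (2 * pi / a) ^ card (insert u B))"
  proof -
    have "orthonormal B" using orthonormal_subset[OF insert.prems] by blast
    from insert.IH[OF this] show ?thesis
      using insert.hyps assms(2) by (subst nn_integral_multc) (simp_all add: ennreal_mult mult.commute)
  qed
  finally show ?case .
qed

lemma emeasure_frame_lborel_cball: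
  assumes "orthonormal B"
  shows "emeasure (frame_lborel B) (cball 0 r) < \<infinity>"
proof -
  have "emeasure (frame_lborel B) (cball 0 r) = (\<integral>\<^sup>+x. indicator (cball 0 r) x \<partial>frame_lborel B)"
    by simp
  \<comment> \<open>On the ball the Gaussian is at least \<open>exp (- r\<^sup>2 / 2)\<close>, so
    this multiple of it dominates the indicator.\<close>
  also have "\<dots> \<le> (\<integral>\<^sup>+x. ennreal (exp (r\<^sup>2 / 2)) * ennreal (exp (- 1 * (norm x)\<^sup>2 / 2)) \<partial>frame_lborel B)"
  proof (rule nn_integral_mono)
    fix x :: 'a
    have "norm x \<le> r \<Longrightarrow> (norm x)\<^sup>2 \<le> r\<^sup>2" by (intro power_mono) auto
    then show "indicator (cball 0 r) x \<le> ennreal (exp (r\<^sup>2 / 2)) * ennreal (exp (- 1 * (norm x)\<^sup>2 / 2))"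
      by (auto simp: indicator_def ennreal_mult[symmetric] exp_add[symmetric] simp flip: ennreal_1 intro!: ennreal_leI)
  qed
  also have "\<dots> < \<infinity>"
    using nn_integral_frame_lborel_gaussian[OF assms, of 1]
    by (subst nn_integral_cmult) (auto simp: ennreal_mult_less_top)
  finally show ?thesis .
qed

lemma sigma_finite_frame_lborel:
  assumes "orthonormal B"
  shows "sigma_finite_measure (frame_lborel B)"
proof
  let ?A = "range (\<lambda>n::nat. cball 0 (real n) :: 'a set)"
  have "\<Union>?A = UNIV"
    using real_arch_simple by (auto simp: dist_norm)
  moreover have "countable ?A" by auto
  moreover have "\<forall>a\<in>?A. emeasure (frame_lborel B) a \<noteq> \<infinity>"
    using emeasure_frame_lborel_cball[OF assms] by (auto simp: less_top[symmetric])
  ultimately show "\<exists>A. countable A \<and> A \<subseteq> sets (frame_lborel B) \<and> \<Union> A = space (frame_lborel B) \<and>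
      (\<forall>a\<in>A. emeasure (frame_lborel B) a \<noteq> \<infinity>)"
    by (intro exI[of _ ?A]) auto
qed

lemma nn_integral_frame_lborel_translate:
  fixes g :: "'a::euclidean_space \<Rightarrow> ennreal"
  assumes "finite B" "g \<in> borel_measurable borel" "v \<in> span B"
  shows "(\<integral>\<^sup>+x. g (x + v) \<partial>frame_lborel B) = (\<integral>\<^sup>+x. g x \<partial>frame_lborel B)"
  using assms
proof (induction B arbitrary: g v rule: finite_induct)
  case empty
  note [measurable] = empty(1)
  from empty show ?case by (simp add: nn_integral_frame_lborel_empty)
next
  case (insert u B)
  note [measurable] = insert.prems(1)
  \<comment> \<open>The component of \<open>v\<close> along \<open>u\<close> is absorbed by a
    one-dimensional shift; the remainder lies in the span of \<open>B\<close> and is left to the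
    induction hypothesis.\<close>
  obtain k where k: "v - k *\<^sub>R u \<in> span B"
    using insert.prems(2) span_breakdown_eq by blast
  have shift: "(\<integral>\<^sup>+t. h (k + t) \<partial>lborel) = (\<integral>\<^sup>+t. h t \<partial>lborel)" if [measurable]: "h \<in> borel_measurable borel"
    for h :: "real \<Rightarrow> ennreal"
    using nn_integral_real_affine[of h 1 k] by simp
  have "(\<integral>\<^sup>+x. g (x + v) \<partial>frame_lborel (insert u B))
      = (\<integral>\<^sup>+x. \<integral>\<^sup>+t. g (x + (v - k *\<^sub>R u) + (k + t) *\<^sub>R u) \<partial>lborel \<partial>frame_lborel B)"
    using insert.hyps by (subst nn_integral_frame_lborel_insert) (auto simp: algebra_simps)
  also have "\<dots> = (\<integral>\<^sup>+x. (\<lambda>y. \<integral>\<^sup>+t. g (y + t *\<^sub>R u) \<partial>lborel) (x + (v - k *\<^sub>R u)) \<partial>frame_lborel B)"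
    by (subst shift) auto
  also have "\<dots> = (\<integral>\<^sup>+y. \<integral>\<^sup>+t. g (y + t *\<^sub>R u) \<partial>lborel \<partial>frame_lborel B)"
    by (rule insert.IH[OF _ k]) auto
  also have "\<dots> = (\<integral>\<^sup>+x. g x \<partial>frame_lborel (insert u B))"
    using insert.hyps by (subst nn_integral_frame_lborel_insert) auto
  finally show ?case .
qed

lemma nn_integral_frame_lborel_scale:
  fixes g :: "'a::euclidean_space \<Rightarrow> ennreal"
  assumes "finite B" "g \<in> borel_measurable borel" "r > 0"
  shows "(\<integral>\<^sup>+x. g (x /\<^sub>R r) \<partial>frame_lborel B) = ennreal (r ^ card B) * (\<integral>\<^sup>+x. g x \<partial>frame_lborel B)"
  using assms
proof (induction B arbitrary: g rule: finite_induct)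
  case empty
  note [measurable] = empty(1)
  from empty show ?case by (simp add: nn_integral_frame_lborel_empty)
next
  case (insert u B)
  note [measurable] = insert.prems(1)
  have sc: "(\<integral>\<^sup>+t. h (t / r) \<partial>lborel) = ennreal r * (\<integral>\<^sup>+t. h t \<partial>lborel)" if [measurable]: "h \<in> borel_measurable borel"
    for h :: "real \<Rightarrow> ennreal"
    using nn_integral_real_affine[of "\<lambda>t. h (t / r)" r 0] \<open>r > 0\<close> by simp
  have "(\<integral>\<^sup>+x. g (x /\<^sub>R r) \<partial>frame_lborel (insert u B))
      = (\<integral>\<^sup>+x. \<integral>\<^sup>+t. g (x /\<^sub>R r + (t / r) *\<^sub>R u) \<partial>lborel \<partial>frame_lborel B)"
    using insert.hyps by (subst nn_integral_frame_lborel_insert) (auto simp: algebra_simps divide_inverse_commute)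
  also have "\<dots> = (\<integral>\<^sup>+x. ennreal r * (\<lambda>y. \<integral>\<^sup>+t. g (y + t *\<^sub>R u) \<partial>lborel) (x /\<^sub>R r) \<partial>frame_lborel B)"
    by (subst sc) auto
  also have "\<dots> = ennreal r * (\<integral>\<^sup>+x. (\<lambda>y. \<integral>\<^sup>+t. g (y + t *\<^sub>R u) \<partial>lborel) (x /\<^sub>R r) \<partial>frame_lborel B)"
    by (subst nn_integral_cmult) auto
  also have "\<dots> = ennreal r * (ennreal (r ^ card B) * (\<integral>\<^sup>+y. \<integral>\<^sup>+t. g (y + t *\<^sub>R u) \<partial>lborel \<partial>frame_lborel B))"
    by (subst insert.IH) (use \<open>r > 0\<close> in auto)
  also have "\<dots> = ennreal (r ^ card (insert u B)) * (\<integral>\<^sup>+x. g x \<partial>frame_lborel (insert u B))"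
    using insert.hyps \<open>r > 0\<close> by (subst nn_integral_frame_lborel_insert) (auto simp: ennreal_mult mult.assoc)
  finally show ?case .
qed

text \<open>The two measures are compared by the usual proof that a translation-invariant measure is
  unique up to a factor; a Gaussian, whose integral depends only on the dimension, fixes the factor.\<close>

lemma frame_lborel_cong:
  fixes A B :: "'a::euclidean_space set"
  assumes A: "orthonormal A" and B: "orthonormal B" and AB: "span A = span B"
  shows "frame_lborel A = frame_lborel B"
proof (rule measure_eqI)
  interpret A: sigma_finite_measure "frame_lborel A" by (rule sigma_finite_frame_lborel[OF A])
  interpret B: sigma_finite_measure "frame_lborel B" by (rule sigma_finite_frame_lborel[OF B])
  interpret pair_sigma_finite "frame_lborel A" "frame_lborel B" ..
  fix X assume "X \<in> sets (frame_lborel A)"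
  then have X[measurable]: "X \<in> sets borel" by simp
  let ?h = "\<lambda>x::'a. ennreal (exp (- 1 * (norm x)\<^sup>2 / 2))"
  let ?g = "indicator X :: 'a \<Rightarrow> ennreal"
  let ?Z = "ennreal (sqrt (2 * pi / 1) ^ card A)"
  have card: "card A = card B" using orthonormal_card[OF A] orthonormal_card[OF B] AB by simp
  have fin: "finite A" "finite B" using A B by (auto intro: orthonormal_finite)
  have "emeasure (frame_lborel A) X * ?Z = (\<integral>\<^sup>+y. (\<integral>\<^sup>+x. ?g x \<partial>frame_lborel A) * ?h y \<partial>frame_lborel B)"
    unfolding card using nn_integral_frame_lborel_gaussian[OF B, of 1]
    by (subst nn_integral_cmult) auto
  \<comment> \<open>Shift \<open>x\<close> by \<open>y\<close>, exchange the integrals, shift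
    \<open>y\<close> back by \<open>x\<close>: the indicator passes from the measure of
    \<open>A\<close> to that of \<open>B\<close>, and the Gaussian the other way.\<close>
  also have "\<dots> = (\<integral>\<^sup>+y. \<integral>\<^sup>+x. ?g (x + y) * ?h y \<partial>frame_lborel A \<partial>frame_lborel B)"
  proof (rule nn_integral_cong_AE, use AE_frame_lborel_span[of B] in eventually_elim)
    fix y assume "y \<in> span B"
    then have "(\<integral>\<^sup>+x. ?g (x + y) \<partial>frame_lborel A) = (\<integral>\<^sup>+x. ?g x \<partial>frame_lborel A)"
      using fin AB by (intro nn_integral_frame_lborel_translate) auto
    then show "(\<integral>\<^sup>+x. ?g x \<partial>frame_lborel A) * ?h y = (\<integral>\<^sup>+x. ?g (x + y) * ?h y \<partial>frame_lborel A)"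
      by (subst nn_integral_multc) auto
  qed
  also have "\<dots> = (\<integral>\<^sup>+x. \<integral>\<^sup>+y. ?g (x + y) * ?h y \<partial>frame_lborel B \<partial>frame_lborel A)"
    by (rule Fubini') auto
  also have "\<dots> = (\<integral>\<^sup>+x. \<integral>\<^sup>+y. ?g y * ?h (y - x) \<partial>frame_lborel B \<partial>frame_lborel A)"
  proof (rule nn_integral_cong_AE, use AE_frame_lborel_span[of A] in eventually_elim)
    fix x assume "x \<in> span A"
    then show "(\<integral>\<^sup>+y. ?g (x + y) * ?h y \<partial>frame_lborel B) = (\<integral>\<^sup>+y. ?g y * ?h (y - x) \<partial>frame_lborel B)"
      using nn_integral_frame_lborel_translate[OF fin(2), of "\<lambda>y. ?g y * ?h (y - x)" x] AB
      by (simp add: add.commute)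
  qed
  also have "\<dots> = (\<integral>\<^sup>+y. \<integral>\<^sup>+x. ?g y * ?h (y - x) \<partial>frame_lborel A \<partial>frame_lborel B)"
    by (rule Fubini'[symmetric]) auto
  also have "\<dots> = (\<integral>\<^sup>+y. ?g y * ?Z \<partial>frame_lborel B)"
  proof (rule nn_integral_cong_AE, use AE_frame_lborel_span[of B] in eventually_elim)
    fix y assume "y \<in> span B"
    then have "(\<integral>\<^sup>+x. ?h (y - x) \<partial>frame_lborel A) = (\<integral>\<^sup>+x. ?h x \<partial>frame_lborel A)"
      using nn_integral_frame_lborel_translate[OF fin(1), of "\<lambda>x. ?h (y - x)" y] AB by simp
    then show "(\<integral>\<^sup>+x. ?g y * ?h (y - x) \<partial>frame_lborel A) = ?g y * ?Z"
      using nn_integral_frame_lborel_gaussian[OF A, of 1] by (subst nn_integral_cmult) auto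
  qed
  also have "\<dots> = emeasure (frame_lborel B) X * ?Z"
    by (subst nn_integral_multc) auto
  finally have "emeasure (frame_lborel A) X * ?Z = emeasure (frame_lborel B) X * ?Z" .
  moreover have "?Z \<noteq> 0" "?Z \<noteq> \<infinity>" by auto
  ultimately show "emeasure (frame_lborel A) X = emeasure (frame_lborel B) X"
    by (metis infinity_ennreal_def mult_divide_eq_ennreal)
qed simp

lemma orthonormal_Basis: "orthonormal (Basis :: 'a::euclidean_space set)"
  by (auto simp: orthonormal_def pairwise_def orthogonal_def inner_Basis)

lemma frame_lborel_UNIV:
  fixes E :: "'a::euclidean_space set"
  shows "orthonormal E \<Longrightarrow> span E = UNIV \<Longrightarrow> frame_lborel E = lborel"
proof -
  assume "orthonormal E" "span E = UNIV"
  then have "frame_lborel E = frame_lborel Basis"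
    by (intro frame_lborel_cong orthonormal_Basis) auto
  also have "\<dots> = lborel"
    unfolding frame_lborel_def by (rule lborel_eq[symmetric])
  finally show "frame_lborel E = lborel" .
qed

lemma subspace_lborel_eq_frame:
  assumes "orthonormal B"
  shows "subspace_lborel (span B) = frame_lborel B"
proof -
  let ?B = "SOME B'. orthonormal_basis_of (span B) B'"
  have "orthonormal_basis_of (span B) ?B"
    by (rule someI_ex[OF ex_orthonormal_basis_of[OF subspace_span]])
  then have "orthonormal ?B" "span ?B = span B"
    by (auto simp: orthonormal_basis_of_def orthonormal_def)
  with frame_lborel_cong[OF _ assms] show ?thesis
    by (simp add: subspace_lborel_def Let_def frame_lborel_def)
qed

text \<open>The form as an image of a product measure is needed for signed integrands, which the
  iterated formula for nonnegative functions does not cover.\<close>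

lemma frame_lborel_insert:
  assumes B: "orthonormal (insert u B)" "u \<notin> B"
  shows "frame_lborel (insert u B) = distr (frame_lborel B \<Otimes>\<^sub>M lborel) borel (\<lambda>(x, t). x + t *\<^sub>R u)"
proof (rule measure_eqI)
  have B': "orthonormal B" using B(1) orthonormal_subset by blast
  interpret B: sigma_finite_measure "frame_lborel B" by (rule sigma_finite_frame_lborel[OF B'])
  interpret pair_sigma_finite "frame_lborel B" "lborel :: real measure" ..
  fix X assume "X \<in> sets (frame_lborel (insert u B))"
  then have X[measurable]: "X \<in> sets borel" by simp
  have "emeasure (frame_lborel (insert u B)) X = (\<integral>\<^sup>+x. \<integral>\<^sup>+t. indicator X (x + t *\<^sub>R u) \<partial>lborel \<partial>frame_lborel B)"
    using orthonormal_finite[OF B'] B(2)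
    by (subst nn_integral_frame_lborel_insert[symmetric]) auto
  also have "\<dots> = (\<integral>\<^sup>+z. indicator X (case z of (x, t) \<Rightarrow> x + t *\<^sub>R u) \<partial>(frame_lborel B \<Otimes>\<^sub>M lborel))"
    by (subst lborel.nn_integral_fst[symmetric]) auto
  also have "\<dots> = (\<integral>\<^sup>+z. indicator X z \<partial>distr (frame_lborel B \<Otimes>\<^sub>M lborel) borel (\<lambda>(x, t). x + t *\<^sub>R u))"
    by (subst nn_integral_distr) auto
  also have "\<dots> = emeasure (distr (frame_lborel B \<Otimes>\<^sub>M lborel) borel (\<lambda>(x, t). x + t *\<^sub>R u)) X"
    by simp
  finally show "emeasure (frame_lborel (insert u B)) X = emeasure (distr (frame_lborel B \<Otimes>\<^sub>M lborel) borel (\<lambda>(x, t). x + t *\<^sub>R u)) X" .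
qed simp

text \<open>Each point lies on at most one dilate of the level set, so Fubini shows that almost all
  dilates are null; but all of them have proportional measure.\<close>

lemma AE_frame_lborel_homogeneous_neq_1:
  fixes N :: "'a::euclidean_space \<Rightarrow> real"
  assumes B: "orthonormal B" and [measurable]: "N \<in> borel_measurable borel"
    and hom: "\<And>r x. r > 0 \<Longrightarrow> N (r *\<^sub>R x) = r * N x"
  shows "AE x in frame_lborel B. N x \<noteq> 1"
proof -
  interpret B: sigma_finite_measure "frame_lborel B" by (rule sigma_finite_frame_lborel[OF B])
  interpret pair_sigma_finite "frame_lborel B" "lborel :: real measure" ..
  define A where "A = {x. N x = 1}"
  have [measurable]: "A \<in> sets borel" unfolding A_def by measurable
  \<comment> \<open>The interval has length 1, so averaging over it returns the mass, and on it the
    scaling factor \<open>r ^ card B\<close> is at least 1.\<close>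
  have "emeasure (frame_lborel B) A = (\<integral>\<^sup>+r. indicator {1..2::real} r * emeasure (frame_lborel B) A \<partial>lborel)"
    by (subst nn_integral_multc) auto
  also have "\<dots> \<le> (\<integral>\<^sup>+r. indicator {1..2} r * (\<integral>\<^sup>+x. indicator A (x /\<^sub>R r) \<partial>frame_lborel B) \<partial>lborel)"
  proof (rule nn_integral_mono)
    fix r :: real
    show "indicator {1..2} r * emeasure (frame_lborel B) A
      \<le> indicator {1..2} r * (\<integral>\<^sup>+x. indicator A (x /\<^sub>R r) \<partial>frame_lborel B)"
    proof (cases "r \<in> {1..2}")
      case True
      then have "(\<integral>\<^sup>+x. indicator A (x /\<^sub>R r) \<partial>frame_lborel B)
        = ennreal (r ^ card B) * emeasure (frame_lborel B) A"
        using nn_integral_frame_lborel_scale[OF orthonormal_finite[OF B], of "indicator A" r] by auto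
      moreover have "1 \<le> ennreal (r ^ card B)" using True by (simp add: one_le_power)
      ultimately show ?thesis using True mult_right_mono[of 1 "ennreal (r ^ card B)"] by (simp add: mult_left_mono)
    qed auto
  qed
  also have "\<dots> = (\<integral>\<^sup>+r. \<integral>\<^sup>+x. indicator {1..2} r * indicator A (x /\<^sub>R r) \<partial>frame_lborel B \<partial>lborel)"
    by (subst nn_integral_cmult) auto
  also have "\<dots> = (\<integral>\<^sup>+x. \<integral>\<^sup>+r. indicator {1..2} r * indicator A (x /\<^sub>R r) \<partial>lborel \<partial>frame_lborel B)"
    by (rule Fubini') measurable
  also have "\<dots> \<le> (\<integral>\<^sup>+x. \<integral>\<^sup>+r. indicator {N x} r \<partial>lborel \<partial>frame_lborel B)"
  proof (intro nn_integral_mono)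
    fix x and r :: real
    have "N x = r" if "1 \<le> r" "N (x /\<^sub>R r) = 1"
      using hom[of "inverse r" x] that by (simp add: field_simps)
    then show "indicator {1..2} r * indicator A (x /\<^sub>R r) \<le> (indicator {N x} r :: ennreal)"
      by (auto simp: indicator_def A_def)
  qed
  also have "\<dots> = 0" by simp
  finally have "emeasure (frame_lborel B) A = 0" by simp
  then show ?thesis
    by (intro AE_I[where N=A]) (auto simp: A_def)
qed

section \<open>Integrability of the inverse norm against a Gaussian\<close>

text \<open>The power -1/2 is the share of one coordinate once the norm is bounded below by the
  geometric mean of two coordinates. It is integrable at 0, and the Gaussian takes care of
  infinity.\<close>

lemma nn_integral_inverse_sqrt_gaussian:
  fixes a :: real
  assumes "a > 0"
  shows "(\<integral>\<^sup>+t. ennreal (exp (- a * t\<^sup>2 / 2) / sqrt \<bar>t\<bar>) \<partial>lborel) < \<infinity>"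
proof -
  have "((\<lambda>x::real. x powr (-1/2)) has_integral (1 powr (-1/2 + 1) / (-1/2 + 1))) {0..1}"
    by (rule has_integral_powr_from_0) auto
  then have "((\<lambda>x::real. if x \<in> {0..1} then x powr (-1/2) else 0) has_integral 2) UNIV"
    by (subst has_integral_restrict_UNIV) simp
  then have half: "(\<integral>\<^sup>+x. ennreal (if x \<in> {0..1} then x powr (-1/2) else 0) \<partial>lborel) = ennreal 2"
    by (intro nn_integral_has_integral_lborel) auto
  then have half': "(\<integral>\<^sup>+x. ennreal (if - x \<in> {0..1} then (- x) powr (-1/2) else 0) \<partial>lborel) = ennreal 2"
    using nn_integral_real_affine[of "\<lambda>x. ennreal (if x \<in> {0..1} then x powr (-1/2) else 0)" "-1" 0] by (simp cong: if_cong)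
  have add3: "(\<integral>\<^sup>+t. f t + g t + h t \<partial>lborel)
      = (\<integral>\<^sup>+t. f t \<partial>lborel) + (\<integral>\<^sup>+t. g t \<partial>lborel) + (\<integral>\<^sup>+t. h t \<partial>lborel)"
    if [measurable]: "f \<in> borel_measurable borel" "g \<in> borel_measurable borel" "h \<in> borel_measurable borel"
    for f g h :: "real \<Rightarrow> ennreal"
    by (simp add: nn_integral_add)
  have "(\<integral>\<^sup>+t. ennreal (exp (- a * t\<^sup>2 / 2) / sqrt \<bar>t\<bar>) \<partial>lborel) \<le>
    (\<integral>\<^sup>+t. ennreal (if t \<in> {0..1} then t powr (-1/2) else 0) + ennreal (if - t \<in> {0..1} then (- t) powr (-1/2) else 0)
       + ennreal (exp (- a * t\<^sup>2 / 2)) \<partial>lborel)"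
  proof (rule nn_integral_mono)
    fix t :: real
    have e: "exp (- a * t\<^sup>2 / 2) \<le> 1" using assms by simp
    have "exp (- a * t\<^sup>2 / 2) / sqrt \<bar>t\<bar> \<le> (if t \<in> {0..1} then t powr (-1/2) else 0) +
       (if - t \<in> {0..1} then (- t) powr (-1/2) else 0) + exp (- a * t\<^sup>2 / 2)"
    proof (cases "\<bar>t\<bar> \<le> 1")
      case True
      have "exp (- a * t\<^sup>2 / 2) / sqrt \<bar>t\<bar> \<le> 1 / sqrt \<bar>t\<bar>" using e by (intro divide_right_mono) auto
      also have "\<dots> = \<bar>t\<bar> powr (-1/2)"
        by (simp add: powr_minus_divide powr_half_sqrt)
      also have "\<dots> \<le> (if t \<in> {0..1} then t powr (-1/2) else 0) +
         (if - t \<in> {0..1} then (- t) powr (-1/2) else 0) + exp (- a * t\<^sup>2 / 2)"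
        using True by (cases "t \<ge> 0") (auto simp: abs_if add_nonneg_nonneg)
      finally show ?thesis .
    next
      case False
      then have "exp (- a * t\<^sup>2 / 2) / sqrt \<bar>t\<bar> \<le> exp (- a * t\<^sup>2 / 2) / 1"
        by (intro divide_left_mono) auto
      with False show ?thesis by auto
    qed
    then show "ennreal (exp (- a * t\<^sup>2 / 2) / sqrt \<bar>t\<bar>) \<le>
      ennreal (if t \<in> {0..1} then t powr (-1/2) else 0) + ennreal (if - t \<in> {0..1} then (- t) powr (-1/2) else 0)
       + ennreal (exp (- a * t\<^sup>2 / 2))"
      by (simp add: ennreal_plus[symmetric] ennreal_leI del: ennreal_plus)
  qed
  also have "\<dots> = (\<integral>\<^sup>+t. ennreal (if t \<in> {0..1} then t powr (-1/2) else 0) \<partial>lborel)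
       + (\<integral>\<^sup>+t. ennreal (if - t \<in> {0..1} then (- t) powr (-1/2) else 0) \<partial>lborel)
       + (\<integral>\<^sup>+t. ennreal (exp (- a * t\<^sup>2 / 2)) \<partial>lborel)"
    by (rule add3) measurable
  also have "\<dots> = ennreal 2 + ennreal 2 + ennreal (sqrt (2 * pi / a))"
    by (simp only: half half' nn_integral_exp_neg_square[OF assms])
  also have "\<dots> < \<infinity>" by simp
  finally show ?thesis .
qed

text \<open>Orthogonal coordinates decouple: peeling off \<open>u\<close> and \<open>v\<close>
  leaves two copies of the one-dimensional integral and a Gaussian on the rest. Two coordinates are
  essential, since a single one would have to carry the power -1, which is not integrable at
  0.\<close>

lemma nn_integral_frame_lborel_inverse_coords:
  fixes a :: real and u v :: "'a::euclidean_space"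
  assumes E: "orthonormal E" and uv: "u \<in> E" "v \<in> E" "u \<noteq> v" and a: "a > 0"
  shows "(\<integral>\<^sup>+x. ennreal (exp (- a * (norm x)\<^sup>2 / 2) / sqrt (\<bar>u \<bullet> x\<bar> * \<bar>v \<bullet> x\<bar>)) \<partial>frame_lborel E) < \<infinity>"
proof -
  define F where "F = E - {u, v}"
  have EF: "E = insert u (insert v F)" "u \<notin> insert v F" "v \<notin> F" using uv by (auto simp: F_def)
  have ouv: "orthonormal (insert u (insert v F))" using E EF by simp
  have ov: "orthonormal (insert v F)" and oF: "orthonormal F"
    using ouv by (auto intro: orthonormal_subset)
  have fin: "finite (insert v F)" "finite F" using orthonormal_finite[OF ov] by auto
  let ?g = "\<lambda>x. ennreal (exp (- a * (norm x)\<^sup>2 / 2) / sqrt (\<bar>u \<bullet> x\<bar> * \<bar>v \<bullet> x\<bar>))"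
  let ?k = "\<lambda>t::real. ennreal (exp (- a * t\<^sup>2 / 2) / sqrt \<bar>t\<bar>)"
  let ?I = "\<integral>\<^sup>+t. ?k t \<partial>lborel"
  have "(\<integral>\<^sup>+x. ?g x \<partial>frame_lborel E) = (\<integral>\<^sup>+x. \<integral>\<^sup>+t. ?g (x + t *\<^sub>R u) \<partial>lborel \<partial>frame_lborel (insert v F))"
    unfolding EF(1) using EF fin by (subst nn_integral_frame_lborel_insert) auto
  also have "\<dots> = (\<integral>\<^sup>+x. \<integral>\<^sup>+s. \<integral>\<^sup>+t. ?g (x + s *\<^sub>R v + t *\<^sub>R u) \<partial>lborel \<partial>lborel \<partial>frame_lborel F)"
    using EF fin by (subst nn_integral_frame_lborel_insert) auto
  also have "\<dots> = (\<integral>\<^sup>+x. ennreal (exp (- a * (norm x)\<^sup>2 / 2)) * (?I * ?I) \<partial>frame_lborel F)"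
  proof (rule nn_integral_cong_AE, use AE_frame_lborel_span in eventually_elim)
    fix x assume x: "x \<in> span F"
    have uu: "u \<bullet> u = 1" "v \<bullet> v = 1" using ouv by (auto simp: orthonormal_def norm_eq_1)
    have vx: "v \<bullet> x = 0" by (rule orthonormal_insert_inner_span[OF ov EF(3) x])
    have xs: "x + s *\<^sub>R v \<in> span (insert v F)" for s
      by (rule span_add[OF subsetD[OF span_mono x] span_mul[OF span_base]]) auto
    have uxs: "u \<bullet> (x + s *\<^sub>R v) = 0" for s
      by (rule orthonormal_insert_inner_span[OF ouv EF(2) xs])
    have ux: "u \<bullet> x = 0" "u \<bullet> v = 0" using uxs[of 0] uxs[of 1] by (auto simp: inner_add_right)
    have "?g (x + s *\<^sub>R v + t *\<^sub>R u) = ennreal (exp (- a * (norm x)\<^sup>2 / 2)) * (?k s * ?k t)" for s t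
    proof -
      have "exp (- a * (norm (x + s *\<^sub>R v + t *\<^sub>R u))\<^sup>2 / 2)
         = exp (- a * (norm x)\<^sup>2 / 2) * exp (- a * s\<^sup>2 / 2) * exp (- a * t\<^sup>2 / 2)"
        unfolding orthonormal_insert_norm[OF ouv EF(2) xs] orthonormal_insert_norm[OF ov EF(3) x]
        by (simp add: exp_add[symmetric] field_simps)
      moreover have "u \<bullet> (x + s *\<^sub>R v + t *\<^sub>R u) = t" "v \<bullet> (x + s *\<^sub>R v + t *\<^sub>R u) = s"
        using uu ux vx by (auto simp: inner_add_right inner_commute)
      ultimately show ?thesis
        by (simp add: ennreal_mult[symmetric] real_sqrt_mult field_simps)
    qed
    then show "(\<integral>\<^sup>+s. \<integral>\<^sup>+t. ?g (x + s *\<^sub>R v + t *\<^sub>R u) \<partial>lborel \<partial>lborel) = ennreal (exp (- a * (norm x)\<^sup>2 / 2)) * (?I * ?I)"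
      by (simp add: nn_integral_cmult nn_integral_multc)
  qed
  also have "\<dots> = ennreal (sqrt (2 * pi / a) ^ card F) * (?I * ?I)"
    using nn_integral_frame_lborel_gaussian[OF oF a] by (subst nn_integral_multc) auto
  also have "\<dots> < \<infinity>"
    using nn_integral_inverse_sqrt_gaussian[OF a] by (auto simp: ennreal_mult_less_top)
  finally show ?thesis .
qed

text \<open>For orthonormal \<open>B\<close> this is the orthogonal projection onto the span. It is
  the part of a frequency that the subspace sees, by \<open>inner_frame_proj\<close>.\<close>

definition frame_proj :: "'a::euclidean_space set \<Rightarrow> 'a \<Rightarrow> 'a" where
  "frame_proj B x = (\<Sum>b\<in>B. (x \<bullet> b) *\<^sub>R b)"

lemma measurable_frame_proj [measurable]: "frame_proj B \<in> borel_measurable borel"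
  unfolding frame_proj_def by measurable

lemma frame_proj_in_span: "frame_proj B x \<in> span B"
  unfolding frame_proj_def by (intro span_sum span_mul span_base)

lemma inner_frame_proj:
  assumes "orthonormal B" "y \<in> span B"
  shows "y \<bullet> frame_proj B x = y \<bullet> x"
proof -
  have "y = (\<Sum>b\<in>B. (y \<bullet> b) *\<^sub>R b)"
    using orthonormal_basis_expand[of B y] assms orthonormal_finite[of B] by (auto simp: orthonormal_def)
  then have "y \<bullet> x = (\<Sum>b\<in>B. (y \<bullet> b) *\<^sub>R b) \<bullet> x" by simp
  then show ?thesis
    by (simp add: frame_proj_def inner_sum_left inner_sum_right inner_commute mult.commute)
qed

lemma inner_le_norm_frame_proj:
  assumes "orthonormal B" "u \<in> B"
  shows "\<bar>u \<bullet> x\<bar> \<le> norm (frame_proj B x)"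
  using inner_frame_proj[OF assms(1) span_base[OF assms(2)], of x] Cauchy_Schwarz_ineq2[of u "frame_proj B x"] assms
  by (auto simp: orthonormal_def)

lemma sqrt_mult_le: "0 \<le> a \<Longrightarrow> a \<le> c \<Longrightarrow> 0 \<le> b \<Longrightarrow> b \<le> c \<Longrightarrow> sqrt (a * b) \<le> (c::real)"
  by (rule real_le_lsqrt) (auto simp: power2_eq_square intro: mult_mono)

lemma two_elements:
  assumes "card B \<ge> 2"
  obtains u v where "u \<in> B" "v \<in> B" "u \<noteq> v"
proof -
  have "\<not> card B \<le> Suc 0" "finite B" using assms by (auto intro: card_ge_0_finite)
  then show thesis using that card_le_Suc0_iff_eq by metis
qed

lemma AE_frame_lborel_inner_neq_0:
  assumes E: "orthonormal E" and w: "w \<in> E"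
  shows "AE x in frame_lborel E. w \<bullet> x \<noteq> 0"
proof -
  have E': "E = insert w (E - {w})" "orthonormal (insert w (E - {w}))" "w \<notin> E - {w}"
    using E w by (auto simp: insert_absorb)
  then have oE: "orthonormal (E - {w})" using orthonormal_subset by blast
  have "emeasure (frame_lborel E) {x. w \<bullet> x = 0} = (\<integral>\<^sup>+x. indicator {x. w \<bullet> x = 0} x \<partial>frame_lborel E)"
    by simp
  also have "\<dots> = (\<integral>\<^sup>+x. \<integral>\<^sup>+t. indicator {x. w \<bullet> x = 0} (x + t *\<^sub>R w) \<partial>lborel \<partial>frame_lborel (E - {w}))"
    using orthonormal_finite[OF oE] by (subst E'(1), subst nn_integral_frame_lborel_insert) auto
  also have "\<dots> = (\<integral>\<^sup>+x. 0 \<partial>frame_lborel (E - {w}))"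
  proof (rule nn_integral_cong_AE, use AE_frame_lborel_span in eventually_elim)
    fix x assume "x \<in> span (E - {w})"
    then have "w \<bullet> x = 0" by (rule orthonormal_insert_inner_span[OF E'(2,3)])
    moreover have "w \<bullet> w = 1" using w E by (auto simp: orthonormal_def norm_eq_1)
    ultimately have "indicator {x. w \<bullet> x = 0} (x + t *\<^sub>R w) = (indicator {0} t :: ennreal)" for t
      by (auto simp: indicator_def inner_add_right)
    then show "(\<integral>\<^sup>+t. indicator {x. w \<bullet> x = 0} (x + t *\<^sub>R w) \<partial>lborel) = (0::ennreal)" by simp
  qed
  finally show ?thesis by (intro AE_I[where N="{x. w \<bullet> x = 0}"]) auto
qed

text \<open>Each coordinate is at most the norm of the projection, hence so is the geometric mean of
  two of them; this avoids polar coordinates. The case \<open>E = B\<close> serves integrals over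
  the subspace, the case of a basis of the whole space serves integrals over frequencies.\<close>

lemma integrable_gaussian_inverse_norm_frame_proj:
  fixes a :: real and B :: "'a::euclidean_space set"
  assumes B: "orthonormal B" "card B \<ge> 2" and E: "orthonormal E" "B \<subseteq> E" and a: "a > 0"
  shows "integrable (frame_lborel E) (\<lambda>x. exp (- a * (norm x)\<^sup>2 / 2) / norm (frame_proj B x))"
proof -
  obtain u v where uv: "u \<in> B" "v \<in> B" "u \<noteq> v" using two_elements[OF B(2)] .
  have "(\<integral>\<^sup>+x. ennreal (norm (exp (- a * (norm x)\<^sup>2 / 2) / norm (frame_proj B x))) \<partial>frame_lborel E)
     \<le> (\<integral>\<^sup>+x. ennreal (exp (- a * (norm x)\<^sup>2 / 2) / sqrt (\<bar>u \<bullet> x\<bar> * \<bar>v \<bullet> x\<bar>)) \<partial>frame_lborel E)"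
    (is "?l \<le> ?r")
  proof -
    \<comment> \<open>Where one of the two coordinates vanishes, the right-hand integrand is 0 by
      convention and the comparison may fail; such points are null.\<close>
    have 1: "AE x in frame_lborel E. w \<bullet> x \<noteq> 0" if "w \<in> B" for w
      using AE_frame_lborel_inner_neq_0[OF E(1)] that E(2) by blast
    show ?thesis
    proof (rule nn_integral_mono_AE, use 1[OF uv(1)] 1[OF uv(2)] in eventually_elim)
      fix x assume nz: "u \<bullet> x \<noteq> 0" "v \<bullet> x \<noteq> 0"
      have "sqrt (\<bar>u \<bullet> x\<bar> * \<bar>v \<bullet> x\<bar>) \<le> norm (frame_proj B x)"
        using inner_le_norm_frame_proj[OF B(1)] uv by (intro sqrt_mult_le) auto
      moreover have "0 < sqrt (\<bar>u \<bullet> x\<bar> * \<bar>v \<bullet> x\<bar>)" using nz by simp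
      ultimately have "exp (- a * (norm x)\<^sup>2 / 2) / norm (frame_proj B x)
        \<le> exp (- a * (norm x)\<^sup>2 / 2) / sqrt (\<bar>u \<bullet> x\<bar> * \<bar>v \<bullet> x\<bar>)"
        by (intro divide_left_mono mult_pos_pos exp_ge_zero; linarith)
      then show "ennreal (norm (exp (- a * (norm x)\<^sup>2 / 2) / norm (frame_proj B x)))
        \<le> ennreal (exp (- a * (norm x)\<^sup>2 / 2) / sqrt (\<bar>u \<bullet> x\<bar> * \<bar>v \<bullet> x\<bar>))"
        by (intro ennreal_leI) simp
    qed
  qed
  also have "?r < \<infinity>"
    using E uv a by (intro nn_integral_frame_lborel_inverse_coords) auto
  finally show ?thesis by (intro integrableI_bounded) auto
qed

lemma frame_proj_span:
  assumes "orthonormal B" "x \<in> span B"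
  shows "frame_proj B x = x"
  unfolding frame_proj_def
  using orthonormal_basis_expand[of B x] assms orthonormal_finite[of B] by (auto simp: orthonormal_def)

lemma integrable_frame_lborel_gaussian_inverse_norm:
  fixes a :: real and B :: "'a::euclidean_space set"
  assumes B: "orthonormal B" "card B \<ge> 2" and a: "a > 0"
  shows "integrable (frame_lborel B) (\<lambda>x. exp (- a * (norm x)\<^sup>2 / 2) / norm x)"
proof (rule integrable_cong_AE_imp[OF integrable_gaussian_inverse_norm_frame_proj[OF B B(1) subset_refl a]])
  show "AE x in frame_lborel B. exp (- a * (norm x)\<^sup>2 / 2) / norm (frame_proj B x) = exp (- a * (norm x)\<^sup>2 / 2) / norm x"
    using AE_frame_lborel_span by eventually_elim (simp add: frame_proj_span[OF B(1)])
qed auto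

lemma integrable_lborel_gaussian_inverse_norm:
  fixes a :: real
  assumes "DIM('a::euclidean_space) \<ge> 2" and "a > 0"
  shows "integrable lborel (\<lambda>x::'a. exp (- a * (norm x)\<^sup>2 / 2) / norm x)"
  using integrable_frame_lborel_gaussian_inverse_norm[OF orthonormal_Basis, where 'a='a and a=a] assms
  by (simp add: frame_lborel_UNIV[OF orthonormal_Basis])

lemma integrable_lborel_gaussian_inverse_norm_frame_proj:
  fixes a :: real and B :: "'a::euclidean_space set"
  assumes B: "orthonormal B" "card B \<ge> 2" and a: "a > 0"
  shows "integrable lborel (\<lambda>x. exp (- a * (norm x)\<^sup>2 / 2) / norm (frame_proj B x))"
proof -
  obtain E where "B \<subseteq> E" "orthonormal E" "span E = UNIV"
    using orthonormal_extend[OF B(1) subspace_UNIV] by auto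
  with integrable_gaussian_inverse_norm_frame_proj[OF B, of E a] a show ?thesis
    by (simp add: frame_lborel_UNIV)
qed

section \<open>Gaussians as test functions\<close>

lemma real_polynomial_function_has_derivative:
  fixes p :: "'a::real_normed_vector \<Rightarrow> real"
  assumes "real_polynomial_function p"
  shows "\<exists>D. (\<forall>x. (p has_derivative D x) (at x)) \<and> (\<forall>v. real_polynomial_function (\<lambda>x. D x v))"
  using assms
proof (induction p rule: real_polynomial_function.induct)
  case (linear f)
  then show ?case
    by (intro exI[of _ "\<lambda>x. f"]) (auto intro: bounded_linear_imp_has_derivative real_polynomial_function.intros)
next
  case (const c)
  then show ?case
    by (intro exI[of _ "\<lambda>x v. 0"]) (auto intro: real_polynomial_function.intros)
next
  case (add f g)
  then obtain D E where "\<forall>x. (f has_derivative D x) (at x)" "\<forall>v. real_polynomial_function (\<lambda>x. D x v)"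
    "\<forall>x. (g has_derivative E x) (at x)" "\<forall>v. real_polynomial_function (\<lambda>x. E x v)" by blast
  then show ?case
    by (intro exI[of _ "\<lambda>x v. D x v + E x v"])
       (auto intro!: real_polynomial_function.intros(3) has_derivative_add)
next
  case (mult f g)
  then obtain D E where "\<forall>x. (f has_derivative D x) (at x)" "\<forall>v. real_polynomial_function (\<lambda>x. D x v)"
    "\<forall>x. (g has_derivative E x) (at x)" "\<forall>v. real_polynomial_function (\<lambda>x. E x v)" by blast
  with mult show ?case
    by (intro exI[of _ "\<lambda>x v. f x * E x v + D x v * g x"])
       (auto intro!: real_polynomial_function.intros(3,4) has_derivative_mult)
qed

lemma real_polynomial_function_growth:
  fixes p :: "'a::real_normed_vector \<Rightarrow> real"
  assumes "real_polynomial_function p"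
  shows "\<exists>C N. 0 \<le> C \<and> (\<forall>x. \<bar>p x\<bar> \<le> C * (1 + norm x) ^ N)"
  using assms
proof (induction p rule: real_polynomial_function.induct)
  case (linear f)
  then obtain K where "0 < K" "\<And>x. norm (f x) \<le> norm x * K" using bounded_linear.pos_bounded by blast
  moreover have "\<bar>f x\<bar> \<le> K * (1 + norm x) ^ 1" for x :: 'a
    using calculation(1) calculation(2)[of x] by (simp add: distrib_left mult.commute)
  ultimately show ?case
    by (intro exI[of _ K] exI[of _ 1]) auto
next
  case (const c)
  then show ?case by (intro exI[of _ "\<bar>c\<bar>"] exI[of _ 0]) auto
next
  case (add f g)
  then obtain C N D M where *: "0 \<le> C" "\<And>x. \<bar>f x\<bar> \<le> C * (1 + norm x) ^ N" "0 \<le> D" "\<And>x. \<bar>g x\<bar> \<le> D * (1 + norm x) ^ M"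
    by blast
  have "\<bar>f x + g x\<bar> \<le> (C + D) * (1 + norm x) ^ (N + M)" for x
  proof -
    have "\<bar>f x + g x\<bar> \<le> C * (1 + norm x) ^ N + D * (1 + norm x) ^ M"
      using *(2)[of x] *(4)[of x] by linarith
    also have "\<dots> \<le> C * (1 + norm x) ^ (N + M) + D * (1 + norm x) ^ (N + M)"
      using * by (intro add_mono mult_left_mono power_increasing) auto
    finally show ?thesis by (simp add: algebra_simps)
  qed
  with * show ?case by (intro exI[of _ "C + D"] exI[of _ "N + M"]) auto
next
  case (mult f g)
  then obtain C N D M where *: "0 \<le> C" "\<And>x. \<bar>f x\<bar> \<le> C * (1 + norm x) ^ N" "0 \<le> D" "\<And>x. \<bar>g x\<bar> \<le> D * (1 + norm x) ^ M"
    by blast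
  have "\<bar>f x * g x\<bar> \<le> (C * D) * (1 + norm x) ^ (N + M)" for x
    using mult_mono[OF *(2)[of x] *(4)[of x]] * by (simp add: abs_mult power_add mult_ac)
  with * show ?case by (intro exI[of _ "C * D"] exI[of _ "N + M"]) auto
qed

lemma power_exp_neg_square_bounded:
  fixes c :: real
  assumes "c > 0"
  shows "\<exists>C. \<forall>r\<ge>0. (1 + r) ^ N * exp (- c * r\<^sup>2) \<le> C"
proof (cases "N = 0")
  case True
  then show ?thesis using assms by (intro exI[of _ 1]) auto
next
  case False
  \<comment> \<open>The decay rate is shared evenly among the \<open>N\<close> factors, so that it
    suffices to bound \<open>(1 + r) * exp (- d * r\<^sup>2)\<close>.\<close>
  define d where "d = c / N"
  have d: "d > 0" using assms False by (simp add: d_def)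
  have "(1 + r) ^ N * exp (- c * r\<^sup>2) \<le> (1 + 1 / (4 * d)) ^ N" if "r \<ge> 0" for r
  proof -
    \<comment> \<open>Completing this square gives the linear-by-quadratic bound of the next
      line.\<close>
    have "0 \<le> (1 - 2 * d * r)\<^sup>2" by simp
    then have "r \<le> 1 / (4 * d) + d * r\<^sup>2"
      using d by (simp add: field_simps power2_eq_square)
    moreover have "0 \<le> 1 / (4 * d) * (d * r\<^sup>2)" using d by simp
    ultimately have "1 + r \<le> (1 + 1 / (4 * d)) * (1 + d * r\<^sup>2)"
      by (simp add: distrib_left distrib_right del: times_divide_eq_left)
    also have "\<dots> \<le> (1 + 1 / (4 * d)) * exp (d * r\<^sup>2)"
      using d by (intro mult_left_mono exp_ge_add_one_self) auto
    finally have "(1 + r) * exp (- d * r\<^sup>2) \<le> 1 + 1 / (4 * d)"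
      by (simp add: exp_minus field_simps)
    then have "((1 + r) * exp (- d * r\<^sup>2)) ^ N \<le> (1 + 1 / (4 * d)) ^ N"
      using that by (intro power_mono) auto
    moreover have "exp (- d * r\<^sup>2) ^ N = exp (- c * r\<^sup>2)"
      using False by (simp add: exp_of_nat_mult[symmetric] d_def)
    ultimately show ?thesis by (simp add: power_mult_distrib)
  qed
  then show ?thesis by blast
qed

context
  fixes \<eta> :: "'a::euclidean_space" and a :: real
  assumes a: "a > 0"
begin

abbreviation "gauss \<equiv> \<lambda>x::'a. exp (- a * (norm (x - \<eta>))\<^sup>2 / 2)"

lemma gauss_has_derivative:
  "(gauss has_derivative (\<lambda>v. gauss x * (- a * ((x - \<eta>) \<bullet> v)))) (at x)"
proof -
  have "((\<lambda>x. exp (- a * ((x - \<eta>) \<bullet> (x - \<eta>)) / 2)) has_derivative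
     (\<lambda>v. exp (- a * ((x - \<eta>) \<bullet> (x - \<eta>)) / 2) * (- a * ((x - \<eta>) \<bullet> v + v \<bullet> (x - \<eta>)) / 2))) (at x)"
    by (rule derivative_eq_intros refl | simp add: mult_ac)+
  moreover have "- a * ((x - \<eta>) \<bullet> v + v \<bullet> (x - \<eta>)) / 2 = - a * ((x - \<eta>) \<bullet> v)" for v
    by (simp add: inner_commute[of v])
  ultimately show ?thesis
    by (simp only: power2_norm_eq_inner)
qed

text \<open>Polynomial multiples of a Gaussian are closed under directional derivatives. The
  conditions of \<open>schwartz\<close> thereby reduce to polynomial growth against Gaussian
  decay.\<close>

lemma poly_gauss_iterated_partial:
  "\<exists>q. real_polynomial_function q \<and>
     iterated_partial vs (\<lambda>x. complex_of_real (gauss x)) = (\<lambda>x. complex_of_real (q x * gauss x))"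
proof (induction vs)
  case Nil
  then show ?case by (intro exI[of _ "\<lambda>x. 1"]) (auto intro: real_polynomial_function.intros)
next
  case (Cons v vs)
  then obtain q where q: "real_polynomial_function q"
    and eq: "iterated_partial vs (\<lambda>x. complex_of_real (gauss x)) = (\<lambda>x. complex_of_real (q x * gauss x))" by blast
  obtain D where D: "\<And>x. (q has_derivative D x) (at x)" "\<And>v. real_polynomial_function (\<lambda>x. D x v)"
    using real_polynomial_function_has_derivative[OF q] by blast
  define q' where "q' = (\<lambda>x. D x v + q x * ((- a) * ((x - \<eta>) \<bullet> v)))"
  have lin: "real_polynomial_function (\<lambda>x. (x - \<eta>) \<bullet> v)"
  proof -
    have "(\<lambda>x. (x - \<eta>) \<bullet> v) = (\<lambda>x. x \<bullet> v + (- (\<eta> \<bullet> v)))" by (simp add: inner_diff_left)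
    then show ?thesis
      by (simp only:) (intro real_polynomial_function.intros bounded_linear_inner_left)
  qed
  have "real_polynomial_function q'"
    unfolding q'_def by (intro real_polynomial_function.intros D q lin)
  moreover have "frechet_derivative (\<lambda>x. complex_of_real (q x * gauss x)) (at x) v = complex_of_real (q' x * gauss x)" for x
  proof -
    have "((\<lambda>x. complex_of_real (q x * gauss x)) has_derivative
       (\<lambda>v. complex_of_real (q x * (gauss x * (- a * ((x - \<eta>) \<bullet> v))) + D x v * gauss x))) (at x)"
      by (intro bounded_linear.has_derivative[OF bounded_linear_of_real] has_derivative_mult D gauss_has_derivative)
    from frechet_derivative_at[OF this, symmetric] show ?thesis
      by (simp add: q'_def algebra_simps)
  qed
  ultimately show ?case by (intro exI[of _ q']) (simp only: eq iterated_partial.simps simp_thms)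
qed

lemma schwartz_gauss: "schwartz (\<lambda>x. complex_of_real (gauss x))"
  unfolding schwartz_def
proof (intro allI impI conjI)
  fix vs :: "'a list"
  obtain q where q: "real_polynomial_function q"
    and eq: "iterated_partial vs (\<lambda>x. complex_of_real (gauss x)) = (\<lambda>x. complex_of_real (q x * gauss x))"
    using poly_gauss_iterated_partial by blast
  obtain D where D: "\<And>x. (q has_derivative D x) (at x)"
    using real_polynomial_function_has_derivative[OF q] by blast
  show "iterated_partial vs (\<lambda>x. complex_of_real (gauss x)) differentiable at x" for x
  proof -
    have "((\<lambda>x. complex_of_real (q x * gauss x)) has_derivative
       (\<lambda>v. complex_of_real (q x * (gauss x * (- a * ((x - \<eta>) \<bullet> v))) + D x v * gauss x))) (at x)"
      by (intro bounded_linear.has_derivative[OF bounded_linear_of_real] has_derivative_mult D gauss_has_derivative)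
    then show ?thesis unfolding eq differentiable_def by blast
  qed
  fix N :: nat
  obtain C M where C: "0 \<le> C" "\<And>x. \<bar>q x\<bar> \<le> C * (1 + norm x) ^ M"
    using real_polynomial_function_growth[OF q] by blast
  obtain K where K: "\<And>r. r \<ge> 0 \<Longrightarrow> (1 + r) ^ (N + M) * exp (- (a / 2) * r\<^sup>2) \<le> K"
    using power_exp_neg_square_bounded[of "a / 2" "N + M"] a by auto
  have "(1 + norm x) ^ N * norm (complex_of_real (q x * gauss x)) \<le> C * (1 + norm \<eta>) ^ (N + M) * K" for x
  proof -
    have "norm x \<le> norm \<eta> + norm (x - \<eta>)" using norm_triangle_sub by blast
    moreover have "0 \<le> norm \<eta> * norm (x - \<eta>)" by simp
    \<comment> \<open>Submultiplicativity of \<open>1 + norm\<close> moves the polynomial weight to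
      the centre \<open>\<eta>\<close> of the Gaussian.\<close>
    ultimately have n: "1 + norm x \<le> (1 + norm \<eta>) * (1 + norm (x - \<eta>))"
      unfolding distrib_left distrib_right by linarith
    have "(1 + norm x) ^ N * norm (complex_of_real (q x * gauss x)) = (1 + norm x) ^ N * (\<bar>q x\<bar> * gauss x)"
      by (simp add: norm_mult abs_mult)
    also have "\<dots> \<le> (1 + norm x) ^ N * ((C * (1 + norm x) ^ M) * gauss x)"
      by (intro mult_left_mono mult_right_mono C) auto
    also have "\<dots> = C * (1 + norm x) ^ (N + M) * gauss x" by (simp add: power_add)
    also have "\<dots> \<le> C * ((1 + norm \<eta>) * (1 + norm (x - \<eta>))) ^ (N + M) * gauss x"
      using n C by (intro mult_left_mono mult_right_mono power_mono) auto
    also have "\<dots> = C * (1 + norm \<eta>) ^ (N + M) * ((1 + norm (x - \<eta>)) ^ (N + M) * exp (- (a / 2) * (norm (x - \<eta>))\<^sup>2))"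
      by (simp add: power_mult_distrib)
    also have "\<dots> \<le> C * (1 + norm \<eta>) ^ (N + M) * K"
      using C by (intro mult_left_mono K) auto
    finally show ?thesis .
  qed
  then show "\<exists>C. \<forall>x. (1 + norm x) ^ N * norm (iterated_partial vs (\<lambda>x. complex_of_real (gauss x)) x) \<le> C"
    unfolding eq by blast
qed

lemma fourier_transform_gauss:
  "fourier_transform (\<lambda>x. complex_of_real (gauss x)) \<xi>
     = complex_of_real (sqrt (2 * pi / a) ^ DIM('a) * exp (- (norm \<xi>)\<^sup>2 / (2 * a))) * exp (- \<i> * complex_of_real (\<eta> \<bullet> \<xi>))"
proof -
  have shift: "complex_of_real (gauss (\<eta> + x)) * exp (- \<i> * complex_of_real ((\<eta> + x) \<bullet> \<xi>))
    = exp (- \<i> * complex_of_real (\<eta> \<bullet> \<xi>)) *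
       (complex_of_real (exp (- a * (norm x)\<^sup>2 / 2)) * exp (\<i> * complex_of_real (- \<xi> \<bullet> x)))" for x
  proof -
    have "- \<i> * complex_of_real ((\<eta> + x) \<bullet> \<xi>) = - \<i> * complex_of_real (\<eta> \<bullet> \<xi>) + \<i> * complex_of_real (- \<xi> \<bullet> x)"
      by (simp add: inner_add_left inner_commute algebra_simps)
    then show ?thesis by (simp only: exp_add add_diff_cancel_left' mult.left_commute)
  qed
  have "fourier_transform (\<lambda>x. complex_of_real (gauss x)) \<xi>
    = (LINT x|distr lborel borel ((+) \<eta>). complex_of_real (gauss x) * exp (- \<i> * complex_of_real (x \<bullet> \<xi>)))"
    by (simp add: fourier_transform_def lborel_distr_plus)
  also have "\<dots> = (LINT x|lborel. exp (- \<i> * complex_of_real (\<eta> \<bullet> \<xi>)) *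
       (complex_of_real (exp (- a * (norm x)\<^sup>2 / 2)) * exp (\<i> * complex_of_real (- \<xi> \<bullet> x))))"
    by (subst integral_distr) (simp_all only: shift, auto)
  also have "\<dots> = exp (- \<i> * complex_of_real (\<eta> \<bullet> \<xi>)) *
     complex_of_real (sqrt (2 * pi / a) ^ DIM('a) * exp (- (norm \<xi>)\<^sup>2 / (2 * a)))"
    by (subst integral_mult_right_zero, subst fourier_gaussian(2)[OF a]) simp
  finally show ?thesis by (simp add: mult.commute)
qed

end

text \<open>The distribution is tested on a Gaussian centred at \<open>\<eta>\<close>: in the
  transform the translation becomes a modulation, whose real part is the cosine.\<close>

lemma positive_definite_cos_integral_nonneg:
  fixes f :: "'a::euclidean_space \<Rightarrow> real" and \<alpha> :: real
  assumes pd: "positive_definite_distribution (distribution_of f)" and \<alpha>: "\<alpha> > 0"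
    and int: "integrable lborel (\<lambda>z. f z * exp (- \<alpha> * (norm z)\<^sup>2 / 2))"
  shows "0 \<le> (LINT z|lborel. f z * exp (- \<alpha> * (norm z)\<^sup>2 / 2) * cos (\<eta> \<bullet> z))"
proof -
  \<comment> \<open>The transform inverts the width, so this choice produces the decay rate
    \<open>\<alpha>\<close>.\<close>
  let ?a = "1 / \<alpha>"
  let ?\<phi> = "\<lambda>x::'a. complex_of_real (exp (- ?a * (norm (x - \<eta>))\<^sup>2 / 2))"
  let ?c = "sqrt (2 * pi / ?a) ^ DIM('a)"
  have a: "?a > 0" and c: "?c > 0" using \<alpha> by auto
  have eq: "complex_of_real (f z) * fourier_transform ?\<phi> z
     = complex_of_real ?c * (complex_of_real (f z * exp (- \<alpha> * (norm z)\<^sup>2 / 2)) * exp (- \<i> * complex_of_real (\<eta> \<bullet> z)))" for z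
    unfolding fourier_transform_gauss[OF a] by (simp add: mult_ac)
  have int': "integrable lborel (\<lambda>z. complex_of_real (f z * exp (- \<alpha> * (norm z)\<^sup>2 / 2)) * exp (- \<i> * complex_of_real (\<eta> \<bullet> z)))"
  proof (rule Bochner_Integration.integrable_bound[OF int])
    have "(\<lambda>z. f z * exp (- \<alpha> * (norm z)\<^sup>2 / 2)) \<in> borel_measurable lborel"
      using int by (rule borel_measurable_integrable)
    from measurable_compose[OF this borel_measurable_of_real]
    show "(\<lambda>z. complex_of_real (f z * exp (- \<alpha> * (norm z)\<^sup>2 / 2)) * exp (- \<i> * complex_of_real (\<eta> \<bullet> z))) \<in> borel_measurable lborel"
      by (rule borel_measurable_times) measurable
  qed (auto simp: norm_mult)
  have "fourier_distribution (distribution_of f) ?\<phi> \<in> \<real>\<^sub>\<ge>\<^sub>0"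
    using pd schwartz_gauss[OF a, of \<eta>] unfolding positive_definite_distribution_def by (auto simp: complex_nonneg_Reals_iff)
  then have "0 \<le> Re (LINT z|lborel. complex_of_real ?c * (complex_of_real (f z * exp (- \<alpha> * (norm z)\<^sup>2 / 2)) * exp (- \<i> * complex_of_real (\<eta> \<bullet> z))))"
    unfolding fourier_distribution_def distribution_of_def eq by (simp add: complex_nonneg_Reals_iff)
  also have "\<dots> = ?c * Re (LINT z|lborel. complex_of_real (f z * exp (- \<alpha> * (norm z)\<^sup>2 / 2)) * exp (- \<i> * complex_of_real (\<eta> \<bullet> z)))"
    by (subst integral_mult_right_zero) (simp del: of_real_power)
  also have "Re (LINT z|lborel. complex_of_real (f z * exp (- \<alpha> * (norm z)\<^sup>2 / 2)) * exp (- \<i> * complex_of_real (\<eta> \<bullet> z)))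
    = (LINT z|lborel. f z * exp (- \<alpha> * (norm z)\<^sup>2 / 2) * cos (\<eta> \<bullet> z))"
    by (subst integral_Re[OF int', symmetric]) (simp add: Re_exp)
  finally show ?thesis using c by (simp add: zero_le_mult_iff)
qed

section \<open>The slice theorem\<close>

text \<open>The product of two integrable functions of separate variables is integrable on the
  product space, and a bounded kernel preserves that. This covers the exchanges with a cosine, with
  a product of cosines and with \<open>cos_kernel\<close>.\<close>

lemma integral_swap_bounded_kernel:
  fixes f :: "'a \<Rightarrow> real" and g :: "'b \<Rightarrow> real" and k :: "'a \<Rightarrow> 'b \<Rightarrow> real"
  assumes M: "sigma_finite_measure M" and N: "sigma_finite_measure N"
    and f: "integrable M f" and g: "integrable N g"
    and k[measurable]: "(\<lambda>(x, y). k x y) \<in> borel_measurable (M \<Otimes>\<^sub>M N)" and bound: "\<And>x y. \<bar>k x y\<bar> \<le> K"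
  shows "(LINT x|M. f x * (LINT y|N. g y * k x y)) = (LINT y|N. g y * (LINT x|M. f x * k x y))"
proof -
  interpret M: sigma_finite_measure M by fact
  interpret N: sigma_finite_measure N by fact
  interpret pair_sigma_finite M N ..
  have [measurable]: "f \<in> borel_measurable M" "g \<in> borel_measurable N" using f g by auto
  have fg: "integrable (M \<Otimes>\<^sub>M N) (\<lambda>(x, y). f x * g y)"
  proof (rule Fubini_integrable)
    show "integrable M (\<lambda>x. LINT y|N. norm (case (x, y) of (x, y) \<Rightarrow> f x * g y))"
      using f g by (simp add: abs_mult)
    show "AE x in M. integrable N (\<lambda>y. case (x, y) of (x, y) \<Rightarrow> f x * g y)"
      using g by simp
  qed measurable
  have "integrable (M \<Otimes>\<^sub>M N) (\<lambda>(x, y). f x * g y * k x y)"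
  proof (rule Bochner_Integration.integrable_bound[OF integrable_mult_left[OF fg, of K]])
    show "AE z in M \<Otimes>\<^sub>M N. norm (case z of (x, y) \<Rightarrow> f x * g y * k x y) \<le> norm ((case z of (x, y) \<Rightarrow> f x * g y) * K)"
    proof (rule AE_I2, clarify)
      fix x y
      have "\<bar>f x * g y\<bar> * \<bar>k x y\<bar> \<le> \<bar>f x * g y\<bar> * \<bar>K\<bar>"
        using bound[of x y] by (intro mult_left_mono) auto
      then show "norm (f x * g y * k x y) \<le> norm (f x * g y * K)" by (simp add: abs_mult)
    qed
  qed measurable
  from Fubini_integral[OF this]
  have "(LINT y|N. LINT x|M. f x * g y * k x y) = (LINT x|M. LINT y|N. f x * g y * k x y)" by simp
  moreover have "(LINT y|N. f x * g y * k x y) = f x * (LINT y|N. g y * k x y)" for x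
    by (subst integral_mult_right_zero[symmetric]) (simp add: mult_ac)
  moreover have "(LINT x|M. f x * g y * k x y) = g y * (LINT x|M. f x * k x y)" for y
    by (subst integral_mult_right_zero[symmetric]) (simp add: mult_ac)
  ultimately show ?thesis by simp
qed

lemma integrable_frame_lborel_gaussian:
  fixes a :: real
  assumes "orthonormal B" "a > 0"
  shows "integrable (frame_lborel B) (\<lambda>x. exp (- a * (norm x)\<^sup>2 / 2))"
    and "(LINT x|frame_lborel B. exp (- a * (norm x)\<^sup>2 / 2)) = sqrt (2 * pi / a) ^ card B"
proof -
  show "integrable (frame_lborel B) (\<lambda>x. exp (- a * (norm x)\<^sup>2 / 2))"
    using nn_integral_frame_lborel_gaussian[OF assms] by (intro integrableI_bounded) auto
  show "(LINT x|frame_lborel B. exp (- a * (norm x)\<^sup>2 / 2)) = sqrt (2 * pi / a) ^ card B"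
    using nn_integral_frame_lborel_gaussian[OF assms] assms by (subst integral_eq_nn_integral) auto
qed

text \<open>The cosine transform of \<open>exp (- \<sigma>\<^sup>2 * s\<^sup>2 / 2)\<close>. It has
  total mass \<open>2 * pi\<close> and concentrates at 0 as \<sigma> tends to 0, acting like a
  multiple of the delta function there.\<close>

definition cos_kernel :: "real \<Rightarrow> real \<Rightarrow> real" where
  "cos_kernel \<sigma> t = sqrt (2 * pi) / \<sigma> * exp (- t\<^sup>2 / (2 * \<sigma>\<^sup>2))"

lemma measurable_cos_kernel [measurable]: "cos_kernel \<sigma> \<in> borel_measurable borel"
  unfolding cos_kernel_def by measurable

lemma cos_kernel_bound: "\<sigma> > 0 \<Longrightarrow> \<bar>cos_kernel \<sigma> t\<bar> \<le> sqrt (2 * pi) / \<sigma>"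
  unfolding cos_kernel_def abs_mult
  using mult_left_mono[of "exp (- t\<^sup>2 / (2 * \<sigma>\<^sup>2))" 1 "sqrt (2 * pi) / \<sigma>"] by simp

lemma integral_cos_kernel:
  assumes "\<sigma> > 0"
  shows "(LINT s|lborel. exp (- \<sigma>\<^sup>2 * s\<^sup>2 / 2) * cos (s * t)) = cos_kernel \<sigma> t"
  using cos_gaussian[of "\<sigma>\<^sup>2" t] assms
  by (simp add: cos_kernel_def real_sqrt_divide mult.commute)

text \<open>Take \<open>u\<close> to be the normalised projection of \<open>\<xi>\<close>. Then the
  inner product of \<open>y\<close> with \<open>\<xi>\<close> depends only on the
  \<open>u\<close>-coordinate of \<open>y\<close>, scaled by the norm of the projection. The
  substitution that standardises the Gaussian moves \<open>\<sigma>\<close> from the kernel into the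
  argument of \<open>G\<close>, and its Jacobian leaves the prefactor. The frame does not depend on
  \<open>\<sigma>\<close>, so a limit can be taken afterwards.\<close>

lemma integral_cos_kernel_slice:
  fixes G :: "'a::euclidean_space \<Rightarrow> real" and B :: "'a set" and \<xi> :: 'a
  assumes B: "orthonormal B"
    and G[measurable]: "G \<in> borel_measurable borel" and GD: "\<And>x. \<bar>G x\<bar> \<le> D * exp (- 1 * (norm x)\<^sup>2 / 2)"
    and h: "frame_proj B \<xi> \<noteq> 0"
  obtains u B' where "orthonormal (insert u B')" "u \<notin> B'" "orthonormal B'" "span B' \<subseteq> span B" "Suc (card B') = card B"
    and "\<forall>\<sigma>>0. (LINT y|frame_lborel B. G y * cos_kernel \<sigma> (y \<bullet> \<xi>))
      = sqrt (2 * pi) / norm (frame_proj B \<xi>) * (LINT x|frame_lborel B'. LINT t|lborel. G (x + (\<sigma> * t / norm (frame_proj B \<xi>)) *\<^sub>R u) * exp (- 1 * t\<^sup>2 / 2))"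
proof -
  let ?\<eta> = "frame_proj B \<xi>"
  define u where "u = ?\<eta> /\<^sub>R norm ?\<eta>"
  have u: "norm u = 1" "u \<in> span B" and \<eta>u: "?\<eta> = norm ?\<eta> *\<^sub>R u"
    using h by (auto simp: u_def intro: span_mul frame_proj_in_span)
  have "orthonormal {u}" using u by (auto simp: orthonormal_def pairwise_def)
  then obtain E where E: "{u} \<subseteq> E" "orthonormal E" "span E = span B"
    using orthonormal_extend[of "{u}" "span B"] u by auto
  define B' where "B' = E - {u}"
  have EB: "E = insert u B'" "u \<notin> B'" using E by (auto simp: B'_def)
  have oE: "orthonormal (insert u B')" using E EB by simp
  have oB': "orthonormal B'" using oE orthonormal_subset by blast
  have card: "Suc (card B') = card B"
  proof -
    have "card E = card B" by (simp only: orthonormal_card[OF B] orthonormal_card[OF E(2)] E(3))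
    then show ?thesis using EB orthonormal_finite[OF oB'] by simp
  qed
  have sp: "span B' \<subseteq> span B" using E(3) EB span_mono[of B' E] by auto
  have fr: "frame_lborel B = distr (frame_lborel B' \<Otimes>\<^sub>M lborel) borel (\<lambda>(x, t). x + t *\<^sub>R u)"
    using frame_lborel_cong[OF B E(2)] E(3) frame_lborel_insert[OF oE EB(2)] EB(1) by simp
  interpret B': sigma_finite_measure "frame_lborel B'" by (rule sigma_finite_frame_lborel[OF oB'])
  interpret pair_sigma_finite "frame_lborel B'" "lborel :: real measure" ..
  show thesis
  proof (rule that[OF oE EB(2) oB' sp card], intro allI impI)
    fix \<sigma> :: real assume \<sigma>: "\<sigma> > 0"
    have D: "0 \<le> D" using GD[of 0] by simp
    have int: "integrable (frame_lborel B) (\<lambda>y. G y * cos_kernel \<sigma> (y \<bullet> \<xi>))"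
    proof (rule Bochner_Integration.integrable_bound)
      show "integrable (frame_lborel B) (\<lambda>y. D * exp (- 1 * (norm y)\<^sup>2 / 2) * (sqrt (2 * pi) / \<sigma>))"
        by (intro integrable_mult_left integrable_mult_right integrable_frame_lborel_gaussian B) simp
      show "AE y in frame_lborel B. norm (G y * cos_kernel \<sigma> (y \<bullet> \<xi>)) \<le> norm (D * exp (- 1 * (norm y)\<^sup>2 / 2) * (sqrt (2 * pi) / \<sigma>))"
      proof (rule AE_I2)
        fix y
        have "\<bar>G y\<bar> * \<bar>cos_kernel \<sigma> (y \<bullet> \<xi>)\<bar> \<le> D * exp (- 1 * (norm y)\<^sup>2 / 2) * (sqrt (2 * pi) / \<sigma>)"
          using D by (intro mult_mono GD cos_kernel_bound \<sigma>) auto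
        then show "norm (G y * cos_kernel \<sigma> (y \<bullet> \<xi>)) \<le> norm (D * exp (- 1 * (norm y)\<^sup>2 / 2) * (sqrt (2 * pi) / \<sigma>))"
          using D \<sigma> by (simp add: abs_mult)
      qed
    qed measurable
    then have int': "integrable (frame_lborel B' \<Otimes>\<^sub>M lborel) (\<lambda>(x, t). G (x + t *\<^sub>R u) * cos_kernel \<sigma> ((x + t *\<^sub>R u) \<bullet> \<xi>))"
      unfolding fr by (subst (asm) integrable_distr_eq) (auto simp: case_prod_beta')
    have "(LINT y|frame_lborel B. G y * cos_kernel \<sigma> (y \<bullet> \<xi>))
      = (LINT z|(frame_lborel B' \<Otimes>\<^sub>M lborel). (case z of (x, t) \<Rightarrow> G (x + t *\<^sub>R u) * cos_kernel \<sigma> ((x + t *\<^sub>R u) \<bullet> \<xi>)))"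
      unfolding fr by (subst integral_distr) (auto simp: case_prod_beta')
    also have "\<dots> = (LINT x|frame_lborel B'. LINT t|lborel. G (x + t *\<^sub>R u) * cos_kernel \<sigma> ((x + t *\<^sub>R u) \<bullet> \<xi>))"
      using integral_fst'[OF int'] by simp
    also have "\<dots> = (LINT x|frame_lborel B'. sqrt (2 * pi) / norm ?\<eta> * (LINT t|lborel. G (x + (\<sigma> * t / norm ?\<eta>) *\<^sub>R u) * exp (- 1 * t\<^sup>2 / 2)))"
    proof (rule integral_cong_AE)
      show "AE x in frame_lborel B'. (LINT t|lborel. G (x + t *\<^sub>R u) * cos_kernel \<sigma> ((x + t *\<^sub>R u) \<bullet> \<xi>))
        = sqrt (2 * pi) / norm ?\<eta> * (LINT t|lborel. G (x + (\<sigma> * t / norm ?\<eta>) *\<^sub>R u) * exp (- 1 * t\<^sup>2 / 2))"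
        using AE_frame_lborel_span
      proof eventually_elim
        fix x assume x: "x \<in> span B'"
        have ip: "(x + t *\<^sub>R u) \<bullet> \<xi> = t * norm ?\<eta>" for t
        proof -
          have "x + t *\<^sub>R u \<in> span B" using x sp u by (auto intro!: span_add span_mul)
          then have "(x + t *\<^sub>R u) \<bullet> \<xi> = (x + t *\<^sub>R u) \<bullet> ?\<eta>" using inner_frame_proj[OF B] by simp
          also have "\<dots> = norm ?\<eta> * ((x + t *\<^sub>R u) \<bullet> u)" by (subst \<eta>u) simp
          also have "(x + t *\<^sub>R u) \<bullet> u = t"
            using orthonormal_insert_inner_span[OF oE EB(2) x] u(1)
            by (simp add: inner_add_left inner_commute[of x] norm_eq_1)
          finally show ?thesis by simp
        qed
        have "(LINT t|lborel. G (x + t *\<^sub>R u) * cos_kernel \<sigma> ((x + t *\<^sub>R u) \<bullet> \<xi>))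
          = (LINT t|lborel. G (x + t *\<^sub>R u) * cos_kernel \<sigma> (t * norm ?\<eta>))" by (simp add: ip)
        also have "\<dots> = \<bar>\<sigma> / norm ?\<eta>\<bar> *\<^sub>R (LINT t|lborel. G (x + (0 + \<sigma> / norm ?\<eta> * t) *\<^sub>R u) * cos_kernel \<sigma> ((0 + \<sigma> / norm ?\<eta> * t) * norm ?\<eta>))"
          using \<sigma> h by (intro lborel_integral_real_affine) auto
        also have "\<dots> = \<sigma> / norm ?\<eta> * (LINT t|lborel. sqrt (2 * pi) / \<sigma> * (G (x + (\<sigma> * t / norm ?\<eta>) *\<^sub>R u) * exp (- 1 * t\<^sup>2 / 2)))"
          using \<sigma> h by (simp add: cos_kernel_def power_mult_distrib mult_ac)
        also have "\<dots> = sqrt (2 * pi) / norm ?\<eta> * (LINT t|lborel. G (x + (\<sigma> * t / norm ?\<eta>) *\<^sub>R u) * exp (- 1 * t\<^sup>2 / 2))"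
          using \<sigma> by (subst integral_mult_right_zero) simp
        finally show "(LINT t|lborel. G (x + t *\<^sub>R u) * cos_kernel \<sigma> ((x + t *\<^sub>R u) \<bullet> \<xi>))
          = sqrt (2 * pi) / norm ?\<eta> * (LINT t|lborel. G (x + (\<sigma> * t / norm ?\<eta>) *\<^sub>R u) * exp (- 1 * t\<^sup>2 / 2))" .
      qed
    qed measurable
    finally show "(LINT y|frame_lborel B. G y * cos_kernel \<sigma> (y \<bullet> \<xi>))
      = sqrt (2 * pi) / norm ?\<eta> * (LINT x|frame_lborel B'. LINT t|lborel. G (x + (\<sigma> * t / norm ?\<eta>) *\<^sub>R u) * exp (- 1 * t\<^sup>2 / 2))"
      by simp
  qed
qed

text \<open>As \<sigma> tends to 0 the slab shrinks to the hyperplane spanned by \<open>B'\<close>.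
  Dominated convergence, first in \<open>t\<close> and then in \<open>x\<close>, gives
  \<open>2 * pi / norm (frame_proj B \<xi>)\<close> times the hyperplane integral of
  \<open>G\<close>; the inner limit uses continuity of \<open>G\<close> at almost every point of the
  hyperplane. The first conclusion is uniform in \<sigma> and later dominates the integral over
  frequencies.\<close>

lemma cos_kernel_slice_limit:
  fixes G :: "'a::euclidean_space \<Rightarrow> real" and B :: "'a set" and \<xi> :: 'a
  assumes B: "orthonormal B"
    and G[measurable]: "G \<in> borel_measurable borel" and GD: "\<And>x. \<bar>G x\<bar> \<le> D * exp (- 1 * (norm x)\<^sup>2 / 2)"
    and slice: "\<And>B'. orthonormal B' \<Longrightarrow> span B' \<subseteq> span B \<Longrightarrow> Suc (card B') = card B \<Longrightarrow>
        (LINT x|frame_lborel B'. G x) \<le> 0 \<and> (AE x in frame_lborel B'. isCont G x)"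
    and h: "frame_proj B \<xi> \<noteq> 0"
  shows "\<And>\<sigma>. \<sigma> > 0 \<Longrightarrow> \<bar>LINT y|frame_lborel B. G y * cos_kernel \<sigma> (y \<bullet> \<xi>)\<bar> \<le> D * sqrt (2 * pi) ^ Suc (card B) / norm (frame_proj B \<xi>)"
    and "\<exists>L\<le>0. (\<lambda>n. LINT y|frame_lborel B. G y * cos_kernel (1 / Suc n) (y \<bullet> \<xi>)) \<longlonglongrightarrow> L"
proof -
  let ?\<eta> = "frame_proj B \<xi>"
  obtain u B' where oE: "orthonormal (insert u B')" and uB': "u \<notin> B'" and oB': "orthonormal B'"
    and sp: "span B' \<subseteq> span B" and card: "Suc (card B') = card B"
    and eq': "\<forall>\<sigma>>0. (LINT y|frame_lborel B. G y * cos_kernel \<sigma> (y \<bullet> \<xi>))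
      = sqrt (2 * pi) / norm ?\<eta> * (LINT x|frame_lborel B'. LINT t|lborel. G (x + (\<sigma> * t / norm ?\<eta>) *\<^sub>R u) * exp (- 1 * t\<^sup>2 / 2))"
    by (rule integral_cos_kernel_slice[OF B G GD h]) (rule that; assumption)
  note eq = eq'[rule_format]
  have D: "0 \<le> D" using GD[of 0] by simp
  let ?I = "\<lambda>\<sigma> x. LINT t|lborel. G (x + (\<sigma> * t / norm ?\<eta>) *\<^sub>R u) * exp (- 1 * t\<^sup>2 / 2)"
  have g1: "integrable lborel (\<lambda>t::real. exp (- 1 * t\<^sup>2 / 2))" "(LINT t|lborel. exp (- 1 * t\<^sup>2 / 2 :: real)) = sqrt (2 * pi)"
    using integrable_exp_neg_square[of 1] by auto
  \<comment> \<open>Moving along \<open>u\<close>, orthogonally to \<open>x\<close>, can only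
    increase the norm, so the Gaussian bound at \<open>x\<close> holds on the whole line.\<close>
  have Gb: "\<bar>G (x + r *\<^sub>R u)\<bar> \<le> D * exp (- 1 * (norm x)\<^sup>2 / 2)" if x: "x \<in> span B'" for x r
  proof -
    have "\<bar>G (x + r *\<^sub>R u)\<bar> \<le> D * exp (- 1 * (norm (x + r *\<^sub>R u))\<^sup>2 / 2)" by (rule GD)
    also have "\<dots> \<le> D * exp (- 1 * (norm x)\<^sup>2 / 2)"
      unfolding orthonormal_insert_norm[OF oE uB' x] using D by (intro mult_left_mono) auto
    finally show ?thesis .
  qed
  have Ib: "\<bar>?I \<sigma> x\<bar> \<le> D * exp (- 1 * (norm x)\<^sup>2 / 2) * sqrt (2 * pi)" if x: "x \<in> span B'" for \<sigma> x
  proof -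
    have "\<bar>?I \<sigma> x\<bar> \<le> (LINT t|lborel. D * exp (- 1 * (norm x)\<^sup>2 / 2) * exp (- 1 * t\<^sup>2 / 2))"
    proof (rule integral_abs_bound_integral)
      show b: "\<bar>G (x + (\<sigma> * t / norm ?\<eta>) *\<^sub>R u) * exp (- 1 * t\<^sup>2 / 2)\<bar> \<le> D * exp (- 1 * (norm x)\<^sup>2 / 2) * exp (- 1 * t\<^sup>2 / 2)" for t
        unfolding abs_mult by (simp only: abs_exp_cancel, intro mult_right_mono Gb x) auto
      show i: "integrable lborel (\<lambda>t. D * exp (- 1 * (norm x)\<^sup>2 / 2) * exp (- 1 * t\<^sup>2 / 2))"
        by (intro integrable_mult_right g1)
      show "integrable lborel (\<lambda>t. G (x + (\<sigma> * t / norm ?\<eta>) *\<^sub>R u) * exp (- 1 * t\<^sup>2 / 2))"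
        by (rule Bochner_Integration.integrable_bound[OF i]) (use b D in \<open>auto intro!: AE_I2 simp: abs_mult\<close>)
    qed
    also have "\<dots> = D * exp (- 1 * (norm x)\<^sup>2 / 2) * sqrt (2 * pi)"
      by (simp only: integral_mult_right_zero g1)
    finally show ?thesis .
  qed
  have intD: "integrable (frame_lborel B') (\<lambda>x. D * exp (- 1 * (norm x)\<^sup>2 / 2) * sqrt (2 * pi))"
    by (intro integrable_mult_left integrable_mult_right integrable_frame_lborel_gaussian oB') simp
  have AEb: "AE x in frame_lborel B'. norm (?I \<sigma> x) \<le> D * exp (- 1 * (norm x)\<^sup>2 / 2) * sqrt (2 * pi)" for \<sigma>
    using AE_frame_lborel_span by eventually_elim (simp only: real_norm_def Ib)
  {
    fix \<sigma> :: real assume \<sigma>: "\<sigma> > 0"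
    have "\<bar>LINT x|frame_lborel B'. ?I \<sigma> x\<bar> \<le> (LINT x|frame_lborel B'. \<bar>?I \<sigma> x\<bar>)"
      using integral_norm_bound[of "frame_lborel B'" "?I \<sigma>"] by simp
    also have "\<dots> \<le> (LINT x|frame_lborel B'. D * exp (- 1 * (norm x)\<^sup>2 / 2) * sqrt (2 * pi))"
      by (rule integral_mono_AE'[OF intD]) (use AEb[of \<sigma>] in auto)
    also have "\<dots> = D * sqrt (2 * pi) ^ card B' * sqrt (2 * pi)"
      using integrable_frame_lborel_gaussian[OF oB', of 1] by simp
    finally have "\<bar>LINT x|frame_lborel B'. ?I \<sigma> x\<bar> \<le> D * sqrt (2 * pi) ^ card B"
      unfolding card[symmetric] by (simp add: mult_ac)
    then have "sqrt (2 * pi) / norm ?\<eta> * \<bar>LINT x|frame_lborel B'. ?I \<sigma> x\<bar> \<le> sqrt (2 * pi) / norm ?\<eta> * (D * sqrt (2 * pi) ^ card B)"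
      by (intro mult_left_mono) auto
    then show "\<bar>LINT y|frame_lborel B. G y * cos_kernel \<sigma> (y \<bullet> \<xi>)\<bar> \<le> D * sqrt (2 * pi) ^ Suc (card B) / norm ?\<eta>"
      unfolding eq[OF \<sigma>] by (simp add: abs_mult mult_ac)
  }
  have "(\<lambda>n. LINT x|frame_lborel B'. ?I (1 / Suc n) x) \<longlonglongrightarrow> (LINT x|frame_lborel B'. G x * sqrt (2 * pi))"
  proof (rule integral_dominated_convergence[OF _ _ intD])
    show "AE x in frame_lborel B'. norm (?I (1 / real (Suc n)) x) \<le> D * exp (- 1 * (norm x)\<^sup>2 / 2) * sqrt (2 * pi)" for n
      by (rule AEb)
    have "AE x in frame_lborel B'. isCont G x" using slice[OF oB' sp card] by simp
    then show "AE x in frame_lborel B'. (\<lambda>n. ?I (1 / real (Suc n)) x) \<longlonglongrightarrow> G x * sqrt (2 * pi)"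
      using AE_frame_lborel_span
    proof eventually_elim
      fix x assume x: "isCont G x" "x \<in> span B'"
      have "(\<lambda>n. ?I (1 / real (Suc n)) x) \<longlonglongrightarrow> (LINT t|lborel. G x * exp (- 1 * t\<^sup>2 / 2))"
      proof (rule integral_dominated_convergence[where w="\<lambda>t. D * exp (- 1 * (norm x)\<^sup>2 / 2) * exp (- 1 * t\<^sup>2 / 2)"])
        show "integrable lborel (\<lambda>t. D * exp (- 1 * (norm x)\<^sup>2 / 2) * exp (- 1 * t\<^sup>2 / 2))"
          by (intro integrable_mult_right g1)
        show "AE t in lborel. norm (G (x + (1 / real (Suc n) * t / norm ?\<eta>) *\<^sub>R u) * exp (- 1 * t\<^sup>2 / 2)) \<le> D * exp (- 1 * (norm x)\<^sup>2 / 2) * exp (- 1 * t\<^sup>2 / 2)" for n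
          unfolding real_norm_def
          by (rule AE_I2, simp only: abs_mult abs_exp_cancel, intro mult_right_mono Gb x) auto
        show "AE t in lborel. (\<lambda>n. G (x + (1 / real (Suc n) * t / norm ?\<eta>) *\<^sub>R u) * exp (- 1 * t\<^sup>2 / 2)) \<longlonglongrightarrow> G x * exp (- 1 * t\<^sup>2 / 2)"
        proof (rule AE_I2)
          fix t :: real
          have "(\<lambda>n. x + (1 / real (Suc n) * t / norm ?\<eta>) *\<^sub>R u) \<longlonglongrightarrow> x + (0 * t / norm ?\<eta>) *\<^sub>R u"
            by (intro tendsto_intros LIMSEQ_Suc[OF lim_inverse_n'] ) (use h in auto)
          then have "(\<lambda>n. G (x + (1 / real (Suc n) * t / norm ?\<eta>) *\<^sub>R u)) \<longlonglongrightarrow> G x"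
            using isCont_tendsto_compose[OF x(1)] by simp
          then show "(\<lambda>n. G (x + (1 / real (Suc n) * t / norm ?\<eta>) *\<^sub>R u) * exp (- 1 * t\<^sup>2 / 2)) \<longlonglongrightarrow> G x * exp (- 1 * t\<^sup>2 / 2)"
            by (intro tendsto_mult tendsto_const)
        qed
      qed measurable
      then show "(\<lambda>n. ?I (1 / real (Suc n)) x) \<longlonglongrightarrow> G x * sqrt (2 * pi)"
        by (simp only: integral_mult_right_zero g1)
    qed
  qed measurable
  then have "(\<lambda>n. sqrt (2 * pi) / norm ?\<eta> * (LINT x|frame_lborel B'. ?I (1 / Suc n) x)) \<longlonglongrightarrow>
      sqrt (2 * pi) / norm ?\<eta> * (LINT x|frame_lborel B'. G x * sqrt (2 * pi))"
    by (intro tendsto_mult tendsto_const)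
  moreover have "sqrt (2 * pi) / norm ?\<eta> * (LINT x|frame_lborel B'. G x * sqrt (2 * pi)) \<le> 0"
    unfolding integral_mult_left_zero
    using slice[OF oB' sp card] by (intro mult_nonneg_nonpos mult_nonpos_nonneg) auto
  ultimately show "\<exists>L\<le>0. (\<lambda>n. LINT y|frame_lborel B. G y * cos_kernel (1 / Suc n) (y \<bullet> \<xi>)) \<longlonglongrightarrow> L"
    using eq by auto
qed

lemma AE_frame_lborel_neq_0:
  assumes "orthonormal B" "card B \<ge> 1"
  shows "AE x in frame_lborel B. x \<noteq> 0"
proof -
  obtain w where "w \<in> B" using assms(2) by fastforce
  from AE_frame_lborel_inner_neq_0[OF assms(1) this] show ?thesis
    by eventually_elim auto
qed

lemma AE_lborel_frame_proj_neq_0: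
  fixes B :: "'a::euclidean_space set"
  assumes "orthonormal B" "card B \<ge> 1"
  shows "AE x in lborel. frame_proj B x \<noteq> 0"
proof -
  obtain w where w: "w \<in> B" using assms(2) by fastforce
  obtain E where E: "B \<subseteq> E" "orthonormal E" "span E = UNIV"
    using orthonormal_extend[OF assms(1) subspace_UNIV] by auto
  then have "AE x in lborel. w \<bullet> x \<noteq> 0"
    using AE_frame_lborel_inner_neq_0[OF E(2) subsetD[OF E(1) w]] by (simp only: frame_lborel_UNIV)
  then show ?thesis
  proof eventually_elim
    fix x assume "w \<bullet> x \<noteq> 0"
    with inner_le_norm_frame_proj[OF assms(1) w, of x] show "frame_proj B x \<noteq> 0" by auto
  qed
qed

text \<open>Formally, \<open>\<integral> p (s *\<^sub>R y) ds\<close> is \<open>2 * pi / |y|\<close> times the integral of \<open>\<Phi>\<close> over the hyperplane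
  orthogonal to \<open>y\<close>, and exchanging the integrals leaves the hyperplane integrals of \<open>G\<close>,
  weighted by \<open>\<Phi>\<close>. The factor \<open>exp (- \<sigma>\<^sup>2 * s\<^sup>2 / 2)\<close> with \<open>\<sigma> \<rightarrow> 0\<close> makes this rigorous.\<close>

lemma integral_positive_definite_nonpos:
  fixes G \<Phi> :: "'a::euclidean_space \<Rightarrow> real" and B :: "'a set"
  assumes B: "orthonormal B" "card B \<ge> 2"
    and G[measurable]: "G \<in> borel_measurable borel" and GD: "\<And>x. \<bar>G x\<bar> \<le> D * exp (- 1 * (norm x)\<^sup>2 / 2)"
    and slice: "\<And>B'. orthonormal B' \<Longrightarrow> span B' \<subseteq> span B \<Longrightarrow> Suc (card B') = card B \<Longrightarrow>
        (LINT x|frame_lborel B'. G x) \<le> 0 \<and> (AE x in frame_lborel B'. isCont G x)"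
    and \<Phi>[measurable]: "\<Phi> \<in> borel_measurable borel" and \<Phi>0: "\<And>\<xi>. 0 \<le> \<Phi> \<xi>"
    and a: "a > 0" and \<Phi>C: "\<And>\<xi>. \<Phi> \<xi> \<le> C * exp (- a * (norm \<xi>)\<^sup>2 / 2)"
    and p: "\<And>x. p x = (LINT \<xi>|lborel. \<Phi> \<xi> * cos (x \<bullet> \<xi>))"
    and pint: "\<And>y. y \<noteq> 0 \<Longrightarrow> integrable lborel (\<lambda>s. p (s *\<^sub>R y))"
    and pbound: "\<And>y. y \<noteq> 0 \<Longrightarrow> (LINT s|lborel. \<bar>p (s *\<^sub>R y)\<bar>) \<le> K / norm y"
  shows "(LINT y|frame_lborel B. G y * (LINT s|lborel. p (s *\<^sub>R y))) \<le> 0"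
proof -
  let ?\<sigma> = "\<lambda>n. 1 / real (Suc n)"
  let ?W = "\<lambda>n \<xi>. LINT y|frame_lborel B. G y * cos_kernel (?\<sigma> n) (y \<bullet> \<xi>)"
  let ?J = "\<lambda>n y. LINT s|lborel. exp (- (?\<sigma> n)\<^sup>2 * s\<^sup>2 / 2) * p (s *\<^sub>R y)"
  interpret B: sigma_finite_measure "frame_lborel B" by (rule sigma_finite_frame_lborel[OF B(1)])
  have [measurable]: "p \<in> borel_measurable borel" unfolding p[abs_def] by measurable
  have D: "0 \<le> D" and C: "0 \<le> C" using GD[of 0] \<Phi>0[of 0] \<Phi>C[of 0] by auto
  have K: "0 \<le> K"
  proof -
    obtain b :: 'a where "b \<in> Basis" using nonempty_Basis by blast
    then have "(LINT s|lborel. \<bar>p (s *\<^sub>R b)\<bar>) \<le> K" using pbound[of b] by (simp add: nonzero_Basis)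
    moreover have "0 \<le> (LINT s|lborel. \<bar>p (s *\<^sub>R b)\<bar>)" by (rule Bochner_Integration.integral_nonneg) simp
    ultimately show ?thesis by linarith
  qed
  have int\<Phi>: "integrable lborel \<Phi>"
    by (rule Bochner_Integration.integrable_bound[OF integrable_mult_right[OF fourier_gaussian(1)[OF a], of C]])
       (use \<Phi>0 \<Phi>C C in \<open>auto intro!: AE_I2\<close>)
  have intG: "integrable (frame_lborel B) G"
    by (rule Bochner_Integration.integrable_bound[OF integrable_mult_right[OF integrable_frame_lborel_gaussian(1)[OF B(1), of 1], of D]])
       (use GD D in \<open>auto intro!: AE_I2\<close>)
  \<comment> \<open>Two exchanges: integrating the cosine over \<open>s\<close> turns it into
    \<open>cos_kernel\<close>, and then the integrals over the subspace and over frequencies trade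
    places.\<close>
  have eq: "(LINT y|frame_lborel B. G y * ?J n y) = (LINT \<xi>|lborel. \<Phi> \<xi> * ?W n \<xi>)" for n
  proof -
    have \<sigma>: "?\<sigma> n > 0" by simp
    have "?J n y = (LINT \<xi>|lborel. \<Phi> \<xi> * cos_kernel (?\<sigma> n) (y \<bullet> \<xi>))" for y
    proof -
      have "integrable lborel (\<lambda>s::real. exp (- (?\<sigma> n)\<^sup>2 * s\<^sup>2 / 2))"
        by (rule integrable_exp_neg_square) simp
      from integral_swap_bounded_kernel[OF lborel.sigma_finite_measure_axioms lborel.sigma_finite_measure_axioms
          this int\<Phi>, of "\<lambda>s \<xi>. cos ((s *\<^sub>R y) \<bullet> \<xi>)" 1]
      have "?J n y = (LINT \<xi>|lborel. \<Phi> \<xi> * (LINT s|lborel. exp (- (?\<sigma> n)\<^sup>2 * s\<^sup>2 / 2) * cos ((s *\<^sub>R y) \<bullet> \<xi>)))"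
        unfolding p by (simp only: abs_cos_le_one) measurable
      also have "\<dots> = (LINT \<xi>|lborel. \<Phi> \<xi> * cos_kernel (?\<sigma> n) (y \<bullet> \<xi>))"
        using integral_cos_kernel[OF \<sigma>] by (simp only: inner_scaleR_left)
      finally show ?thesis .
    qed
    then have "(LINT y|frame_lborel B. G y * ?J n y) = (LINT y|frame_lborel B. G y * (LINT \<xi>|lborel. \<Phi> \<xi> * cos_kernel (?\<sigma> n) (y \<bullet> \<xi>)))"
      by (simp only:)
    also have "\<dots> = (LINT \<xi>|lborel. \<Phi> \<xi> * ?W n \<xi>)"
      by (rule integral_swap_bounded_kernel[OF B.sigma_finite_measure_axioms lborel.sigma_finite_measure_axioms intG int\<Phi> _ cos_kernel_bound[OF \<sigma>]])
         measurable
    finally show ?thesis .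
  qed
  \<comment> \<open>The hypothesis \<open>pbound\<close> dominates by a Gaussian over the norm,
    which is integrable because \<open>B\<close> has at least two elements.\<close>
  have lim1: "(\<lambda>n. LINT y|frame_lborel B. G y * ?J n y) \<longlonglongrightarrow> (LINT y|frame_lborel B. G y * (LINT s|lborel. p (s *\<^sub>R y)))"
  proof (rule integral_dominated_convergence[where w="\<lambda>y. D * K * (exp (- 1 * (norm y)\<^sup>2 / 2) / norm y)"])
    show "integrable (frame_lborel B) (\<lambda>y. D * K * (exp (- 1 * (norm y)\<^sup>2 / 2) / norm y))"
      by (intro integrable_mult_right integrable_frame_lborel_gaussian_inverse_norm B) simp
    have nz: "AE y in frame_lborel B. y \<noteq> 0" using AE_frame_lborel_neq_0[OF B(1)] B(2) by simp
    then show "AE y in frame_lborel B. (\<lambda>n. G y * ?J n y) \<longlonglongrightarrow> G y * (LINT s|lborel. p (s *\<^sub>R y))"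
    proof eventually_elim
      fix y :: 'a assume y: "y \<noteq> 0"
      have "(\<lambda>n. ?J n y) \<longlonglongrightarrow> (LINT s|lborel. p (s *\<^sub>R y))"
      proof (rule integral_dominated_convergence[OF _ _ integrable_abs[OF pint[OF y]]])
        show "AE s in lborel. (\<lambda>n. exp (- (?\<sigma> n)\<^sup>2 * s\<^sup>2 / 2) * p (s *\<^sub>R y)) \<longlonglongrightarrow> p (s *\<^sub>R y)"
        proof (rule AE_I2)
          fix s :: real
          have "(\<lambda>n. exp (- (?\<sigma> n)\<^sup>2 * s\<^sup>2 / 2) * p (s *\<^sub>R y)) \<longlonglongrightarrow> exp (- 0\<^sup>2 * s\<^sup>2 / 2) * p (s *\<^sub>R y)"
            by (intro tendsto_intros LIMSEQ_Suc[OF lim_inverse_n']) simp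
          then show "(\<lambda>n. exp (- (?\<sigma> n)\<^sup>2 * s\<^sup>2 / 2) * p (s *\<^sub>R y)) \<longlonglongrightarrow> p (s *\<^sub>R y)" by simp
        qed
        show "AE s in lborel. norm (exp (- (?\<sigma> n)\<^sup>2 * s\<^sup>2 / 2) * p (s *\<^sub>R y)) \<le> \<bar>p (s *\<^sub>R y)\<bar>" for n
          by (rule AE_I2) (auto simp: abs_mult intro!: mult_left_le_one_le)
      qed measurable
      then show "(\<lambda>n. G y * ?J n y) \<longlonglongrightarrow> G y * (LINT s|lborel. p (s *\<^sub>R y))"
        by (intro tendsto_mult tendsto_const)
    qed
    show "AE y in frame_lborel B. norm (G y * ?J n y) \<le> D * K * (exp (- 1 * (norm y)\<^sup>2 / 2) / norm y)" for n
      using nz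
    proof eventually_elim
      fix y :: 'a assume y: "y \<noteq> 0"
      have b: "\<bar>exp (- (?\<sigma> n)\<^sup>2 * s\<^sup>2 / 2) * p (s *\<^sub>R y)\<bar> \<le> \<bar>p (s *\<^sub>R y)\<bar>" for s
        by (auto simp: abs_mult intro!: mult_left_le_one_le)
      have "\<bar>?J n y\<bar> \<le> (LINT s|lborel. \<bar>p (s *\<^sub>R y)\<bar>)"
      proof (rule integral_abs_bound_integral[OF _ integrable_abs[OF pint[OF y]] b])
        show "integrable lborel (\<lambda>s. exp (- (?\<sigma> n)\<^sup>2 * s\<^sup>2 / 2) * p (s *\<^sub>R y))"
          by (rule Bochner_Integration.integrable_bound[OF integrable_abs[OF pint[OF y]]])
             (use b in \<open>auto intro!: AE_I2\<close>)
      qed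
      also have "\<dots> \<le> K / norm y" by (rule pbound[OF y])
      finally have "\<bar>G y\<bar> * \<bar>?J n y\<bar> \<le> D * exp (- 1 * (norm y)\<^sup>2 / 2) * (K / norm y)"
        using D by (intro mult_mono GD) auto
      then show "norm (G y * ?J n y) \<le> D * K * (exp (- 1 * (norm y)\<^sup>2 / 2) / norm y)"
        by (simp add: abs_mult mult_ac)
    qed
  qed measurable
  have nz: "AE \<xi> in lborel. frame_proj B \<xi> \<noteq> 0" using AE_lborel_frame_proj_neq_0[OF B(1)] B(2) by simp
  \<comment> \<open>Taking the limit itself, rather than the hyperplane integral it equals, gives
    measurability in \<open>\<xi>\<close> at once: the frame of the hyperplane was chosen separately
    for every \<open>\<xi>\<close>.\<close>
  define L where "L \<xi> = lim (\<lambda>n. ?W n \<xi>)" for \<xi>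
  have L: "L \<xi> \<le> 0" "(\<lambda>n. ?W n \<xi>) \<longlonglongrightarrow> L \<xi>" if "frame_proj B \<xi> \<noteq> 0" for \<xi>
  proof -
    from cos_kernel_slice_limit(2)[OF B(1) G GD slice that]
    obtain l where l: "l \<le> 0" "(\<lambda>n. ?W n \<xi>) \<longlonglongrightarrow> l" by blast
    then have "L \<xi> = l" unfolding L_def by (intro limI)
    with l show "L \<xi> \<le> 0" "(\<lambda>n. ?W n \<xi>) \<longlonglongrightarrow> L \<xi>" by auto
  qed
  have [measurable]: "L \<in> borel_measurable borel"
    unfolding L_def by (rule borel_measurable_lim_metric) measurable
  let ?D = "D * sqrt (2 * pi) ^ Suc (card B)"
  \<comment> \<open>The dominating function is singular along the orthogonal complement of the span
    of \<open>B\<close>. That complement has codimension at least 2, so the singularity is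
    integrable.\<close>
  have lim2: "(\<lambda>n. LINT \<xi>|lborel. \<Phi> \<xi> * ?W n \<xi>) \<longlonglongrightarrow> (LINT \<xi>|lborel. \<Phi> \<xi> * L \<xi>)"
  proof (rule integral_dominated_convergence[where w="\<lambda>\<xi>. C * ?D * (exp (- a * (norm \<xi>)\<^sup>2 / 2) / norm (frame_proj B \<xi>))"])
    show "integrable lborel (\<lambda>\<xi>. C * ?D * (exp (- a * (norm \<xi>)\<^sup>2 / 2) / norm (frame_proj B \<xi>)))"
      by (intro integrable_mult_right integrable_lborel_gaussian_inverse_norm_frame_proj B a)
    show "AE \<xi> in lborel. (\<lambda>n. \<Phi> \<xi> * ?W n \<xi>) \<longlonglongrightarrow> \<Phi> \<xi> * L \<xi>"
      using nz by eventually_elim (intro tendsto_mult tendsto_const L(2))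
    show "AE \<xi> in lborel. norm (\<Phi> \<xi> * ?W n \<xi>) \<le> C * ?D * (exp (- a * (norm \<xi>)\<^sup>2 / 2) / norm (frame_proj B \<xi>))" for n
      using nz
    proof eventually_elim
      fix \<xi> assume h: "frame_proj B \<xi> \<noteq> 0"
      have \<sigma>: "?\<sigma> n > 0" by simp
      have "\<bar>?W n \<xi>\<bar> \<le> ?D / norm (frame_proj B \<xi>)"
        by (rule cos_kernel_slice_limit(1)[OF B(1) G GD slice h \<sigma>])
      then have "\<Phi> \<xi> * \<bar>?W n \<xi>\<bar> \<le> C * exp (- a * (norm \<xi>)\<^sup>2 / 2) * (?D / norm (frame_proj B \<xi>))"
        using C by (intro mult_mono \<Phi>C) auto
      then show "norm (\<Phi> \<xi> * ?W n \<xi>) \<le> C * ?D * (exp (- a * (norm \<xi>)\<^sup>2 / 2) / norm (frame_proj B \<xi>))"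
        using \<Phi>0[of \<xi>] by (simp add: abs_mult mult_ac)
    qed
  qed measurable
  have "(LINT y|frame_lborel B. G y * (LINT s|lborel. p (s *\<^sub>R y))) = (LINT \<xi>|lborel. \<Phi> \<xi> * L \<xi>)"
    using lim1 lim2 unfolding eq by (rule LIMSEQ_unique)
  also have "\<dots> \<le> 0"
  proof -
    have "0 \<le> (LINT \<xi>|lborel. - (\<Phi> \<xi> * L \<xi>))"
      by (rule integral_nonneg_AE) (use nz in \<open>eventually_elim, use L(1) \<Phi>0 in \<open>auto simp: mult_nonneg_nonpos\<close>\<close>)
    then show ?thesis by simp
  qed
  finally show ?thesis .
qed

section \<open>Logarithmic averages\<close>

text \<open>The divergent normaliser, of logarithmic order in \<open>1 / \<epsilon>\<close>. Using
  \<open>1 + \<bar>t\<bar>\<close> instead of \<open>\<bar>t\<bar>\<close> keeps the behaviour at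
  infinity and avoids the singularity at 0.\<close>

definition log_cutoff :: "real \<Rightarrow> real" where
  "log_cutoff \<epsilon> = (LINT t|lborel. exp (- \<epsilon>\<^sup>2 * t\<^sup>2 / 2) / (1 + \<bar>t\<bar>))"

lemma integrable_log_cutoff:
  assumes "\<epsilon> > 0"
  shows "integrable lborel (\<lambda>t::real. exp (- \<epsilon>\<^sup>2 * t\<^sup>2 / 2) / (1 + \<bar>t\<bar>))"
proof (rule Bochner_Integration.integrable_bound[OF integrable_exp_neg_square(1)[of "\<epsilon>\<^sup>2"]])
  show "AE t in lborel. norm (exp (- \<epsilon>\<^sup>2 * t\<^sup>2 / 2) / (1 + \<bar>t\<bar>)) \<le> norm (exp (- \<epsilon>\<^sup>2 * t\<^sup>2 / 2))"
    by (rule AE_I2) (simp add: divide_le_eq mult_le_cancel_left1)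
qed (use assms in auto)

lemma log_cutoff_at_top: "filterlim (\<lambda>n. log_cutoff (1 / Suc n)) at_top sequentially"
proof (rule filterlim_at_top_mono)
  have "filterlim (\<lambda>n. ln (1 + real n)) at_top sequentially"
    by (rule filterlim_compose[OF ln_at_top]) (intro filterlim_tendsto_add_at_top[OF tendsto_const] filterlim_real_sequentially)
  \<comment> \<open>For \<epsilon> equal to \<open>1 / Suc n\<close> the Gaussian factor is at least
    \<open>exp (-1/2)\<close> on the interval from 0 to \<open>n\<close>.\<close>
  then show "filterlim (\<lambda>n. exp (-1/2) * ln (1 + real n)) at_top sequentially"
    by (intro filterlim_tendsto_pos_mult_at_top[OF tendsto_const]) auto
  show "\<forall>\<^sub>F n in sequentially. exp (-1/2) * ln (1 + real n) \<le> log_cutoff (1 / Suc n)"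
  proof (rule always_eventually, rule allI)
    fix n
    have d: "((\<lambda>x. ln (1 + x)) has_real_derivative 1 / (1 + x)) (at x)" if "0 \<le> x" for x :: real
      using that by (auto intro!: derivative_eq_intros)
    have i: "integrable lborel (\<lambda>x. 1 / (1 + x) * indicator {0..real n} x)"
      by (rule integrable_FTC_Icc_nonneg[where F="\<lambda>x. ln (1 + x)"]) (use d in auto)
    have e: "(LINT x|lborel. 1 / (1 + x) * indicator {0..real n} x) = ln (1 + real n) - ln (1 + 0)"
      by (rule integral_FTC_Icc_nonneg[where F="\<lambda>x. ln (1 + x)"]) (use d in auto)
    have "exp (-1/2) * ln (1 + real n) = (LINT x|lborel. exp (-1/2) * (1 / (1 + x) * indicator {0..real n} x))"
      by (simp only: integral_mult_right_zero e) simp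
    also have "\<dots> \<le> log_cutoff (1 / Suc n)"
      unfolding log_cutoff_def
    proof (rule integral_mono)
      show "integrable lborel (\<lambda>x. exp (- 1 / 2) * (1 / (1 + x) * indicator {0..real n} x))"
        by (intro integrable_mult_right i)
      show "integrable lborel (\<lambda>t. exp (- (1 / real (Suc n))\<^sup>2 * t\<^sup>2 / 2) / (1 + \<bar>t\<bar>))"
        by (rule integrable_log_cutoff) simp
      fix x :: real
      show "exp (- 1 / 2) * (1 / (1 + x) * indicator {0..real n} x) \<le> exp (- (1 / real (Suc n))\<^sup>2 * x\<^sup>2 / 2) / (1 + \<bar>x\<bar>)"
      proof (cases "x \<in> {0..real n}")
        case True
        then have "(x / real (Suc n))\<^sup>2 \<le> 1"
          by (intro power_le_one) (auto simp: field_simps)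
        then have "exp (- 1 / 2) \<le> exp (- (1 / real (Suc n))\<^sup>2 * x\<^sup>2 / 2)" by (simp add: power_divide)
        then have "exp (- 1 / 2) / (1 + x) \<le> exp (- (1 / real (Suc n))\<^sup>2 * x\<^sup>2 / 2) / (1 + x)"
          using True by (intro divide_right_mono) auto
        with True show ?thesis by simp
      qed simp
    qed
    finally show "exp (-1/2) * ln (1 + real n) \<le> log_cutoff (1 / Suc n)" .
  qed
qed

lemma integrable_decay_cutoff:
  fixes h :: "real \<Rightarrow> real"
  assumes [measurable]: "h \<in> borel_measurable borel" and hK: "\<And>t. (1 + \<bar>t\<bar>) * \<bar>h t\<bar> \<le> K" and \<epsilon>: "\<epsilon> > 0"
  shows "integrable lborel (\<lambda>t. h t * exp (- \<epsilon>\<^sup>2 * t\<^sup>2 / 2))"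
    and "(LINT t|lborel. \<bar>h t * exp (- \<epsilon>\<^sup>2 * t\<^sup>2 / 2)\<bar>) \<le> K * log_cutoff \<epsilon>"
proof -
  have b: "\<bar>h t * exp (- \<epsilon>\<^sup>2 * t\<^sup>2 / 2)\<bar> \<le> K * (exp (- \<epsilon>\<^sup>2 * t\<^sup>2 / 2) / (1 + \<bar>t\<bar>))" for t
  proof -
    have "\<bar>h t\<bar> \<le> K / (1 + \<bar>t\<bar>)" using hK[of t] by (simp add: field_simps)
    then have "\<bar>h t\<bar> * exp (- \<epsilon>\<^sup>2 * t\<^sup>2 / 2) \<le> K / (1 + \<bar>t\<bar>) * exp (- \<epsilon>\<^sup>2 * t\<^sup>2 / 2)"
      by (intro mult_right_mono) auto
    then show ?thesis by (simp add: abs_mult)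
  qed
  have i: "integrable lborel (\<lambda>t. K * (exp (- \<epsilon>\<^sup>2 * t\<^sup>2 / 2) / (1 + \<bar>t\<bar>)))"
    by (intro integrable_mult_right integrable_log_cutoff \<epsilon>)
  show int: "integrable lborel (\<lambda>t. h t * exp (- \<epsilon>\<^sup>2 * t\<^sup>2 / 2))"
  proof (rule Bochner_Integration.integrable_bound[OF i])
    show "AE t in lborel. norm (h t * exp (- \<epsilon>\<^sup>2 * t\<^sup>2 / 2)) \<le> norm (K * (exp (- \<epsilon>\<^sup>2 * t\<^sup>2 / 2) / (1 + \<bar>t\<bar>)))"
      unfolding real_norm_def by (rule AE_I2) (rule order_trans[OF b abs_ge_self])
  qed measurable
  have "(LINT t|lborel. \<bar>h t * exp (- \<epsilon>\<^sup>2 * t\<^sup>2 / 2)\<bar>) \<le> (LINT t|lborel. K * (exp (- \<epsilon>\<^sup>2 * t\<^sup>2 / 2) / (1 + \<bar>t\<bar>)))"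
    by (rule integral_mono[OF integrable_abs[OF int] i b])
  then show "(LINT t|lborel. \<bar>h t * exp (- \<epsilon>\<^sup>2 * t\<^sup>2 / 2)\<bar>) \<le> K * log_cutoff \<epsilon>"
    by (simp only: integral_mult_right_zero log_cutoff_def)
qed

lemma log_cutoff_nonneg: "0 \<le> log_cutoff \<epsilon>"
  unfolding log_cutoff_def by (rule Bochner_Integration.integral_nonneg) auto

text \<open>The integrand of \<open>log_cutoff\<close>, divided by its integral, is a probability
  density whose mass escapes to infinity as \<epsilon> tends to 0. The quotient averages
  \<open>(1 + \<bar>t\<bar>) * h t\<close>, which is bounded and tends to \<open>c\<close> at both
  ends, against this density.\<close>

lemma abelian_log_average:
  fixes h :: "real \<Rightarrow> real"
  assumes [measurable]: "h \<in> borel_measurable borel" and hK: "\<And>t. (1 + \<bar>t\<bar>) * \<bar>h t\<bar> \<le> K"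
    and lim: "((\<lambda>t. t * h t) \<longlongrightarrow> c) at_top" "((\<lambda>t. t * h (- t)) \<longlongrightarrow> c) at_top"
  shows "(\<lambda>n. (LINT t|lborel. h t * exp (- (1 / Suc n)\<^sup>2 * t\<^sup>2 / 2)) / log_cutoff (1 / Suc n)) \<longlonglongrightarrow> c"
proof (rule LIMSEQ_I)
  fix \<delta> :: real assume \<delta>: "\<delta> > 0"
  \<comment> \<open>For positive \<open>t\<close> this is \<open>(1 + t) * h t\<close>, rearranged
    so that the hypothesis on \<open>t * h t\<close> applies.\<close>
  have "((\<lambda>t. (1 / t + 1) * (t * h t)) \<longlongrightarrow> (0 + 1) * c) at_top"
    by (intro tendsto_mult tendsto_add lim tendsto_const tendsto_divide_0[OF tendsto_const] filterlim_at_top_imp_at_infinity filterlim_ident)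
  from tendstoD[OF this, of "\<delta> / 2"] \<delta>
  have "\<forall>\<^sub>F t in at_top. \<bar>(1 / t + 1) * (t * h t) - c\<bar> < \<delta> / 2" by (simp add: dist_real_def)
  moreover
  have "((\<lambda>t. (1 / t + 1) * (t * h (- t))) \<longlongrightarrow> (0 + 1) * c) at_top"
    by (intro tendsto_mult tendsto_add lim tendsto_const tendsto_divide_0[OF tendsto_const] filterlim_at_top_imp_at_infinity filterlim_ident)
  from tendstoD[OF this, of "\<delta> / 2"] \<delta>
  have "\<forall>\<^sub>F t in at_top. \<bar>(1 / t + 1) * (t * h (- t)) - c\<bar> < \<delta> / 2" by (simp add: dist_real_def)
  ultimately have "\<forall>\<^sub>F t in at_top. \<bar>(1 / t + 1) * (t * h t) - c\<bar> < \<delta> / 2 \<and> \<bar>(1 / t + 1) * (t * h (- t)) - c\<bar> < \<delta> / 2"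
    by eventually_elim auto
  then obtain R0 where R0: "\<And>t. t \<ge> R0 \<Longrightarrow> \<bar>(1 / t + 1) * (t * h t) - c\<bar> < \<delta> / 2 \<and> \<bar>(1 / t + 1) * (t * h (- t)) - c\<bar> < \<delta> / 2"
    unfolding eventually_at_top_linorder by blast
  define R where "R = max R0 1"
  have far: "\<bar>(1 + \<bar>t\<bar>) * h t - c\<bar> \<le> \<delta> / 2" if "\<bar>t\<bar> \<ge> R" for t
  proof -
    have "t \<noteq> 0" using that by (auto simp: R_def)
    then have eq: "(1 / \<bar>t\<bar> + 1) * (\<bar>t\<bar> * h x) = (1 + \<bar>t\<bar>) * h x" for x
      by (simp add: field_simps)
    have "R0 \<le> \<bar>t\<bar>" using that by (simp add: R_def)
    from R0[OF this, unfolded eq]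
    have "\<bar>(1 + \<bar>t\<bar>) * h \<bar>t\<bar> - c\<bar> \<le> \<delta> / 2" "\<bar>(1 + \<bar>t\<bar>) * h (- \<bar>t\<bar>) - c\<bar> \<le> \<delta> / 2" by auto
    then show ?thesis by (cases "t \<ge> 0") (simp_all only: abs_of_nonneg abs_of_neg not_le minus_minus)
  qed
  \<comment> \<open>Bounds the error from the range up to \<open>R\<close>, whatever the value of
    \<epsilon>: the deviation from \<open>c\<close> is at most \<open>K + \<bar>c\<bar>\<close> and
    the weight at most 1.\<close>
  define A where "A = (K + \<bar>c\<bar>) * (2 * R)"
  \<comment> \<open>The near range is to take less than a quarter of the allowed error and the far
    range takes half. The added 1 makes the first estimate strict and keeps the denominator
    positive.\<close>
  have "\<forall>\<^sub>F n in sequentially. A / (\<delta> / 4) + 1 \<le> log_cutoff (1 / Suc n)"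
    using log_cutoff_at_top by (auto simp: filterlim_at_top)
  then obtain n0 where n0: "\<And>n. n \<ge> n0 \<Longrightarrow> A / (\<delta> / 4) + 1 \<le> log_cutoff (1 / Suc n)"
    unfolding eventually_sequentially by blast
  have K: "0 \<le> K" using order_trans[OF _ hK[of 0]] by simp
  have A: "0 \<le> A" using K by (auto simp: A_def R_def)
  have "\<bar>(LINT t|lborel. h t * exp (- (1 / Suc n)\<^sup>2 * t\<^sup>2 / 2)) / log_cutoff (1 / Suc n) - c\<bar> < \<delta>" if n: "n \<ge> n0" for n
  proof -
    define \<epsilon> where "\<epsilon> = 1 / real (Suc n)"
    have \<epsilon>: "\<epsilon> > 0" by (simp add: \<epsilon>_def)
    let ?e = "\<lambda>t. exp (- \<epsilon>\<^sup>2 * t\<^sup>2 / 2)"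
    let ?S = "log_cutoff \<epsilon>"
    have S: "A / (\<delta> / 4) + 1 \<le> ?S" using n0[OF n] by (simp only: \<epsilon>_def)
    moreover have "0 \<le> A / (\<delta> / 4)" using A \<delta> by simp
    ultimately have S0: "?S > 0" by linarith
    have ib: "integrable lborel (\<lambda>t. (K + \<bar>c\<bar>) * indicator {-R..R} t)"
      by (intro integrable_mult_right integrable_real_indicator) (auto simp: R_def)
    have i2: "integrable lborel (\<lambda>t. \<delta> / 2 * (?e t / (1 + \<bar>t\<bar>)))"
      by (intro integrable_mult_right integrable_log_cutoff \<epsilon>)
    have i1: "integrable lborel (\<lambda>t. h t * ?e t)" by (rule integrable_decay_cutoff[OF _ hK \<epsilon>]) measurable
    have i3: "integrable lborel (\<lambda>t. c * (?e t / (1 + \<bar>t\<bar>)))"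
      by (intro integrable_mult_right integrable_log_cutoff \<epsilon>)
    have "\<bar>(LINT t|lborel. h t * ?e t) - c * ?S\<bar> = \<bar>LINT t|lborel. h t * ?e t - c * (?e t / (1 + \<bar>t\<bar>))\<bar>"
      by (simp only: Bochner_Integration.integral_diff[OF i1 i3] integral_mult_right_zero log_cutoff_def)
    also have "\<dots> \<le> (LINT t|lborel. (K + \<bar>c\<bar>) * indicator {-R..R} t + \<delta> / 2 * (?e t / (1 + \<bar>t\<bar>)))"
    proof (rule integral_abs_bound_integral)
      show "integrable lborel (\<lambda>t. h t * ?e t - c * (?e t / (1 + \<bar>t\<bar>)))"
        by (rule Bochner_Integration.integrable_diff[OF i1 i3])
      show "integrable lborel (\<lambda>t. (K + \<bar>c\<bar>) * indicator {-R..R} t + \<delta> / 2 * (?e t / (1 + \<bar>t\<bar>)))"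
        by (rule Bochner_Integration.integrable_add[OF ib i2])
      fix t :: real
      have "h t * ?e t - c * (?e t / (1 + \<bar>t\<bar>)) = ((1 + \<bar>t\<bar>) * h t - c) * (?e t / (1 + \<bar>t\<bar>))"
        by (simp add: field_simps add_pos_nonneg)
      then have eq: "\<bar>h t * ?e t - c * (?e t / (1 + \<bar>t\<bar>))\<bar> = \<bar>(1 + \<bar>t\<bar>) * h t - c\<bar> * (?e t / (1 + \<bar>t\<bar>))"
        by (simp add: abs_mult)
      show "\<bar>h t * ?e t - c * (?e t / (1 + \<bar>t\<bar>))\<bar> \<le> (K + \<bar>c\<bar>) * indicator {-R..R} t + \<delta> / 2 * (?e t / (1 + \<bar>t\<bar>))"
      proof (cases "\<bar>t\<bar> \<ge> R")
        case True
        have "\<bar>(1 + \<bar>t\<bar>) * h t - c\<bar> * (?e t / (1 + \<bar>t\<bar>)) \<le> \<delta> / 2 * (?e t / (1 + \<bar>t\<bar>))"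
          by (intro mult_right_mono far True) auto
        then show ?thesis unfolding eq using K by (auto simp: indicator_def)
      next
        case False
        have "\<bar>(1 + \<bar>t\<bar>) * h t - c\<bar> \<le> K + \<bar>c\<bar>"
          using hK[of t] abs_triangle_ineq4[of "(1 + \<bar>t\<bar>) * h t" c] by (simp add: abs_mult)
        moreover have "?e t / (1 + \<bar>t\<bar>) \<le> 1"
        proof -
          have "?e t \<le> 1" by simp
          then have "?e t \<le> 1 * (1 + \<bar>t\<bar>)" by (rule order_trans) simp
          then show ?thesis by (subst pos_divide_le_eq) auto
        qed
        ultimately have "\<bar>(1 + \<bar>t\<bar>) * h t - c\<bar> * (?e t / (1 + \<bar>t\<bar>)) \<le> (K + \<bar>c\<bar>) * 1"
          using K by (intro mult_mono) auto
        moreover have "0 \<le> \<delta> / 2 * (?e t / (1 + \<bar>t\<bar>))" using \<delta> by simp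
        moreover have "t \<in> {-R..R}" using False by auto
        ultimately show ?thesis unfolding eq by simp
      qed
    qed
    also have "\<dots> = A + \<delta> / 2 * ?S"
      unfolding Bochner_Integration.integral_add[OF ib i2] integral_mult_right_zero log_cutoff_def
      by (simp add: A_def R_def)
    finally have "\<bar>(LINT t|lborel. h t * ?e t) - c * ?S\<bar> \<le> A + \<delta> / 2 * ?S" .
    moreover have "A < \<delta> / 4 * ?S"
    proof -
      have "\<delta> / 4 * (A / (\<delta> / 4) + 1) \<le> \<delta> / 4 * ?S" using S \<delta> by (intro mult_left_mono) auto
      moreover have "\<delta> / 4 * (A / (\<delta> / 4) + 1) = A + \<delta> / 4" using \<delta> by (simp add: field_simps)
      ultimately show ?thesis using \<delta> by linarith
    qed
    moreover have "0 < \<delta> / 4 * ?S" using \<delta> S0 by simp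
    ultimately have "\<bar>(LINT t|lborel. h t * ?e t) - c * ?S\<bar> < \<delta> * ?S" by linarith
    moreover have "(LINT t|lborel. h t * ?e t) / ?S - c = ((LINT t|lborel. h t * ?e t) - c * ?S) / ?S"
      using S0 by (simp add: field_simps)
    ultimately have "\<bar>(LINT t|lborel. h t * ?e t) / ?S - c\<bar> < \<delta>"
      using S0 by (simp add: abs_divide divide_less_eq)
    then show ?thesis by (simp only: \<epsilon>_def)
  qed
  then show "\<exists>no. \<forall>n\<ge>no. norm ((LINT t|lborel. h t * exp (- (1 / real (Suc n))\<^sup>2 * t\<^sup>2 / 2)) / log_cutoff (1 / real (Suc n)) - c) < \<delta>"
    by (intro exI[of _ n0]) auto
qed

section \<open>Gaussian smoothing of a homogeneous kernel\<close>

lemma integral_lborel_shift: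
  fixes g :: "'a::euclidean_space \<Rightarrow> real"
  assumes [measurable]: "g \<in> borel_measurable borel"
  shows "(LINT z|lborel. g z) = (LINT z|lborel. g (x + z))"
    and "integrable lborel g \<longleftrightarrow> integrable lborel (\<lambda>z. g (x + z))"
  by (subst lborel_distr_plus[of x, symmetric], subst integral_distr integrable_distr_eq, measurable)+

lemma integral_lborel_reflect:
  fixes g :: "'a::euclidean_space \<Rightarrow> real"
  assumes [measurable]: "g \<in> borel_measurable borel"
  shows "(LINT z|lborel. g z) = (LINT z|lborel. g (- z))"
proof -
  have "lborel = distr lborel borel (uminus :: 'a \<Rightarrow> 'a)"
    by (subst lborel_affine[of "-1" 0]) (simp_all add: density_1)
  then have "(LINT z|lborel. g z) = (LINT z|distr lborel borel uminus. g z)" by simp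
  also have "\<dots> = (LINT z|lborel. g (- z))" by (rule integral_distr) measurable
  finally show ?thesis .
qed

text \<open>What is used of the inverse gauge of \<open>M\<close>. Negative scalars in
  \<open>f_hom\<close> include evenness. At the origin division by zero turns \<open>f_le\<close>
  into \<open>f 0 \<le> 0\<close>, in agreement with the value of \<open>1 / 0\<close>.\<close>

locale homogeneous_kernel =
  fixes f :: "'a::euclidean_space \<Rightarrow> real" and C :: real
  assumes dim: "DIM('a) \<ge> 2"
    and f_meas [measurable]: "f \<in> borel_measurable borel"
    and f_hom: "\<And>c x. c \<noteq> 0 \<Longrightarrow> f (c *\<^sub>R x) = f x / \<bar>c\<bar>"
    and f_nonneg: "\<And>x. 0 \<le> f x"
    and f_le: "\<And>x. f x \<le> C / norm x"
    and f_cont: "\<And>x. x \<noteq> 0 \<Longrightarrow> isCont f x"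
begin

lemma f_even: "f (- x) = f x"
  using f_hom[of "-1" x] by simp

lemma C_nonneg: "0 \<le> C"
proof -
  obtain b :: 'a where "b \<in> Basis" using nonempty_Basis by blast
  then have "f b \<le> C" using f_le[of b] by simp
  with f_nonneg[of b] show ?thesis by linarith
qed

text \<open>The bound is uniform in the centre \<open>x\<close>. On the unit ball the singularity of
  \<open>f\<close> is integrable whatever \<open>x\<close> is; outside it \<open>f\<close> is at
  most \<open>C\<close>, and the mass of a Gaussian does not depend on its centre.\<close>

lemma f_gaussian_shift_bound:
  assumes "a > 0"
  shows "integrable lborel (\<lambda>z. f z * exp (- a * (norm (z - x))\<^sup>2 / 2))"
    and "\<exists>K\<ge>0. \<forall>x. (LINT z|lborel. f z * exp (- a * (norm (z - x))\<^sup>2 / 2)) \<le> K"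
proof -
  \<comment> \<open>The factor \<open>exp (1/2)\<close> makes the Gaussian of the first summand at
    least 1 on the unit ball.\<close>
  let ?w = "\<lambda>(x::'a) (z::'a). C * exp (1/2) * (exp (- 1 * (norm z)\<^sup>2 / 2) / norm z) + C * exp (- a * (norm (z - x))\<^sup>2 / 2)"
  have e1: "integrable lborel (\<lambda>z::'a. exp (- a * (norm (z - x))\<^sup>2 / 2))"
    and e2: "(LINT z|lborel. exp (- a * (norm (z - x))\<^sup>2 / 2)) = (LINT z::'a|lborel. exp (- a * (norm z)\<^sup>2 / 2))" for x :: 'a
    using fourier_gaussian(1)[OF assms, where 'a='a]
      integral_lborel_shift[of "\<lambda>z::'a. exp (- a * (norm (z - x))\<^sup>2 / 2)" x] by simp_all
  have b: "f z * exp (- a * (norm (z - x))\<^sup>2 / 2) \<le> ?w x z" for x z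
  proof (cases "norm z \<le> 1")
    case True
    have "f z * exp (- a * (norm (z - x))\<^sup>2 / 2) \<le> f z * 1"
      using assms f_nonneg by (intro mult_left_mono) auto
    also have "\<dots> \<le> C * (1 / norm z)" using f_le[of z] by simp
    also have "\<dots> \<le> C * (exp (1/2) * (exp (- 1 * (norm z)\<^sup>2 / 2) / norm z))"
    proof -
      have "(norm z)\<^sup>2 \<le> 1" using True by (intro power_le_one) auto
      then have "1 \<le> exp (1/2) * exp (- 1 * (norm z)\<^sup>2 / 2)"
        by (simp add: exp_add[symmetric])
      then have "1 / norm z \<le> exp (1/2) * exp (- 1 * (norm z)\<^sup>2 / 2) / norm z"
        by (intro divide_right_mono) auto
      then show ?thesis using C_nonneg by (intro mult_left_mono) auto
    qed
    also have "\<dots> \<le> ?w x z" using C_nonneg by (simp add: mult.assoc)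
    finally show ?thesis .
  next
    case False
    have "f z \<le> C / norm z" by (rule f_le)
    also have "\<dots> \<le> C / 1" using False C_nonneg by (intro divide_left_mono) auto
    finally have "f z * exp (- a * (norm (z - x))\<^sup>2 / 2) \<le> C * exp (- a * (norm (z - x))\<^sup>2 / 2)"
      by (intro mult_right_mono) auto
    then show ?thesis using C_nonneg by (simp add: add_increasing)
  qed
  have iw: "integrable lborel (?w x)" for x
    by (intro Bochner_Integration.integrable_add integrable_mult_right integrable_lborel_gaussian_inverse_norm e1 dim) simp
  show int: "integrable lborel (\<lambda>z. f z * exp (- a * (norm (z - x))\<^sup>2 / 2))" for x
    by (rule Bochner_Integration.integrable_bound[OF iw[of x]])
       (use b f_nonneg in \<open>auto intro!: AE_I2 simp del: divide_minus_left intro: order_trans[OF _ abs_ge_self]\<close>)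
  let ?K = "C * exp (1/2) * (LINT z::'a|lborel. exp (- 1 * (norm z)\<^sup>2 / 2) / norm z) + C * (LINT z::'a|lborel. exp (- a * (norm z)\<^sup>2 / 2))"
  have "(LINT z|lborel. f z * exp (- a * (norm (z - x))\<^sup>2 / 2)) \<le> ?K" for x
  proof -
    have "(LINT z|lborel. f z * exp (- a * (norm (z - x))\<^sup>2 / 2)) \<le> (LINT z|lborel. ?w x z)"
      by (rule integral_mono[OF int iw b])
    also have "\<dots> = (LINT z::'a|lborel. C * exp (1/2) * (exp (- 1 * (norm z)\<^sup>2 / 2) / norm z)) + (LINT z|lborel. C * exp (- a * (norm (z - x))\<^sup>2 / 2))"
      by (intro Bochner_Integration.integral_add integrable_mult_right integrable_lborel_gaussian_inverse_norm e1 dim) simp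
    also have "\<dots> = ?K" by (simp only: integral_mult_right_zero e2)
    finally show ?thesis .
  qed
  moreover have "0 \<le> ?K"
    using C_nonneg by (intro add_nonneg_nonneg mult_nonneg_nonneg Bochner_Integration.integral_nonneg) auto
  ultimately show "\<exists>K\<ge>0. \<forall>x. (LINT z|lborel. f z * exp (- a * (norm (z - x))\<^sup>2 / 2)) \<le> K" by blast
qed

text \<open>The convolution of \<open>f\<close> with an unnormalised Gaussian of fixed width. By
  homogeneity, going out along a ray has the same effect as shrinking the width.\<close>

definition smoothed :: "'a \<Rightarrow> real" where
  "smoothed x = (LINT z|lborel. f z * exp (- 1 * (norm (z - x))\<^sup>2 / 2))"

lemma smoothed_meas [measurable]: "smoothed \<in> borel_measurable borel"
  unfolding smoothed_def by measurable

lemma smoothed_nonneg: "0 \<le> smoothed x"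
  unfolding smoothed_def by (rule Bochner_Integration.integral_nonneg) (simp add: f_nonneg)

lemma smoothed_even: "smoothed (- x) = smoothed x"
proof -
  have "smoothed (- x) = (LINT z|lborel. f (- z) * exp (- 1 * (norm (- z - - x))\<^sup>2 / 2))"
    unfolding smoothed_def by (rule integral_lborel_reflect) measurable
  then show ?thesis by (simp add: smoothed_def f_even norm_minus_commute[of x])
qed

text \<open>After centring the Gaussian, homogeneity gives \<open>t * f (t *\<^sub>R \<theta> + z) =
  f (\<theta> + (1 / t) *\<^sub>R z)\<close>, which tends to \<open>f \<theta>\<close>; the constant
  is the mass of the Gaussian. A singularity sits at \<open>z = - t *\<^sub>R \<theta>\<close>, so
  domination is possible only in part \<open>?A\<close>, where \<open>norm z \<le> t / 2\<close>
  keeps the argument at distance \<open>t / 2\<close> from 0. Part \<open>?B\<close> is negligible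
  because the Gaussian is tiny there.\<close>

lemma smoothed_ray:
  assumes "norm \<theta> = 1"
  shows "((\<lambda>t. t * smoothed (t *\<^sub>R \<theta>)) \<longlongrightarrow> sqrt (2 * pi) ^ DIM('a) * f \<theta>) at_top"
    and "\<exists>K. \<forall>\<theta> t. norm \<theta> = 1 \<longrightarrow> t > 0 \<longrightarrow> t * smoothed (t *\<^sub>R \<theta>) \<le> K"
proof -
  let ?e = "\<lambda>z::'a. exp (- 1 * (norm z)\<^sup>2 / 2)"
  let ?A = "\<lambda>\<theta> t z. indicator {z. norm z \<le> t / 2} z * (t * f (t *\<^sub>R \<theta> + z) * ?e z)"
  let ?B = "\<lambda>\<theta> t z. indicator {z. norm z > t / 2} z * (t * f (t *\<^sub>R \<theta> + z) * ?e z)"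
  obtain K where K: "K \<ge> 0" "\<And>x. (LINT z|lborel. f z * exp (- (1/2) * (norm (z - x))\<^sup>2 / 2)) \<le> K"
    using f_gaussian_shift_bound(2)[of "1/2"] by auto
  have ie: "integrable lborel ?e" "(LINT z|lborel. ?e z) = sqrt (2 * pi) ^ DIM('a)"
    using fourier_gaussian(1)[of 1, where 'a='a] cos_gaussian[of 1 "0::'a"] by auto
  have Ab: "\<bar>?A \<theta> t z\<bar> \<le> 2 * C * ?e z" if "norm \<theta> = 1" "t > 0" for \<theta> t z
  proof (cases "norm z \<le> t / 2")
    case True
    have "norm (t *\<^sub>R \<theta>) \<le> norm (t *\<^sub>R \<theta> + z) + norm z"
      using norm_triangle_ineq4[of "t *\<^sub>R \<theta> + z" z] by simp
    then have n: "t / 2 \<le> norm (t *\<^sub>R \<theta> + z)" using that True by simp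
    have "t * f (t *\<^sub>R \<theta> + z) \<le> t * (C / norm (t *\<^sub>R \<theta> + z))"
      using that f_le by (intro mult_left_mono) auto
    also have "\<dots> \<le> t * (C / (t / 2))"
    proof -
      have "0 < norm (t *\<^sub>R \<theta> + z)" using n that by linarith
      then show ?thesis using that n C_nonneg by (intro mult_left_mono divide_left_mono mult_pos_pos) auto
    qed
    also have "\<dots> = 2 * C" using that by simp
    finally have "t * f (t *\<^sub>R \<theta> + z) * ?e z \<le> 2 * C * ?e z" by (intro mult_right_mono) auto
    then show ?thesis using True that f_nonneg by (simp add: abs_mult)
  qed (use C_nonneg in simp)
  have Aint: "integrable lborel (?A \<theta> t)" if "norm \<theta> = 1" "t > 0" for \<theta> t
  proof (rule Bochner_Integration.integrable_bound[OF integrable_mult_right[OF ie(1), of "2 * C"]])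
    show "AE z in lborel. norm (?A \<theta> t z) \<le> norm (2 * C * ?e z)"
      unfolding real_norm_def by (rule AE_I2) (rule order_trans[OF Ab[OF that] abs_ge_self])
  qed measurable
  have gint: "integrable lborel (\<lambda>z. f (x + z) * exp (- (1/2) * (norm z)\<^sup>2 / 2))"
    and gle: "(LINT z|lborel. f (x + z) * exp (- (1/2) * (norm z)\<^sup>2 / 2)) \<le> K" for x
    using f_gaussian_shift_bound(1)[of "1/2" x] K(2)[of x]
      integral_lborel_shift[of "\<lambda>z. f z * exp (- (1/2) * (norm (z - x))\<^sup>2 / 2)" x] by auto
  \<comment> \<open>The Gaussian is split into two halves of equal exponent. For
    \<open>norm z > t / 2\<close> one half is at most \<open>exp (- t\<^sup>2 / 16)\<close>; the
    other keeps the integral over the singularity bounded, uniformly in the shift.\<close>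
  have Bb: "\<bar>?B \<theta> t z\<bar> \<le> t * exp (- t\<^sup>2 / 16) * (f (t *\<^sub>R \<theta> + z) * exp (- (1/2) * (norm z)\<^sup>2 / 2))" if "t > 0" for \<theta> t z
  proof (cases "norm z > t / 2")
    case True
    have "(t / 2)\<^sup>2 \<le> (norm z)\<^sup>2" using True that by (intro power_mono) auto
    then have "?e z \<le> exp (- t\<^sup>2 / 16) * exp (- (1/2) * (norm z)\<^sup>2 / 2)"
      by (simp add: exp_add[symmetric] power_divide)
    then have "t * f (t *\<^sub>R \<theta> + z) * ?e z \<le> t * f (t *\<^sub>R \<theta> + z) * (exp (- t\<^sup>2 / 16) * exp (- (1/2) * (norm z)\<^sup>2 / 2))"
      using that f_nonneg by (intro mult_left_mono) auto
    then show ?thesis using True that f_nonneg by (simp add: abs_mult mult_ac)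
  qed (use that f_nonneg in auto)
  have Bint: "integrable lborel (?B \<theta> t)" and Ble: "\<bar>LINT z|lborel. ?B \<theta> t z\<bar> \<le> t * exp (- t\<^sup>2 / 16) * K" if "t > 0" for \<theta> t
  proof -
    have i: "integrable lborel (\<lambda>z. t * exp (- t\<^sup>2 / 16) * (f (t *\<^sub>R \<theta> + z) * exp (- (1/2) * (norm z)\<^sup>2 / 2)))"
      by (intro integrable_mult_right gint)
    show Bi: "integrable lborel (?B \<theta> t)"
    proof (rule Bochner_Integration.integrable_bound[OF i])
      show "AE z in lborel. norm (?B \<theta> t z) \<le> norm (t * exp (- t\<^sup>2 / 16) * (f (t *\<^sub>R \<theta> + z) * exp (- (1/2) * (norm z)\<^sup>2 / 2)))"
        unfolding real_norm_def by (rule AE_I2) (rule order_trans[OF Bb[OF that] abs_ge_self])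
    qed measurable
    have "\<bar>LINT z|lborel. ?B \<theta> t z\<bar> \<le> (LINT z|lborel. t * exp (- t\<^sup>2 / 16) * (f (t *\<^sub>R \<theta> + z) * exp (- (1/2) * (norm z)\<^sup>2 / 2)))"
      by (rule integral_abs_bound_integral[OF Bi i Bb[OF that]])
    also have "\<dots> \<le> t * exp (- t\<^sup>2 / 16) * K"
      unfolding integral_mult_right_zero using that gle by (intro mult_left_mono) auto
    finally show "\<bar>LINT z|lborel. ?B \<theta> t z\<bar> \<le> t * exp (- t\<^sup>2 / 16) * K" .
  qed
  have split: "t * smoothed (t *\<^sub>R \<theta>) = (LINT z|lborel. ?A \<theta> t z) + (LINT z|lborel. ?B \<theta> t z)" if "norm \<theta> = 1" "t > 0" for \<theta> t
  proof -
    have "t * smoothed (t *\<^sub>R \<theta>) = (LINT z|lborel. t * (f z * exp (- 1 * (norm (z - t *\<^sub>R \<theta>))\<^sup>2 / 2)))"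
      by (simp add: smoothed_def)
    also have "\<dots> = (LINT z|lborel. t * (f (t *\<^sub>R \<theta> + z) * exp (- 1 * (norm (t *\<^sub>R \<theta> + z - t *\<^sub>R \<theta>))\<^sup>2 / 2)))"
      by (rule integral_lborel_shift) measurable
    also have "\<dots> = (LINT z|lborel. ?A \<theta> t z + ?B \<theta> t z)"
      by (rule Bochner_Integration.integral_cong) (auto simp: indicator_def)
    also have "\<dots> = (LINT z|lborel. ?A \<theta> t z) + (LINT z|lborel. ?B \<theta> t z)"
      by (rule Bochner_Integration.integral_add[OF Aint[OF that] Bint[OF that(2)]])
    finally show ?thesis .
  qed
  have limB: "((\<lambda>t. LINT z|lborel. ?B \<theta> t z) \<longlongrightarrow> 0) at_top"
  proof (rule Lim_null_comparison)
    show "\<forall>\<^sub>F t in at_top. norm (LINT z|lborel. ?B \<theta> t z) \<le> t * exp (- t\<^sup>2 / 16) * K"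
      using eventually_gt_at_top[of 0] by eventually_elim (simp only: real_norm_def Ble)
    have "((\<lambda>t::real. t * exp (- t\<^sup>2 / 16)) \<longlongrightarrow> 0) at_top" by real_asymp
    then show "((\<lambda>t. t * exp (- t\<^sup>2 / 16) * K) \<longlongrightarrow> 0) at_top" by (rule tendsto_mult_left_zero)
  qed
  have limA: "((\<lambda>t. LINT z|lborel. ?A \<theta> t z) \<longlongrightarrow> (LINT z|lborel. f \<theta> * ?e z)) at_top"
  proof (rule integral_dominated_convergence_at_top[where w="\<lambda>z. 2 * C * ?e z"])
    show "integrable lborel (\<lambda>z. 2 * C * ?e z)" by (intro integrable_mult_right ie)
    show "\<forall>\<^sub>F t in at_top. AE z in lborel. norm (?A \<theta> t z) \<le> 2 * C * ?e z"
      using eventually_gt_at_top[of 0]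
      by eventually_elim (rule AE_I2, unfold real_norm_def, rule Ab[OF assms])
    show "AE z in lborel. ((\<lambda>t. ?A \<theta> t z) \<longlongrightarrow> f \<theta> * ?e z) at_top"
    proof (rule AE_I2)
      fix z
      have "((\<lambda>t. \<theta> + (1 / t) *\<^sub>R z) \<longlongrightarrow> \<theta> + 0 *\<^sub>R z) at_top"
        by (intro tendsto_add tendsto_scaleR tendsto_const tendsto_divide_0[OF tendsto_const] filterlim_at_top_imp_at_infinity filterlim_ident)
      moreover have "isCont f \<theta>" using assms by (intro f_cont) auto
      ultimately have "((\<lambda>t. f (\<theta> + (1 / t) *\<^sub>R z)) \<longlongrightarrow> f \<theta>) at_top"
        using isCont_tendsto_compose by fastforce
      then have l: "((\<lambda>t. f (\<theta> + (1 / t) *\<^sub>R z) * ?e z) \<longlongrightarrow> f \<theta> * ?e z) at_top"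
        by (intro tendsto_mult tendsto_const)
      show "((\<lambda>t. ?A \<theta> t z) \<longlongrightarrow> f \<theta> * ?e z) at_top"
      proof (rule Lim_transform_eventually[OF l])
        show "\<forall>\<^sub>F t in at_top. f (\<theta> + (1 / t) *\<^sub>R z) * ?e z = ?A \<theta> t z"
          using eventually_ge_at_top[of "2 * norm z"] eventually_gt_at_top[of 0]
        proof eventually_elim
          fix t :: real assume t: "2 * norm z \<le> t" "0 < t"
          have "t *\<^sub>R \<theta> + z = t *\<^sub>R (\<theta> + (1 / t) *\<^sub>R z)" using t by (simp add: scaleR_add_right)
          then have "t * f (t *\<^sub>R \<theta> + z) = f (\<theta> + (1 / t) *\<^sub>R z)"
            using t f_hom[of t "\<theta> + (1 / t) *\<^sub>R z"] by simp
          then show "f (\<theta> + (1 / t) *\<^sub>R z) * ?e z = ?A \<theta> t z" using t by simp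
        qed
      qed
    qed
  qed measurable
  have "((\<lambda>t. (LINT z|lborel. ?A \<theta> t z) + (LINT z|lborel. ?B \<theta> t z)) \<longlongrightarrow> (LINT z|lborel. f \<theta> * ?e z) + 0) at_top"
    by (intro tendsto_add limA limB)
  moreover have "(LINT z|lborel. f \<theta> * ?e z) + 0 = sqrt (2 * pi) ^ DIM('a) * f \<theta>"
    by (simp only: integral_mult_right_zero ie(2) add_0_right mult.commute)
  ultimately have l: "((\<lambda>t. (LINT z|lborel. ?A \<theta> t z) + (LINT z|lborel. ?B \<theta> t z)) \<longlongrightarrow> sqrt (2 * pi) ^ DIM('a) * f \<theta>) at_top"
    by (simp only:)
  show "((\<lambda>t. t * smoothed (t *\<^sub>R \<theta>)) \<longlongrightarrow> sqrt (2 * pi) ^ DIM('a) * f \<theta>) at_top"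
    by (rule Lim_transform_eventually[OF l])
       (use eventually_gt_at_top[of 0] in \<open>eventually_elim, simp only: split[OF assms]\<close>)
  have "t * smoothed (t *\<^sub>R \<theta>) \<le> 2 * C * sqrt (2 * pi) ^ DIM('a) + 2 * K" if "norm \<theta> = 1" "t > 0" for \<theta> t
  proof -
    have "(LINT z|lborel. ?A \<theta> t z) \<le> (LINT z|lborel. 2 * C * ?e z)"
      by (rule integral_mono[OF Aint[OF that] integrable_mult_right[OF ie(1)]]) (rule order_trans[OF abs_ge_self Ab[OF that]])
    also have "\<dots> = 2 * C * sqrt (2 * pi) ^ DIM('a)" by (simp only: integral_mult_right_zero ie(2))
    finally have 1: "(LINT z|lborel. ?A \<theta> t z) \<le> 2 * C * sqrt (2 * pi) ^ DIM('a)" .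
    \<comment> \<open>This yields \<open>t * exp (- t\<^sup>2 / 16) \<le> 2\<close>, the bound for
      part \<open>?B\<close>.\<close>
    have "0 \<le> (t - 4)\<^sup>2" by simp
    then have "t \<le> 2 * (1 + t\<^sup>2 / 16)" by (simp add: power2_eq_square algebra_simps)
    also have "\<dots> \<le> 2 * exp (t\<^sup>2 / 16)" by (intro mult_left_mono exp_ge_add_one_self) simp
    finally have "t * exp (- t\<^sup>2 / 16) \<le> 2" by (simp add: exp_minus field_simps)
    then have "t * exp (- t\<^sup>2 / 16) * K \<le> 2 * K" using K by (intro mult_right_mono) auto
    with Ble[OF that(2), of \<theta>] 1 show ?thesis unfolding split[OF that] by linarith
  qed
  then show "\<exists>K. \<forall>\<theta> t. norm \<theta> = 1 \<longrightarrow> t > 0 \<longrightarrow> t * smoothed (t *\<^sub>R \<theta>) \<le> K" by blast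
qed

text \<open>Uniformity over the unit directions lets one constant dominate for all \<open>y\<close>
  when the cutoff is removed.\<close>

lemma smoothed_decay:
  obtains K where "K \<ge> 0" "\<And>\<theta> t. norm \<theta> = 1 \<Longrightarrow> (1 + \<bar>t\<bar>) * \<bar>smoothed (t *\<^sub>R \<theta>)\<bar> \<le> K"
proof -
  obtain b :: 'a where b: "b \<in> Basis" using nonempty_Basis by blast
  then obtain K1 where K1: "\<And>\<theta> t. norm \<theta> = 1 \<Longrightarrow> t > 0 \<Longrightarrow> t * smoothed (t *\<^sub>R \<theta>) \<le> K1"
    using smoothed_ray(2)[of b] by auto
  obtain K0 where K0: "\<And>x. smoothed x \<le> K0"
    using f_gaussian_shift_bound(2)[of 1] unfolding smoothed_def by auto
  have K10: "0 \<le> K1" using K1[of b 1] b smoothed_nonneg[of b] by simp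
  have "(1 + \<bar>t\<bar>) * \<bar>smoothed (t *\<^sub>R \<theta>)\<bar> \<le> K0 + K1" if "norm \<theta> = 1" for \<theta> t
  proof -
    have "\<bar>t\<bar> * smoothed (t *\<^sub>R \<theta>) \<le> K1"
    proof (cases "t = 0")
      case False
      have "smoothed (t *\<^sub>R \<theta>) = smoothed (\<bar>t\<bar> *\<^sub>R \<theta>)"
        using smoothed_even[of "t *\<^sub>R \<theta>"] by (cases "t \<ge> 0") auto
      with K1[OF that, of "\<bar>t\<bar>"] False show ?thesis by simp
    qed (simp add: K10)
    with K0[of "t *\<^sub>R \<theta>"] smoothed_nonneg[of "t *\<^sub>R \<theta>"] show ?thesis by (simp add: algebra_simps)
  qed
  moreover have "0 \<le> K0 + K1" using K10 K0[of 0] smoothed_nonneg[of 0] by linarith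
  ultimately show thesis using that by blast
qed

text \<open>The completion of the square \<open>\<alpha> |z|\<^sup>2 + |\<beta> z - x|\<^sup>2 / \<beta> = |z - x|\<^sup>2 + \<epsilon>\<^sup>2 |x|\<^sup>2\<close> for
  \<open>\<beta> = 1 / (1 + \<epsilon>\<^sup>2)\<close> and \<open>\<alpha> = 1 - \<beta>\<close> exhibits \<open>smoothed x * exp (- \<epsilon>\<^sup>2 |x|\<^sup>2 / 2)\<close> as a
  positive multiple of a cosine transform.\<close>

lemma smoothed_cutoff_cosine_transform:
  fixes \<epsilon> :: real
  assumes \<epsilon>: "\<epsilon> > 0"
  defines "\<beta> \<equiv> 1 / (1 + \<epsilon>\<^sup>2)" and "\<alpha> \<equiv> \<epsilon>\<^sup>2 / (1 + \<epsilon>\<^sup>2)"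
  defines "\<Phi> \<equiv> \<lambda>\<xi>. exp (- \<beta> * (norm \<xi>)\<^sup>2 / 2) * (LINT z|lborel. f z * exp (- \<alpha> * (norm z)\<^sup>2 / 2) * cos ((\<beta> *\<^sub>R \<xi>) \<bullet> z))"
  shows "(LINT \<xi>|lborel. \<Phi> \<xi> * cos (x \<bullet> \<xi>)) = sqrt (2 * pi / \<beta>) ^ DIM('a) * (smoothed x * exp (- \<epsilon>\<^sup>2 * (norm x)\<^sup>2 / 2))"
proof -
  have pos: "1 + \<epsilon>\<^sup>2 > 0" by (simp add: add_pos_nonneg)
  have \<beta>: "\<beta> > 0" and \<alpha>: "\<alpha> > 0" using \<epsilon> pos by (auto simp: \<beta>_def \<alpha>_def)
  let ?g = "\<lambda>z. f z * exp (- \<alpha> * (norm z)\<^sup>2 / 2)"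
  let ?c = "sqrt (2 * pi / \<beta>) ^ DIM('a)"
  have ig: "integrable lborel ?g" using f_gaussian_shift_bound(1)[OF \<alpha>, of 0] by simp
  have ie: "integrable lborel (\<lambda>\<xi>::'a. exp (- \<beta> * (norm \<xi>)\<^sup>2 / 2))" by (rule fourier_gaussian(1)[OF \<beta>])
  have icos: "integrable lborel (\<lambda>\<xi>::'a. exp (- \<beta> * (norm \<xi>)\<^sup>2 / 2) * cos (v \<bullet> \<xi>))" for v
  proof (rule Bochner_Integration.integrable_bound[OF ie])
    show "AE \<xi> in lborel. norm (exp (- \<beta> * (norm \<xi>)\<^sup>2 / 2) * cos (v \<bullet> \<xi>)) \<le> norm (exp (- \<beta> * (norm \<xi>)\<^sup>2 / 2))"
      by (rule AE_I2) (simp add: abs_mult mult_left_le)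
  qed measurable
  have inner: "(LINT \<xi>|lborel. exp (- \<beta> * (norm \<xi>)\<^sup>2 / 2) * (cos ((\<beta> *\<^sub>R \<xi>) \<bullet> z) * cos (x \<bullet> \<xi>)))
     = ?c / 2 * (exp (- (norm (\<beta> *\<^sub>R z - x))\<^sup>2 / (2 * \<beta>)) + exp (- (norm (\<beta> *\<^sub>R z + x))\<^sup>2 / (2 * \<beta>)))" for z
  proof -
    \<comment> \<open>The product formula produces both \<open>x\<close> and \<open>- x\<close>;
      evenness of \<open>smoothed\<close> merges the two contributions at the end.\<close>
    have ce: "cos ((\<beta> *\<^sub>R \<xi>) \<bullet> z) * cos (x \<bullet> \<xi>) = (cos ((\<beta> *\<^sub>R z - x) \<bullet> \<xi>) + cos ((\<beta> *\<^sub>R z + x) \<bullet> \<xi>)) / 2" for \<xi>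
      using cos_times_cos[of "(\<beta> *\<^sub>R \<xi>) \<bullet> z" "x \<bullet> \<xi>"] by (simp add: inner_diff_left inner_add_left inner_commute[of \<xi> z])
    have "(LINT \<xi>|lborel. exp (- \<beta> * (norm \<xi>)\<^sup>2 / 2) * (cos ((\<beta> *\<^sub>R \<xi>) \<bullet> z) * cos (x \<bullet> \<xi>)))
      = (LINT \<xi>|lborel. 1 / 2 * (exp (- \<beta> * (norm \<xi>)\<^sup>2 / 2) * cos ((\<beta> *\<^sub>R z - x) \<bullet> \<xi>) + exp (- \<beta> * (norm \<xi>)\<^sup>2 / 2) * cos ((\<beta> *\<^sub>R z + x) \<bullet> \<xi>)))"
      by (rule Bochner_Integration.integral_cong[OF refl]) (simp only: ce distrib_left times_divide_eq_right times_divide_eq_left add_divide_distrib mult_1_left)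
    also have "\<dots> = 1 / 2 * (?c * exp (- (norm (\<beta> *\<^sub>R z - x))\<^sup>2 / (2 * \<beta>)) + ?c * exp (- (norm (\<beta> *\<^sub>R z + x))\<^sup>2 / (2 * \<beta>)))"
      by (simp only: integral_mult_right_zero Bochner_Integration.integral_add[OF icos icos] cos_gaussian[OF \<beta>])
    finally show ?thesis by (simp add: algebra_simps)
  qed
  have sq: "?g z * exp (- (norm (\<beta> *\<^sub>R z - x))\<^sup>2 / (2 * \<beta>)) = f z * exp (- 1 * (norm (z - x))\<^sup>2 / 2) * exp (- \<epsilon>\<^sup>2 * (norm x)\<^sup>2 / 2)" for x z
  proof -
    have "- \<alpha> * (norm z)\<^sup>2 / 2 + - (norm (\<beta> *\<^sub>R z - x))\<^sup>2 / (2 * \<beta>) = - 1 * (norm (z - x))\<^sup>2 / 2 + - \<epsilon>\<^sup>2 * (norm x)\<^sup>2 / 2"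
    proof -
      have n1: "(norm (\<beta> *\<^sub>R z - x))\<^sup>2 = \<beta>\<^sup>2 * (norm z)\<^sup>2 - 2 * \<beta> * (z \<bullet> x) + (norm x)\<^sup>2"
        unfolding power2_norm_eq_inner
        by (simp add: inner_diff_left inner_diff_right inner_commute[of x z] power2_eq_square algebra_simps)
      have n2: "(norm (z - x))\<^sup>2 = (norm z)\<^sup>2 - 2 * (z \<bullet> x) + (norm x)\<^sup>2"
        unfolding power2_norm_eq_inner
        by (simp add: inner_diff_left inner_diff_right inner_commute[of x z])
      have \<beta>1: "1 / \<beta> = 1 + \<epsilon>\<^sup>2" by (simp add: \<beta>_def)
      have \<alpha>1: "\<alpha> = 1 - \<beta>" using pos by (simp add: \<alpha>_def \<beta>_def field_simps)
      have n3: "- (norm (\<beta> *\<^sub>R z - x))\<^sup>2 / (2 * \<beta>) = - (\<beta> * (norm z)\<^sup>2 - 2 * (z \<bullet> x) + (norm x)\<^sup>2 * (1 / \<beta>)) / 2"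
        unfolding n1 using \<beta> by (simp add: field_simps power2_eq_square)
      show ?thesis unfolding n3 \<beta>1 n2 unfolding \<alpha>1 by (simp add: algebra_simps add_divide_distrib diff_divide_distrib)
    qed
    then show ?thesis
      by (simp only: mult.assoc exp_add[symmetric])
  qed
  have "(LINT \<xi>|lborel. \<Phi> \<xi> * cos (x \<bullet> \<xi>))
    = (LINT \<xi>|lborel. exp (- \<beta> * (norm \<xi>)\<^sup>2 / 2) * (LINT z|lborel. ?g z * (cos ((\<beta> *\<^sub>R \<xi>) \<bullet> z) * cos (x \<bullet> \<xi>))))"
  proof (rule Bochner_Integration.integral_cong[OF refl])
    fix \<xi>
    have "(LINT z|lborel. ?g z * (cos ((\<beta> *\<^sub>R \<xi>) \<bullet> z) * cos (x \<bullet> \<xi>))) = (LINT z|lborel. ?g z * cos ((\<beta> *\<^sub>R \<xi>) \<bullet> z)) * cos (x \<bullet> \<xi>)"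
      by (simp only: mult.assoc[symmetric] integral_mult_left_zero)
    then show "\<Phi> \<xi> * cos (x \<bullet> \<xi>) = exp (- \<beta> * (norm \<xi>)\<^sup>2 / 2) * (LINT z|lborel. ?g z * (cos ((\<beta> *\<^sub>R \<xi>) \<bullet> z) * cos (x \<bullet> \<xi>)))"
      by (simp only: \<Phi>_def mult.assoc)
  qed
  also have "\<dots> = (LINT z|lborel. ?g z * (LINT \<xi>|lborel. exp (- \<beta> * (norm \<xi>)\<^sup>2 / 2) * (cos ((\<beta> *\<^sub>R \<xi>) \<bullet> z) * cos (x \<bullet> \<xi>))))"
  proof (rule integral_swap_bounded_kernel[OF lborel.sigma_finite_measure_axioms lborel.sigma_finite_measure_axioms ie ig, where K=1])
    show "\<bar>cos ((\<beta> *\<^sub>R \<xi>) \<bullet> z) * cos (x \<bullet> \<xi>)\<bar> \<le> 1" for \<xi> z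
      unfolding abs_mult by (intro mult_le_one) auto
  qed measurable
  also have "\<dots> = (LINT z|lborel. ?c / 2 * exp (- \<epsilon>\<^sup>2 * (norm x)\<^sup>2 / 2) * (f z * exp (- 1 * (norm (z - x))\<^sup>2 / 2) + f z * exp (- 1 * (norm (z - - x))\<^sup>2 / 2)))"
  proof (rule Bochner_Integration.integral_cong[OF refl])
    fix z
    have "?g z * exp (- (norm (\<beta> *\<^sub>R z + x))\<^sup>2 / (2 * \<beta>)) = f z * exp (- 1 * (norm (z - - x))\<^sup>2 / 2) * exp (- \<epsilon>\<^sup>2 * (norm x)\<^sup>2 / 2)"
      using sq[of z "- x"] by simp
    then show "?g z * (LINT \<xi>|lborel. exp (- \<beta> * (norm \<xi>)\<^sup>2 / 2) * (cos ((\<beta> *\<^sub>R \<xi>) \<bullet> z) * cos (x \<bullet> \<xi>)))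
      = ?c / 2 * exp (- \<epsilon>\<^sup>2 * (norm x)\<^sup>2 / 2) * (f z * exp (- 1 * (norm (z - x))\<^sup>2 / 2) + f z * exp (- 1 * (norm (z - - x))\<^sup>2 / 2))"
      unfolding inner using sq[of z x] by (simp only: distrib_left mult.left_commute mult.commute)
  qed
  also have "\<dots> = ?c / 2 * exp (- \<epsilon>\<^sup>2 * (norm x)\<^sup>2 / 2) * (smoothed x + smoothed (- x))"
    unfolding smoothed_def
    by (subst Bochner_Integration.integral_add[symmetric])
       (use f_gaussian_shift_bound(1)[of 1 x] f_gaussian_shift_bound(1)[of 1 "- x"] in \<open>auto simp only: integral_mult_right_zero zero_less_one\<close>)
  also have "\<dots> = ?c * (smoothed x * exp (- \<epsilon>\<^sup>2 * (norm x)\<^sup>2 / 2))" by (simp add: smoothed_even)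
  finally show ?thesis .
qed

text \<open>For each cutoff the slice theorem gives a nonpositive integral, and division by
  \<open>log_cutoff\<close> preserves the sign. In the limit the line integral in the direction of
  \<open>y\<close> leaves a multiple of the value of \<open>f\<close> at that unit vector, and the
  factor \<open>1 / norm y\<close> completes it to \<open>f y\<close>.\<close>

lemma integral_kernel_nonpos:
  fixes G :: "'a \<Rightarrow> real" and B :: "'a set"
  assumes pd: "\<And>\<alpha> \<eta>. \<alpha> > 0 \<Longrightarrow> 0 \<le> (LINT z|lborel. f z * exp (- \<alpha> * (norm z)\<^sup>2 / 2) * cos (\<eta> \<bullet> z))"
    and B: "orthonormal B" "card B \<ge> 2"
    and G[measurable]: "G \<in> borel_measurable borel" and GD: "\<And>x. \<bar>G x\<bar> \<le> D * exp (- 1 * (norm x)\<^sup>2 / 2)"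
    and slice: "\<And>B'. orthonormal B' \<Longrightarrow> span B' \<subseteq> span B \<Longrightarrow> Suc (card B') = card B \<Longrightarrow>
        (LINT x|frame_lborel B'. G x) \<le> 0 \<and> (AE x in frame_lborel B'. isCont G x)"
  shows "(LINT y|frame_lborel B. G y * f y) \<le> 0"
proof -
  obtain K where K: "K \<ge> 0" "\<And>\<theta> t. norm \<theta> = 1 \<Longrightarrow> (1 + \<bar>t\<bar>) * \<bar>smoothed (t *\<^sub>R \<theta>)\<bar> \<le> K" using smoothed_decay by blast
  \<comment> \<open>Parametrising the line by arc length makes the cutoff independent of
    \<open>y\<close>, so one normaliser serves all directions. The substitution costs the factor
    \<open>1 / norm y\<close>.\<close>
  define Q where "Q n y = (LINT t|lborel. smoothed (t *\<^sub>R (y /\<^sub>R norm y)) * exp (- (1 / real (Suc n))\<^sup>2 * t\<^sup>2 / 2))" for n y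
  have [measurable]: "Q n \<in> borel_measurable borel" for n unfolding Q_def by measurable
  have D: "0 \<le> D" using GD[of 0] by simp
  have nonpos: "(LINT y|frame_lborel B. G y * (Q n y / norm y)) \<le> 0" for n
  proof -
    define \<epsilon> where "\<epsilon> = 1 / real (Suc n)"
    have \<epsilon>: "\<epsilon> > 0" by (simp add: \<epsilon>_def)
    define \<beta> where "\<beta> = 1 / (1 + \<epsilon>\<^sup>2)"
    define \<alpha> where "\<alpha> = \<epsilon>\<^sup>2 / (1 + \<epsilon>\<^sup>2)"
    have pos: "1 + \<epsilon>\<^sup>2 > 0" by (simp add: add_pos_nonneg)
    have \<beta>: "\<beta> > 0" and \<alpha>: "\<alpha> > 0" using \<epsilon> pos by (auto simp: \<beta>_def \<alpha>_def)
    let ?c = "sqrt (2 * pi / \<beta>) ^ DIM('a)"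
    have c: "?c > 0" using \<beta> by simp
    define \<Phi> where "\<Phi> \<xi> = exp (- \<beta> * (norm \<xi>)\<^sup>2 / 2) * (LINT z|lborel. f z * exp (- \<alpha> * (norm z)\<^sup>2 / 2) * cos ((\<beta> *\<^sub>R \<xi>) \<bullet> z))" for \<xi>
    define p where "p x = ?c * (smoothed x * exp (- \<epsilon>\<^sup>2 * (norm x)\<^sup>2 / 2))" for x
    have [measurable]: "\<Phi> \<in> borel_measurable borel" unfolding \<Phi>_def by measurable
    have ig: "integrable lborel (\<lambda>z. f z * exp (- \<alpha> * (norm z)\<^sup>2 / 2))" using f_gaussian_shift_bound(1)[OF \<alpha>, of 0] by simp
    \<comment> \<open>The inner cosine integral at frequency 0; it bounds the others because
      \<open>f\<close> is nonnegative.\<close>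
    let ?C = "LINT z|lborel. f z * exp (- \<alpha> * (norm z)\<^sup>2 / 2)"
    have ps: "p (s *\<^sub>R y) = ?c * (smoothed ((norm y * s) *\<^sub>R (y /\<^sub>R norm y)) * exp (- \<epsilon>\<^sup>2 * (norm y * s)\<^sup>2 / 2))" if "y \<noteq> 0" for y s
      using that by (simp add: p_def power_mult_distrib mult_ac)
    have i1: "integrable lborel (\<lambda>t. smoothed (t *\<^sub>R (y /\<^sub>R norm y)) * exp (- \<epsilon>\<^sup>2 * t\<^sup>2 / 2))"
      and b1: "(LINT t|lborel. \<bar>smoothed (t *\<^sub>R (y /\<^sub>R norm y)) * exp (- \<epsilon>\<^sup>2 * t\<^sup>2 / 2)\<bar>) \<le> K * log_cutoff \<epsilon>" if "y \<noteq> 0" for y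
      by (rule integrable_decay_cutoff[OF _ K(2) \<epsilon>], measurable, use that in simp)+
    have sub: "(LINT s|lborel. h (norm y * s)) = (LINT t|lborel. h t) / norm y" if "y \<noteq> 0" for y :: 'a and h :: "real \<Rightarrow> real"
      using lborel_integral_real_affine[of "norm y" h 0] that by (simp add: field_simps)
    have pint: "integrable lborel (\<lambda>s. p (s *\<^sub>R y))" if "y \<noteq> 0" for y
      unfolding ps[OF that]
      using lborel_integrable_real_affine[OF i1[OF that], of "norm y" 0] that by (intro integrable_mult_right) simp
    have pI: "(LINT s|lborel. p (s *\<^sub>R y)) = ?c * (Q n y / norm y)" if "y \<noteq> 0" for y
      unfolding ps[OF that] integral_mult_right_zero Q_def \<epsilon>_def[symmetric]
      by (subst sub[OF that, of "\<lambda>t. smoothed (t *\<^sub>R (y /\<^sub>R norm y)) * exp (- \<epsilon>\<^sup>2 * t\<^sup>2 / 2)"]) simp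
    have "(LINT y|frame_lborel B. G y * (LINT s|lborel. p (s *\<^sub>R y))) \<le> 0"
    proof (rule integral_positive_definite_nonpos[OF B G GD slice, where \<Phi>=\<Phi> and a=\<beta> and C="?C" and K="?c * (K * log_cutoff \<epsilon>)"])
      show "\<Phi> \<in> borel_measurable borel" by measurable
      \<comment> \<open>Positive definiteness of the kernel enters here, through
        \<open>pd\<close>.\<close>
      show "0 \<le> \<Phi> \<xi>" for \<xi> unfolding \<Phi>_def by (intro mult_nonneg_nonneg pd[OF \<alpha>]) simp
      show "\<beta> > 0" by (rule \<beta>)
      show "p x = (LINT \<xi>|lborel. \<Phi> \<xi> * cos (x \<bullet> \<xi>))" for x
        unfolding p_def \<Phi>_def \<alpha>_def \<beta>_def by (rule smoothed_cutoff_cosine_transform[OF \<epsilon>, symmetric])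
      show "\<Phi> \<xi> \<le> ?C * exp (- \<beta> * (norm \<xi>)\<^sup>2 / 2)" for \<xi>
      proof -
        have "(LINT z|lborel. f z * exp (- \<alpha> * (norm z)\<^sup>2 / 2) * cos ((\<beta> *\<^sub>R \<xi>) \<bullet> z)) \<le> ?C"
        proof (rule integral_mono')
          show "f z * exp (- \<alpha> * (norm z)\<^sup>2 / 2) * cos ((\<beta> *\<^sub>R \<xi>) \<bullet> z) \<le> f z * exp (- \<alpha> * (norm z)\<^sup>2 / 2)" for z
            using f_nonneg by (intro mult_left_le) auto
        qed (use ig f_nonneg in auto)
        then show ?thesis unfolding \<Phi>_def by (subst mult.commute, intro mult_right_mono) auto
      qed
      show "integrable lborel (\<lambda>s. p (s *\<^sub>R y))" if "y \<noteq> 0" for y by (rule pint[OF that])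
      show "(LINT s|lborel. \<bar>p (s *\<^sub>R y)\<bar>) \<le> ?c * (K * log_cutoff \<epsilon>) / norm y" if "y \<noteq> 0" for y
      proof -
        have "(LINT s|lborel. \<bar>p (s *\<^sub>R y)\<bar>) = ?c * ((LINT t|lborel. \<bar>smoothed (t *\<^sub>R (y /\<^sub>R norm y)) * exp (- \<epsilon>\<^sup>2 * t\<^sup>2 / 2)\<bar>) / norm y)"
          unfolding ps[OF that] abs_mult[of ?c] integral_mult_right_zero
          using c by (subst sub[OF that, of "\<lambda>t. \<bar>smoothed (t *\<^sub>R (y /\<^sub>R norm y)) * exp (- \<epsilon>\<^sup>2 * t\<^sup>2 / 2)\<bar>"]) simp
        also have "\<dots> \<le> ?c * ((K * log_cutoff \<epsilon>) / norm y)"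
          using c b1[OF that] by (intro mult_left_mono divide_right_mono) auto
        finally show ?thesis by simp
      qed
    qed
    also have "(LINT y|frame_lborel B. G y * (LINT s|lborel. p (s *\<^sub>R y))) = (LINT y|frame_lborel B. ?c * (G y * (Q n y / norm y)))"
    proof (rule integral_cong_AE)
      have "AE y in frame_lborel B. y \<noteq> 0" using AE_frame_lborel_neq_0[OF B(1)] B(2) by simp
      then show "AE y in frame_lborel B. G y * (LINT s|lborel. p (s *\<^sub>R y)) = ?c * (G y * (Q n y / norm y))"
        by eventually_elim (subst pI, assumption, rule mult.left_commute)
      show "(\<lambda>y. G y * (LINT s|lborel. p (s *\<^sub>R y))) \<in> borel_measurable (frame_lborel B)"
        unfolding p_def by measurable
    qed measurable
    finally show ?thesis using c unfolding integral_mult_right_zero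
      by (metis linorder_not_le mult_pos_pos)
  qed
  let ?S = "\<lambda>n. log_cutoff (1 / real (Suc n))"
  let ?k = "sqrt (2 * pi) ^ DIM('a)"
  have "(\<lambda>n. LINT y|frame_lborel B. G y * (Q n y / ?S n / norm y)) \<longlonglongrightarrow> (LINT y|frame_lborel B. ?k * (G y * f y))"
  proof (rule integral_dominated_convergence[where w="\<lambda>y. D * K * (exp (- 1 * (norm y)\<^sup>2 / 2) / norm y)"])
    show "integrable (frame_lborel B) (\<lambda>y. D * K * (exp (- 1 * (norm y)\<^sup>2 / 2) / norm y))"
      by (intro integrable_mult_right integrable_frame_lborel_gaussian_inverse_norm B) simp
    have nz: "AE y in frame_lborel B. y \<noteq> 0" using AE_frame_lborel_neq_0[OF B(1)] B(2) by simp
    then show "AE y in frame_lborel B. (\<lambda>n. G y * (Q n y / ?S n / norm y)) \<longlonglongrightarrow> ?k * (G y * f y)"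
    proof eventually_elim
      fix y :: 'a assume y: "y \<noteq> 0"
      let ?\<theta> = "y /\<^sub>R norm y"
      have \<theta>: "norm ?\<theta> = 1" "norm (- ?\<theta>) = 1" using y by auto
      have "(\<lambda>n. Q n y / ?S n) \<longlonglongrightarrow> ?k * f ?\<theta>"
        unfolding Q_def
      proof (rule abelian_log_average)
        show "(\<lambda>t. smoothed (t *\<^sub>R ?\<theta>)) \<in> borel_measurable borel" by measurable
        show "(1 + \<bar>t\<bar>) * \<bar>smoothed (t *\<^sub>R ?\<theta>)\<bar> \<le> K" for t by (rule K(2)[OF \<theta>(1)])
        show "((\<lambda>t. t * smoothed (t *\<^sub>R ?\<theta>)) \<longlongrightarrow> ?k * f ?\<theta>) at_top" by (rule smoothed_ray(1)[OF \<theta>(1)])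
        have "t *\<^sub>R - ?\<theta> = (- t) *\<^sub>R ?\<theta>" for t by simp
        with smoothed_ray(1)[OF \<theta>(2)] f_even[of ?\<theta>]
        show "((\<lambda>t. t * smoothed ((- t) *\<^sub>R ?\<theta>)) \<longlongrightarrow> ?k * f ?\<theta>) at_top" by (simp only:)
      qed
      then have "(\<lambda>n. G y * (Q n y / ?S n / norm y)) \<longlonglongrightarrow> G y * (?k * f ?\<theta> / norm y)"
        using y by (intro tendsto_mult tendsto_divide tendsto_const) auto
      moreover have "f ?\<theta> / norm y = f y"
        using f_hom[of "inverse (norm y)" y] y by simp
      then have "G y * (?k * f ?\<theta> / norm y) = ?k * (G y * f y)"
        by (simp only: times_divide_eq_right[symmetric] mult.left_commute)
      ultimately show "(\<lambda>n. G y * (Q n y / ?S n / norm y)) \<longlonglongrightarrow> ?k * (G y * f y)"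
        by (simp only:)
    qed
    show "AE y in frame_lborel B. norm (G y * (Q n y / ?S n / norm y)) \<le> D * K * (exp (- 1 * (norm y)\<^sup>2 / 2) / norm y)" for n
      using nz
    proof eventually_elim
      fix y :: 'a assume y: "y \<noteq> 0"
      have \<theta>: "norm (y /\<^sub>R norm y) = 1" using y by auto
      have "\<bar>Q n y\<bar> \<le> (LINT t|lborel. \<bar>smoothed (t *\<^sub>R (y /\<^sub>R norm y)) * exp (- (1 / real (Suc n))\<^sup>2 * t\<^sup>2 / 2)\<bar>)"
        unfolding Q_def by (rule integral_abs_bound)
      also have "\<dots> \<le> K * ?S n"
      proof (rule integrable_decay_cutoff(2)[OF _ K(2)[OF \<theta>]])
        show "(\<lambda>t. smoothed (t *\<^sub>R (y /\<^sub>R norm y))) \<in> borel_measurable borel" by measurable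
        show "0 < 1 / real (Suc n)" by simp
      qed
      finally have "\<bar>Q n y\<bar> \<le> K * ?S n" .
      then have "\<bar>Q n y / ?S n\<bar> \<le> K"
        using log_cutoff_nonneg[of "1 / real (Suc n)"] K(1)
        by (cases "?S n = 0") (auto simp: abs_divide divide_le_eq)
      then have "\<bar>G y\<bar> * (\<bar>Q n y / ?S n\<bar> / norm y) \<le> D * exp (- 1 * (norm y)\<^sup>2 / 2) * (K / norm y)"
        using D by (intro mult_mono GD divide_right_mono) auto
      then show "norm (G y * (Q n y / ?S n / norm y)) \<le> D * K * (exp (- 1 * (norm y)\<^sup>2 / 2) / norm y)"
        by (simp add: abs_mult mult_ac)
    qed
  qed measurable
  moreover have "(LINT y|frame_lborel B. G y * (Q n y / ?S n / norm y)) \<le> 0" for n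
  proof -
    have "(LINT y|frame_lborel B. G y * (Q n y / ?S n / norm y)) = (LINT y|frame_lborel B. inverse (?S n) * (G y * (Q n y / norm y)))"
      by (rule Bochner_Integration.integral_cong) (simp_all add: field_simps)
    also have "\<dots> \<le> 0"
      unfolding integral_mult_right_zero
      using nonpos[of n] log_cutoff_nonneg by (intro mult_nonneg_nonpos) auto
    finally show ?thesis .
  qed
  ultimately have "(LINT y|frame_lborel B. ?k * (G y * f y)) \<le> 0"
    by (intro LIMSEQ_le_const2) auto
  moreover have "?k > 0" by simp
  ultimately show ?thesis unfolding integral_mult_right_zero
    by (metis linorder_not_le mult_pos_pos)
qed

end

section \<open>Star bodies\<close>

text \<open>\<open>LEAST\<close> over the reals means something only if a minimum exists. The
  admissible dilation factors are bounded below by a positive number because \<open>K\<close> is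
  bounded, upward closed because \<open>K\<close> is star-shaped, and contain their infimum because
  \<open>K\<close> is closed.\<close>

lemma star_body_minkowski_le_iff:
  fixes K :: "'a::euclidean_space set"
  assumes K: "star_body K" and x: "x \<noteq> 0"
  shows "minkowski_functional K x > 0"
    and "a > 0 \<Longrightarrow> x /\<^sub>R a \<in> K \<longleftrightarrow> minkowski_functional K x \<le> a"
proof -
  define S where "S = {a. a > 0 \<and> x /\<^sub>R a \<in> K}"
  have S: "a > 0 \<and> x \<in> (\<lambda>y. a *\<^sub>R y) ` K \<longleftrightarrow> a \<in> S" for a
    by (auto simp: S_def intro: image_eqI[of _ _ "x /\<^sub>R a"])
  have cpt: "compact K" and seg: "\<And>y. y \<in> K \<Longrightarrow> closed_segment 0 y \<subseteq> K" and int: "0 \<in> interior K"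
    using K by (auto simp: star_body_def)
  obtain R where R: "R > 0" "\<And>y. y \<in> K \<Longrightarrow> norm y \<le> R"
    using compact_imp_bounded[OF cpt] bounded_pos by metis
  obtain e where e: "e > 0" "cball 0 e \<subseteq> K" using int mem_interior_cball by blast
  have up: "b \<in> S" if "a \<in> S" "a \<le> b" for a b
  proof -
    have "x /\<^sub>R b = (a / b) *\<^sub>R (x /\<^sub>R a)" "0 \<le> a / b" "a / b \<le> 1" using that by (auto simp: S_def field_simps)
    then have "x /\<^sub>R b \<in> closed_segment 0 (x /\<^sub>R a)" unfolding closed_segment_def by (auto intro!: exI[of _ "a / b"])
    then show ?thesis using seg[of "x /\<^sub>R a"] that by (auto simp: S_def)
  qed
  have lb: "norm x / R \<le> a" if "a \<in> S" for a
    using R(2)[of "x /\<^sub>R a"] that R(1) by (auto simp: S_def field_simps)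
  have ne: "norm x / e \<in> S"
  proof -
    have "norm (x /\<^sub>R (norm x / e)) \<le> e" using x e by simp
    then show ?thesis using x e by (auto simp: S_def)
  qed
  have bdd: "bdd_below S" by (rule bdd_belowI) (rule lb)
  define m where "m = Inf S"
  have mpos: "m > 0"
  proof -
    have "norm x / R \<le> m" unfolding m_def using lb ne by (intro cInf_greatest) auto
    moreover have "norm x / R > 0" using x R by simp
    ultimately show ?thesis by linarith
  qed
  have "x /\<^sub>R m \<in> K"
  proof -
    have "(\<lambda>n. x /\<^sub>R (m + 1 / Suc n)) \<longlonglongrightarrow> x /\<^sub>R (m + 0)"
      using mpos by (intro tendsto_scaleR tendsto_inverse tendsto_add tendsto_const LIMSEQ_Suc[OF lim_inverse_n']) auto
    moreover have "x /\<^sub>R (m + 1 / Suc n) \<in> K" for n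
    proof -
      have "Inf S < m + 1 / Suc n" by (simp add: m_def)
      then obtain a where "a \<in> S" "a < m + 1 / Suc n" using cInf_less_iff[of S] ne bdd by blast
      then have "m + 1 / Suc n \<in> S" by (rule up[OF _ less_imp_le])
      then show ?thesis by (simp add: S_def)
    qed
    ultimately show ?thesis
      using closed_sequentially[OF compact_imp_closed[OF cpt], of "\<lambda>n. x /\<^sub>R (m + 1 / Suc n)"] by simp
  qed
  with mpos have mS: "m \<in> S" by (simp add: S_def)
  have mle: "m \<le> a" if "a \<in> S" for a unfolding m_def using that bdd by (rule cInf_lower)
  have eq: "minkowski_functional K x = m"
    unfolding minkowski_functional_def S using x mS mle by (simp add: Least_equality)
  show "minkowski_functional K x > 0" using mpos eq by simp
  show "a > 0 \<Longrightarrow> x /\<^sub>R a \<in> K \<longleftrightarrow> minkowski_functional K x \<le> a"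
    unfolding eq using mle[of a] up[OF mS, of a] by (auto simp: S_def)
qed

lemma star_body_zero_mem: "star_body K \<Longrightarrow> 0 \<in> K"
  using interior_subset by (auto simp: star_body_def)

lemma minkowski_functional_0 [simp]: "minkowski_functional K 0 = 0"
  by (simp add: minkowski_functional_def)

lemma star_body_minkowski_nonneg: "star_body K \<Longrightarrow> 0 \<le> minkowski_functional K x"
  using star_body_minkowski_le_iff(1)[of K x] by (cases "x = 0") auto

lemma star_body_mem_iff:
  assumes "star_body K"
  shows "x \<in> K \<longleftrightarrow> minkowski_functional K x \<le> 1"
  using star_body_minkowski_le_iff(2)[OF assms, of x 1] star_body_zero_mem[OF assms] by (cases "x = 0") auto

lemma star_body_minkowski_scaleR:
  assumes K: "star_body K" and r: "r > 0"
  shows "minkowski_functional K (r *\<^sub>R x) = r * minkowski_functional K x"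
proof (cases "x = 0")
  case False
  let ?N = "minkowski_functional K"
  have rx: "r *\<^sub>R x \<noteq> 0" using False r by simp
  have iff: "?N (r *\<^sub>R x) \<le> a \<longleftrightarrow> r * ?N x \<le> a" if "a > 0" for a
  proof -
    have "?N (r *\<^sub>R x) \<le> a \<longleftrightarrow> (r *\<^sub>R x) /\<^sub>R a \<in> K" using star_body_minkowski_le_iff(2)[OF K rx that] by simp
    also have "(r *\<^sub>R x) /\<^sub>R a = x /\<^sub>R (a / r)" by (simp add: field_simps)
    also have "\<dots> \<in> K \<longleftrightarrow> ?N x \<le> a / r" using star_body_minkowski_le_iff(2)[OF K False, of "a / r"] that r by simp
    also have "\<dots> \<longleftrightarrow> r * ?N x \<le> a" using r by (simp add: field_simps)
    finally show ?thesis .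
  qed
  have "?N (r *\<^sub>R x) > 0" "r * ?N x > 0" using star_body_minkowski_le_iff(1)[OF K] rx False r by auto
  with iff[of "?N (r *\<^sub>R x)"] iff[of "r * ?N x"] show ?thesis by simp
qed simp

lemma star_body_minkowski_uminus:
  assumes K: "star_body K" and sym: "origin_symmetric K"
  shows "minkowski_functional K (- x) = minkowski_functional K x"
proof (cases "x = 0")
  case False
  have m: "- y \<in> K \<longleftrightarrow> y \<in> K" for y
    using sym unfolding origin_symmetric_def by (metis image_eqI minus_minus imageE)
  have iff: "minkowski_functional K (- x) \<le> a \<longleftrightarrow> minkowski_functional K x \<le> a" if "a > 0" for a
    using star_body_minkowski_le_iff(2)[OF K False that] star_body_minkowski_le_iff(2)[OF K _ that, of "- x"] False m[of "x /\<^sub>R a"]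
    by simp
  have "minkowski_functional K (- x) > 0" "minkowski_functional K x > 0"
    using star_body_minkowski_le_iff(1)[OF K] False by auto
  with iff[of "minkowski_functional K (- x)"] iff[of "minkowski_functional K x"] show ?thesis by simp
qed simp

lemma star_body_minkowski_bounds:
  fixes K :: "'a::euclidean_space set"
  assumes K: "star_body K"
  obtains R c where "R > 0" "c > 0" "\<And>x. norm x \<le> R * minkowski_functional K x" "\<And>x. minkowski_functional K x \<le> c * norm x"
proof -
  have cpt: "compact K" and int: "0 \<in> interior K" using K by (auto simp: star_body_def)
  obtain R where R: "R > 0" "\<And>y. y \<in> K \<Longrightarrow> norm y \<le> R"
    using compact_imp_bounded[OF cpt] bounded_pos by metis
  obtain e where e: "e > 0" "cball 0 e \<subseteq> K" using int mem_interior_cball by blast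
  have "norm x \<le> R * minkowski_functional K x \<and> minkowski_functional K x \<le> 1 / e * norm x" if x: "x \<noteq> 0" for x
  proof
    let ?N = "minkowski_functional K x"
    have N: "?N > 0" by (rule star_body_minkowski_le_iff(1)[OF K x])
    have "x /\<^sub>R ?N \<in> K" using star_body_minkowski_le_iff(2)[OF K x N] by simp
    from R(2)[OF this] show "norm x \<le> R * ?N" using N by (simp add: field_simps)
    have "norm (x /\<^sub>R (norm x / e)) \<le> e" using x e by simp
    then have "x /\<^sub>R (norm x / e) \<in> K" using e by auto
    then show "?N \<le> 1 / e * norm x" using star_body_minkowski_le_iff(2)[OF K x, of "norm x / e"] x e by simp
  qed
  then have "\<And>x. norm x \<le> R * minkowski_functional K x" "\<And>x. minkowski_functional K x \<le> 1 / e * norm x"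
    by (metis minkowski_functional_0 mult_zero_right norm_zero order_refl)+
  with that[of R "1 / e"] R(1) e(1) show thesis by simp
qed

text \<open>The definition of a star body asks for continuity away from 0; at 0 it follows from the
  linear upper bound.\<close>

lemma star_body_minkowski_continuous:
  fixes K :: "'a::euclidean_space set"
  assumes K: "star_body K"
  shows "isCont (minkowski_functional K) x"
proof (cases "x = 0")
  case False
  have "continuous_on (UNIV - {0}) (minkowski_functional K)" using K by (simp add: star_body_def)
  then show ?thesis using False by (simp add: continuous_on_eq_continuous_at open_delete)
next
  case True
  obtain R c where c: "c > 0" "\<And>x. minkowski_functional K x \<le> c * norm x"
    using star_body_minkowski_bounds[OF K] by metis
  have "((\<lambda>x. minkowski_functional K x) \<longlongrightarrow> 0) (at 0)"
  proof (rule Lim_null_comparison)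
    show "\<forall>\<^sub>F x in at 0. norm (minkowski_functional K x) \<le> c * norm x"
      using c star_body_minkowski_nonneg[OF K] by (intro always_eventually) auto
    show "((\<lambda>x::'a. c * norm x) \<longlongrightarrow> 0) (at 0)"
      by (intro tendsto_mult_right_zero tendsto_norm_zero tendsto_ident_at)
  qed
  then show ?thesis using True by (simp add: isCont_def)
qed

lemma star_body_minkowski_measurable:
  "star_body K \<Longrightarrow> minkowski_functional K \<in> borel_measurable borel"
  by (intro borel_measurable_continuous_onI continuous_at_imp_continuous_on ballI star_body_minkowski_continuous)

text \<open>By continuity of the gauge, points of gauge below 1 are interior, so the frontier lies
  in the level set 1.\<close>

lemma star_body_isCont_indicator:
  fixes K :: "'a::euclidean_space set"
  assumes K: "star_body K" and x: "minkowski_functional K x \<noteq> 1"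
  shows "isCont (indicator K :: 'a \<Rightarrow> real) x"
proof -
  have "x \<notin> frontier K"
  proof
    assume "x \<in> frontier K"
    moreover have "closed K" using K by (auto simp: star_body_def compact_imp_closed)
    ultimately have "x \<in> K" "x \<notin> interior K" by (auto simp: frontier_def)
    then have "minkowski_functional K x < 1" using star_body_mem_iff[OF K] x by fastforce
    moreover have "open {y. minkowski_functional K y < 1}"
      by (intro open_Collect_less continuous_at_imp_continuous_on ballI star_body_minkowski_continuous K continuous_on_const)
    moreover have "{y. minkowski_functional K y < 1} \<subseteq> K" by (auto simp: star_body_mem_iff[OF K])
    ultimately have "x \<in> interior K" by (intro interiorI[of "{y. minkowski_functional K y < 1}"]) simp_all
    with \<open>x \<notin> interior K\<close> show False by blast
  qed
  then show ?thesis by (simp add: isCont_indicator)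
qed

lemma homogeneous_kernel_inverse_minkowski:
  fixes M :: "'a::euclidean_space set"
  assumes "DIM('a) \<ge> 2" "star_body M" "origin_symmetric M"
  obtains C where "homogeneous_kernel (\<lambda>x. 1 / minkowski_functional M x) C"
proof -
  let ?N = "minkowski_functional M"
  obtain R c where R: "R > 0" "\<And>x. norm x \<le> R * ?N x" "\<And>x. ?N x \<le> c * norm x" "c > 0"
    using star_body_minkowski_bounds[OF assms(2)] by metis
  have "homogeneous_kernel (\<lambda>x. 1 / ?N x) R"
  proof
    show "2 \<le> DIM('a)" by fact
    have [measurable]: "?N \<in> borel_measurable borel" by (rule star_body_minkowski_measurable[OF assms(2)])
    show "(\<lambda>x. 1 / ?N x) \<in> borel_measurable borel" by measurable
    show "1 / ?N (r *\<^sub>R x) = 1 / ?N x / \<bar>r\<bar>" if "r \<noteq> 0" for r x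
    proof -
      \<comment> \<open>The symmetry of \<open>M\<close> is what handles negative scalars.\<close>
      have "?N (r *\<^sub>R x) = ?N (\<bar>r\<bar> *\<^sub>R x)"
        using star_body_minkowski_uminus[OF assms(2,3), of "r *\<^sub>R x"] by (cases "r \<ge> 0") auto
      also have "\<dots> = \<bar>r\<bar> * ?N x" using that by (intro star_body_minkowski_scaleR assms) auto
      finally show ?thesis by simp
    qed
    show "0 \<le> 1 / ?N x" for x using star_body_minkowski_nonneg[OF assms(2)] by simp
    show "1 / ?N x \<le> R / norm x" for x
    proof (cases "x = 0")
      case False
      then have "?N x > 0" by (rule star_body_minkowski_le_iff(1)[OF assms(2)])
      with False R(2)[of x] show ?thesis by (simp add: field_simps)
    qed simp
    show "isCont (\<lambda>x. 1 / ?N x) x" if "x \<noteq> 0" for x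
      using star_body_minkowski_le_iff(1)[OF assms(2) that]
      by (intro continuous_intros star_body_minkowski_continuous assms) auto
  qed
  then show thesis using that by blast
qed

section \<open>Trading weight for dimension\<close>

text \<open>The two bodies are kept in one signed function, since the kernel step concerns the sign
  of an integral.\<close>

definition weighted_difference :: "'a::euclidean_space set \<Rightarrow> 'a set \<Rightarrow> 'a set \<Rightarrow> nat \<Rightarrow> 'a \<Rightarrow> real" where
  "weighted_difference M K L j y = minkowski_functional M y ^ j * (indicator K y - indicator L y)"

lemma minkowski_power_indicator_gaussian_bound:
  fixes M K :: "'a::euclidean_space set"
  assumes M: "star_body M" and K: "star_body K"
  obtains D where "D \<ge> 0" "\<And>y. \<bar>minkowski_functional M y ^ j * indicator K y\<bar> \<le> D * exp (- 1 * (norm y)\<^sup>2 / 2)"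
proof -
  obtain c where c: "c > 0" "\<And>x. minkowski_functional M x \<le> c * norm x"
    using star_body_minkowski_bounds[OF M] by metis
  have "compact K" using K by (simp add: star_body_def)
  then obtain R where R: "R > 0" "\<And>y. y \<in> K \<Longrightarrow> norm y \<le> R"
    using compact_imp_bounded bounded_pos by metis
  \<comment> \<open>On the body the gauge of \<open>M\<close> is at most \<open>c * R\<close>, and
    the exponential compensates the Gaussian at distance \<open>R\<close>.\<close>
  let ?D = "(c * R) ^ j * exp (R\<^sup>2 / 2)"
  have "\<bar>minkowski_functional M y ^ j * indicator K y\<bar> \<le> ?D * exp (- 1 * (norm y)\<^sup>2 / 2)" for y
  proof (cases "y \<in> K")
    case True
    have nn: "0 \<le> minkowski_functional M y" by (rule star_body_minkowski_nonneg[OF M])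
    have "minkowski_functional M y \<le> c * R"
      using c(2)[of y] R(2)[OF True] c(1) by (meson mult_left_mono order_less_imp_le order_trans)
    then have 1: "minkowski_functional M y ^ j \<le> (c * R) ^ j" using nn by (intro power_mono)
    have "(norm y)\<^sup>2 \<le> R\<^sup>2" using R(2)[OF True] by (intro power_mono) auto
    then have 2: "1 \<le> exp (R\<^sup>2 / 2) * exp (- 1 * (norm y)\<^sup>2 / 2)" by (simp add: exp_add[symmetric])
    have "minkowski_functional M y ^ j * 1 \<le> (c * R) ^ j * (exp (R\<^sup>2 / 2) * exp (- 1 * (norm y)\<^sup>2 / 2))"
      using 1 2 c R by (intro mult_mono) auto
    then show ?thesis using True nn by (simp add: mult.assoc)
  qed (use c R in auto)
  then show thesis using that[of ?D] c R by simp
qed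

text \<open>Jumps occur only where the gauge of \<open>K\<close> or \<open>L\<close> equals 1. That
  the boundary is null in the whole space would say nothing about a proper subspace; homogeneity of
  the gauge makes it null in each of them.\<close>

lemma AE_isCont_weighted_difference:
  fixes M K L :: "'a::euclidean_space set"
  assumes M: "star_body M" and K: "star_body K" and L: "star_body L" and B: "orthonormal B"
  shows "AE x in frame_lborel B. isCont (weighted_difference M K L j) x"
proof -
  have "AE x in frame_lborel B. minkowski_functional K x \<noteq> 1" "AE x in frame_lborel B. minkowski_functional L x \<noteq> 1"
    using AE_frame_lborel_homogeneous_neq_1[OF B] star_body_minkowski_measurable star_body_minkowski_scaleR K L by blast+
  then show ?thesis
  proof eventually_elim
    fix x assume "minkowski_functional K x \<noteq> 1" "minkowski_functional L x \<noteq> 1"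
    then show "isCont (weighted_difference M K L j) x"
      unfolding weighted_difference_def[abs_def]
      by (intro continuous_intros star_body_minkowski_continuous star_body_isCont_indicator M K L)
  qed
qed

lemma weighted_difference_step:
  fixes M K L :: "'a::euclidean_space set"
  assumes dim: "DIM('a) \<ge> 2"
    and M: "star_body M" "origin_symmetric M"
    and pd: "positive_definite_distribution (distribution_of (\<lambda>x. 1 / minkowski_functional M x))"
    and K: "star_body K" and L: "star_body L"
    and B: "orthonormal B" "card B \<ge> 2"
    and slice: "\<And>B'. orthonormal B' \<Longrightarrow> Suc (card B') = card B \<Longrightarrow>
      (LINT x|frame_lborel B'. weighted_difference M K L (Suc j) x) \<le> 0"
  shows "(LINT x|frame_lborel B. weighted_difference M K L j x) \<le> 0"
proof -
  let ?G = "weighted_difference M K L"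
  have [measurable]: "minkowski_functional M \<in> borel_measurable borel" by (rule star_body_minkowski_measurable[OF M(1)])
  have [measurable]: "K \<in> sets borel" "L \<in> sets borel" using K L by (auto simp: star_body_def intro: borel_compact)
  have [measurable]: "?G i \<in> borel_measurable borel" for i unfolding weighted_difference_def[abs_def] by measurable
  obtain C where "homogeneous_kernel (\<lambda>x. 1 / minkowski_functional M x) C"
    using homogeneous_kernel_inverse_minkowski[OF dim M] by blast
  then interpret homogeneous_kernel "\<lambda>x. 1 / minkowski_functional M x" C .
  obtain D1 where D1: "\<And>y. \<bar>minkowski_functional M y ^ Suc j * indicator K y\<bar> \<le> D1 * exp (- 1 * (norm y)\<^sup>2 / 2)"
    using minkowski_power_indicator_gaussian_bound[OF M(1) K] by metis
  obtain D2 where D2: "\<And>y. \<bar>minkowski_functional M y ^ Suc j * indicator L y\<bar> \<le> D2 * exp (- 1 * (norm y)\<^sup>2 / 2)"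
    using minkowski_power_indicator_gaussian_bound[OF M(1) L] by metis
  have "(LINT x|frame_lborel B. ?G (Suc j) x * (1 / minkowski_functional M x)) \<le> 0"
  proof (rule integral_kernel_nonpos[OF _ B])
    show "0 \<le> (LINT z|lborel. 1 / minkowski_functional M z * exp (- \<alpha> * (norm z)\<^sup>2 / 2) * cos (\<eta> \<bullet> z))" if "\<alpha> > 0" for \<alpha> \<eta>
    proof (rule positive_definite_cos_integral_nonneg[OF pd that])
      show "integrable lborel (\<lambda>z. 1 / minkowski_functional M z * exp (- \<alpha> * (norm z)\<^sup>2 / 2))"
        using f_gaussian_shift_bound(1)[OF that, of 0] by simp
    qed
    show "?G (Suc j) \<in> borel_measurable borel" by measurable
    show "\<bar>?G (Suc j) x\<bar> \<le> (D1 + D2) * exp (- 1 * (norm x)\<^sup>2 / 2)" for x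
    proof -
      have "?G (Suc j) x = minkowski_functional M x ^ Suc j * indicator K x - minkowski_functional M x ^ Suc j * indicator L x"
        by (simp only: weighted_difference_def right_diff_distrib)
      then have "\<bar>?G (Suc j) x\<bar> \<le> \<bar>minkowski_functional M x ^ Suc j * indicator K x\<bar> + \<bar>minkowski_functional M x ^ Suc j * indicator L x\<bar>"
        by (simp only: abs_triangle_ineq4)
      also have "\<dots> \<le> D1 * exp (- 1 * (norm x)\<^sup>2 / 2) + D2 * exp (- 1 * (norm x)\<^sup>2 / 2)"
        by (intro add_mono D1 D2)
      finally show ?thesis by (simp only: distrib_right)
    qed
    show "(LINT x|frame_lborel B'. ?G (Suc j) x) \<le> 0 \<and> (AE x in frame_lborel B'. isCont (?G (Suc j)) x)"
      if "orthonormal B'" "span B' \<subseteq> span B" "Suc (card B') = card B" for B'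
      using slice[OF that(1,3)] AE_isCont_weighted_difference[OF M(1) K L that(1)] by blast
  qed
  also have "(LINT x|frame_lborel B. ?G (Suc j) x * (1 / minkowski_functional M x)) = (LINT x|frame_lborel B. ?G j x)"
  proof (rule integral_cong_AE)
    have "AE x in frame_lborel B. x \<noteq> 0" using AE_frame_lborel_neq_0[OF B(1)] B(2) by simp
    then show "AE x in frame_lborel B. ?G (Suc j) x * (1 / minkowski_functional M x) = ?G j x"
    proof eventually_elim
      fix x :: 'a assume "x \<noteq> 0"
      then have "minkowski_functional M x > 0" by (rule star_body_minkowski_le_iff(1)[OF M(1)])
      then show "?G (Suc j) x * (1 / minkowski_functional M x) = ?G j x" by (simp add: weighted_difference_def)
    qed
  qed measurable
  finally show ?thesis .
qed

theorem theorem4: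
  fixes M K L :: "(real ^ 'n) set" and k :: nat
  assumes "CARD('n) \<ge> 2"
    and "star_body M" and "origin_symmetric M"
    and "positive_definite_distribution (distribution_of (\<lambda>x. 1 / minkowski_functional M x))"
    and "star_body K" and "origin_symmetric K"
    and "star_body L" and "origin_symmetric L"
    and "1 \<le> k" and "k < CARD('n)"
    and "\<And>H. H \<in> grassmannian (CARD('n) - k) \<Longrightarrow>
           (LINT x:K \<inter> H|subspace_lborel H. minkowski_functional M x ^ k)
           \<le> (LINT x:L \<inter> H|subspace_lborel H. minkowski_functional M x ^ k)"
  shows "measure lebesgue K \<le> measure lebesgue L"
proof -
  note M = assms(2,3) and pd = assms(4) and K = assms(5) and L = assms(7)
  let ?N = "minkowski_functional M"
  have [measurable]: "?N \<in> borel_measurable borel" by (rule star_body_minkowski_measurable[OF M(1)])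
  have KL[measurable]: "K \<in> sets borel" "L \<in> sets borel" using K L by (auto simp: star_body_def intro: borel_compact)
  have int: "integrable (frame_lborel B) (\<lambda>x. ?N x ^ j * indicator A x)"
    if B: "orthonormal B" and A: "star_body A" for B A j
  proof -
    have [measurable]: "A \<in> sets borel" using A by (auto simp: star_body_def intro: borel_compact)
    obtain D where D: "D \<ge> 0" "\<And>y. \<bar>?N y ^ j * indicator A y\<bar> \<le> D * exp (- 1 * (norm y)\<^sup>2 / 2)"
      using minkowski_power_indicator_gaussian_bound[OF M(1) A] by metis
    show ?thesis
    proof (rule Bochner_Integration.integrable_bound)
      show "integrable (frame_lborel B) (\<lambda>y. D * exp (- 1 * (norm y)\<^sup>2 / 2))"
        by (intro integrable_mult_right integrable_frame_lborel_gaussian B) simp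
      show "AE y in frame_lborel B. norm (?N y ^ j * indicator A y) \<le> norm (D * exp (- 1 * (norm y)\<^sup>2 / 2))"
        unfolding real_norm_def by (rule AE_I2) (rule order_trans[OF D(2) abs_ge_self])
    qed measurable
  qed
  have split: "(LINT x|frame_lborel B. weighted_difference M K L j x)
      = (LINT x|frame_lborel B. ?N x ^ j * indicator K x) - (LINT x|frame_lborel B. ?N x ^ j * indicator L x)"
    if "orthonormal B" for B j
    unfolding weighted_difference_def right_diff_distrib
    by (rule Bochner_Integration.integral_diff[OF int[OF that K] int[OF that L]])
  \<comment> \<open>Weight and dimension add up to the ambient dimension throughout. The induction
    on the weight runs downwards, from \<open>k\<close>, which is the hypothesis, to 0, which is the
    comparison of volumes.\<close>
  have "(LINT x|frame_lborel B. weighted_difference M K L j x) \<le> 0"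
    if "j \<le> k" "orthonormal B" "card B + j = CARD('n)" for j B
    using that
  proof (induction j arbitrary: B rule: inc_induct)
    case base
    let ?H = "span B"
    have "dim ?H = CARD('n) - k" using orthonormal_card[OF base(1)] base(2) by simp
    then have "?H \<in> grassmannian (CARD('n) - k)" by (simp add: grassmannian_def)
    from assms(11)[OF this]
    have le: "(LINT x:K \<inter> ?H|frame_lborel B. ?N x ^ k) \<le> (LINT x:L \<inter> ?H|frame_lborel B. ?N x ^ k)"
      by (simp only: subspace_lborel_eq_frame[OF base(1)])
    have [measurable]: "?H \<in> sets borel" by (simp add: closed_subspace)
    \<comment> \<open>The measure is concentrated on \<open>?H\<close>, so intersecting with it
      changes nothing.\<close>
    have "(LINT x:A \<inter> ?H|frame_lborel B. ?N x ^ k) = (LINT x|frame_lborel B. ?N x ^ k * indicator A x)"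
      if [measurable]: "A \<in> sets borel" for A
      unfolding set_lebesgue_integral_def
    proof (rule integral_cong_AE)
      show "AE x in frame_lborel B. indicator (A \<inter> ?H) x *\<^sub>R ?N x ^ k = ?N x ^ k * indicator A x"
        using AE_frame_lborel_span by eventually_elim (auto simp: indicator_def)
    qed measurable
    with le KL show ?case unfolding split[OF base(1)] by simp
  next
    case (step j)
    show ?case
    proof (rule weighted_difference_step[OF _ M pd K L step.prems(1)])
      show "2 \<le> DIM(real ^ 'n)" using assms(1) by simp
      \<comment> \<open>From \<open>j < k\<close> and \<open>k < CARD('n)\<close> the weight is at
        most \<open>CARD('n) - 2\<close>, leaving dimension at least 2.\<close>
      show "card B \<ge> 2" using step.prems(2) step.hyps assms(10) by linarith
      show "(LINT x|frame_lborel B'. weighted_difference M K L (Suc j) x) \<le> 0"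
        if "orthonormal B'" "Suc (card B') = card B" for B'
        using step.IH[OF that(1)] that(2) step.prems(2) by simp
    qed
  qed
  from this[of 0 Basis]
  have "(LINT x|frame_lborel Basis. weighted_difference M K L 0 x) \<le> 0"
    by (simp add: orthonormal_Basis)
  \<comment> \<open>A zeroth power equals 1 also at the origin, where the gauge vanishes, so plain
    indicators remain.\<close>
  then have "(LINT x|lborel. indicat_real K x) \<le> (LINT x|lborel. indicat_real L x)"
    unfolding split[OF orthonormal_Basis] by (simp add: frame_lborel_UNIV[OF orthonormal_Basis])
  then show ?thesis using KL by simp
qed

end
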